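(* Let $\Omega\subset\mathbb C$ be a bounded, simply connected domain and $\psi:\mathbb D\to\Omega$ a conformal map of $\mathbb D$ onto $\Omega$. If $|\psi'|^2\in\bigcap_{p>1}\mathrm{B}_p(\mathbb D)$, then for each $1<p<\infty$ and each $\sigma\in\mathrm{B}_p(\Omega)$, the Bergman projection $\Pi_\Omega$ is bounded on $L^p(\Omega,\sigma)$.
   Context: $\mathbb D$ is the open unit disc, $\mathbb T$ the unit circle, $dA$ normalized area measure. A weight is a locally integrable, a.e. positive function. For measurable $f$, $0<p<\infty$, weight $v$, measurable $E$: $\langle f\rangle_{p,v,E}=\big(\int_E|f|^pv\,dA\big)^{1/p}/\big(\int_Ev\,dA\big)^{1/p}$; for $p=\infty$ it is $\|f\|_{L^\infty(E)}$; $v$ omitted when $v\equiv1$, $p$ omitted when $p=1$. For an arc $I\subset\mathbb T$ with center $e^{i\theta_0}$ and normalized arclength $\ell(I)$ ($\ell(\mathbb T)=1$), $Q_I=\{re^{i\theta}\in\mathbb D:1-r\le\ell(I),|\theta-\theta_0|\le\ell(I)/2\}$. For $1\le p<\infty$, a weight $u$ on $\mathbb D$ belongs to $\mathrm{B}_p(\mathbb D)$ if $\sup_I\langle u\rangle_{Q_I}\langle u^{-1}\rangle_{\frac1{p-1},Q_I}<\infty$ (supremum over all arcs; $\frac1{p-1}=\infty$ when $p=1$). A weight $\sigma$ on $\Omega$ belongs to $\mathrm{B}_p(\Omega)$ if $\sup_I\langle\sigma\rangle_{\psi(Q_I)}\langle\sigma^{-1}\rangle_{\frac1{p-1},\psi(Q_I)}<\infty$.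 $\Pi_\Omega$ is the orthogonal projection of $L^2(\Omega)$ onto its closed subspace of holomorphic functions; boundedness on $L^p(\Omega,\sigma)$ (the $L^p$ space of $\sigma\,dA$) means $\|\Pi_\Omega f\|_{L^p(\Omega,\sigma)}\le C\|f\|_{L^p(\Omega,\sigma)}$ on a dense class, i.e. $\Pi_\Omega$ extends to a bounded operator. *)

theory Defs
  imports "HOL-Complex_Analysis.Complex_Analysis"
begin

definition dA :: "complex measure" where
  "dA = density lebesgue (\<lambda>_. ennreal (1 / pi))"

abbreviation unit_disc :: "complex set" where
  "unit_disc \<equiv> ball 0 1"

definition weight_on :: "complex set \<Rightarrow> (complex \<Rightarrow> real) \<Rightarrow> bool" where
  "weight_on S w \<longleftrightarrow>
     w \<in> borel_measurable (restrict_space lebesgue S) \<and>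
     (\<forall>K. compact K \<and> K \<subseteq> S \<longrightarrow> (\<integral>\<^sup>+ z\<in>K. ennreal \<bar>w z\<bar> \<partial>lebesgue) < \<infinity>) \<and>
     (AE z in lebesgue. z \<in> S \<longrightarrow> w z > 0)"

definition avg :: "real \<Rightarrow> (complex \<Rightarrow> real) \<Rightarrow> complex set \<Rightarrow> (complex \<Rightarrow> real) \<Rightarrow> ennreal" where
  "avg p v E f =
     (let N = (\<integral>\<^sup>+ z\<in>E. ennreal (\<bar>f z\<bar> powr p * v z) \<partial>dA);
          D = (\<integral>\<^sup>+ z\<in>E. ennreal (v z) \<partial>dA);
          R = N / D
      in if R = \<infinity> then \<infinity> else ennreal (enn2real R powr (1 / p)))"

text \<open>Box Q_I over the arc I with center e^{i theta0} and normalized length l (0 < l \<le> 1).\<close>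
definition Qbox :: "real \<Rightarrow> real \<Rightarrow> complex set" where
  "Qbox \<theta>0 l = {z \<in> unit_disc. \<exists>r \<theta>. z = complex_of_real r * cis \<theta> \<and> 0 \<le> r \<and>
                                  1 - r \<le> l \<and> \<bar>\<theta> - \<theta>0\<bar> \<le> l / 2}"

definition Bp_disc :: "real \<Rightarrow> (complex \<Rightarrow> real) \<Rightarrow> bool" where
  "Bp_disc p u \<longleftrightarrow> weight_on unit_disc u \<and>
     (\<exists>C::real. \<forall>\<theta>0 l. 0 < l \<and> l \<le> 1 \<longrightarrow>
        avg 1 (\<lambda>_. 1) (Qbox \<theta>0 l) u * avg (1 / (p - 1)) (\<lambda>_. 1) (Qbox \<theta>0 l) (\<lambda>z. 1 / u z)
          \<le> ennreal C)"

definition Bp_dom :: "(complex \<Rightarrow> complex) \<Rightarrow> complex set \<Rightarrow> real \<Rightarrow> (complex \<Rightarrow> real) \<Rightarrow> bool" where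
  "Bp_dom \<psi> \<Omega> p \<sigma> \<longleftrightarrow> weight_on \<Omega> \<sigma> \<and>
     (\<exists>C::real. \<forall>\<theta>0 l. 0 < l \<and> l \<le> 1 \<longrightarrow>
        avg 1 (\<lambda>_. 1) (\<psi> ` Qbox \<theta>0 l) \<sigma> *
        avg (1 / (p - 1)) (\<lambda>_. 1) (\<psi> ` Qbox \<theta>0 l) (\<lambda>z. 1 / \<sigma> z)
          \<le> ennreal C)"

definition L2_on :: "complex set \<Rightarrow> (complex \<Rightarrow> complex) \<Rightarrow> bool" where
  "L2_on \<Omega> f \<longleftrightarrow> f \<in> borel_measurable (restrict_space dA \<Omega>) \<and>
     (\<integral>\<^sup>+ z\<in>\<Omega>. ennreal ((cmod (f z))\<^sup>2) \<partial>dA) < \<infinity>"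

definition Lp_on :: "complex set \<Rightarrow> real \<Rightarrow> (complex \<Rightarrow> real) \<Rightarrow> (complex \<Rightarrow> complex) \<Rightarrow> bool" where
  "Lp_on \<Omega> p \<sigma> f \<longleftrightarrow> f \<in> borel_measurable (restrict_space dA \<Omega>) \<and>
     (\<integral>\<^sup>+ z\<in>\<Omega>. ennreal (cmod (f z) powr p * \<sigma> z) \<partial>dA) < \<infinity>"

definition is_bergman_proj :: "complex set \<Rightarrow> (complex \<Rightarrow> complex) \<Rightarrow> (complex \<Rightarrow> complex) \<Rightarrow> bool" where
  "is_bergman_proj \<Omega> f g \<longleftrightarrow> L2_on \<Omega> f \<and> g holomorphic_on \<Omega> \<and> L2_on \<Omega> g \<and>
     (\<forall>h. h holomorphic_on \<Omega> \<and> L2_on \<Omega> h \<longrightarrow>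
        (LINT z:\<Omega>|dA. (f z - g z) * cnj (h z)) = 0)"

text \<open>Boundedness of Pi_Omega on L^p(Omega, sigma) on the dense class L^2 \<inter> L^p(sigma):
  \<integral> |Pi f|^p sigma \<le> C \<integral> |f|^p sigma (equivalently ||Pi f|| \<le> C^(1/p) ||f||).\<close>
definition bergman_bounded :: "complex set \<Rightarrow> real \<Rightarrow> (complex \<Rightarrow> real) \<Rightarrow> bool" where
  "bergman_bounded \<Omega> p \<sigma> \<longleftrightarrow>
     (\<exists>C::real. \<forall>f g. L2_on \<Omega> f \<and> Lp_on \<Omega> p \<sigma> f \<and> is_bergman_proj \<Omega> f g \<longrightarrow>
        (\<integral>\<^sup>+ z\<in>\<Omega>. ennreal (cmod (g z) powr p * \<sigma> z) \<partial>dA)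
          \<le> ennreal C * (\<integral>\<^sup>+ z\<in>\<Omega>. ennreal (cmod (f z) powr p * \<sigma> z) \<partial>dA))"

end

theory Submission
  imports Defs
begin

text \<open>
  Composition with \<open>\<psi>\<close> intertwines the two Bergman projections, so with \<open>u = |\<psi>'|\<^sup>2\<close> and \<open>\<tau> = \<sigma> \<circ> \<psi>\<close> one has to
  bound the operator with kernel \<open>|1 - cnj z * w|\<close> to the power \<open>-2\<close> on the disc with weight
  \<open>\<omega> = \<tau> * u powr (1 - p/2)\<close>, where \<open>\<tau>\<close> is an \<open>A\<^sub>p\<close> weight on Carleson boxes relative to the measure \<open>u dA\<close>.

  Two facts make \<open>\<omega>\<close> satisfy a self-improved \<open>B\<^sub>p\<close> condition. First, \<open>A\<^sub>p\<close> forces the top half of each box to carry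
  a fixed proportion of the mass of \<open>\<tau> u\<close> and of its dual weight; as the bottom half is tiled by two boxes
  of half the size, the mass near the boundary decays geometrically. Second, \<open>u\<close> is in every \<open>B\<^sub>q\<close> and the negative
  powers of \<open>\<psi>'\<close> are holomorphic, so \<open>u(z)\<close> is at least the mean of \<open>u\<close> over a box times an arbitrarily
  small power of the relative distance of \<open>z\<close> to the boundary. The geometric gain absorbs this loss, and what is left
  of the gain sums the dyadic decomposition of the kernel by two applications of Hoelder's inequality.
\<close>

section \<open>Conformal change of variables\<close>

text \<open>The exponent \<open>1 - p/2\<close> in \<omega> balances two effects: the projection
  acts on f(\<psi>) times \<psi>', whose p-th power costs \<open>u powr (p/2)\<close>, while the
  change of variables supplies one factor \<open>u\<close>. Put \<open>v = u * \<tau>\<close>,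
  \<open>v' = u * \<tau> powr (- 1 / (p - 1))\<close> and \<open>q = p / (p - 1)\<close>. Then
  \<omega> equals \<open>v * u powr (- p/2)\<close>, and its dual weight equals
  \<open>v' * u powr (- q/2)\<close>. Both contain only negative powers of \<open>u\<close>, so
  lower bounds for \<open>u\<close> suffice. On a box of size \<open>l\<close> with mass \<mu> for
  \<open>u dA\<close> they contribute \<open>l^2/\<mu>\<close> to the powers \<open>p/2\<close> and
  \<open>q/2\<close>; since \<open>p/2 + (q/2) * (p - 1) = p\<close>, this converts the
  \<open>\<mu> powr p\<close> of the A_p condition into \<open>(l^2) powr p\<close>. The order of
  choices is the crux. The decay rate of \<open>v\<close> and \<open>v'\<close> depends on \<sigma>
  and may be arbitrarily slow, so the loss in the bound for \<open>u\<close> must be made small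
  after that rate is known. This is why all q > 1 are required of |\<psi>'|^2: the loss is the power
  \<open>2/N\<close>, obtained from \<open>q = 1 + 1/N\<close>.\<close>

text \<open>The library proves the change of variables formula only on \<open>real^'n\<close>; the isometry with
  \<open>real^2\<close> carries it over to conformal maps.\<close>
definition vec_complex :: "real^2 \<Rightarrow> complex" where
  "vec_complex v = Complex (v$1) (v$2)"

definition complex_vec :: "complex \<Rightarrow> real^2" where
  "complex_vec z = vector [Re z, Im z]"

lemma vec_complex_inverse [simp]: "complex_vec (vec_complex v) = v" "vec_complex (complex_vec z) = z"
  by (simp_all add: vec_complex_def complex_vec_def vec_eq_iff forall_2 complex_eq_iff)

lemma linear_vec_complex: "linear vec_complex"
  by (rule linearI) (simp_all add: vec_complex_def complex_eq_iff)

lemma linear_complex_vec: "linear complex_vec"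
  by (rule linearI) (simp_all add: complex_vec_def vec_eq_iff forall_2)

lemma measurable_vec_complex [measurable]: "vec_complex \<in> borel_measurable borel"
  by (intro borel_measurable_continuous_onI linear_continuous_on linear_conv_bounded_linear[THEN iffD1] linear_vec_complex)

text \<open>Lebesgue measure is determined by its values on boxes, and the identification of
  coordinates carries boxes to boxes with the same side lengths.\<close>

lemma lborel_distr_vec_complex: "distr lborel borel vec_complex = lborel"
proof (rule lborel_eqI[symmetric])
  fix l u :: complex
  assume le: "\<And>b. b \<in> Basis \<Longrightarrow> l \<bullet> b \<le> u \<bullet> b"
  have le': "Re l \<le> Re u" "Im l \<le> Im u"
    using le[of 1] le[of \<i>] by (auto simp: Basis_complex_def)
  have "vec_complex -` box l u = box (complex_vec l) (complex_vec u)"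
    by (auto simp: box_def vec_complex_def complex_vec_def Basis_complex_def Basis_vec_def forall_2 inner_axis)
  then have "emeasure (distr lborel borel vec_complex) (box l u) = emeasure lborel (box (complex_vec l) (complex_vec u))"
    by (simp add: emeasure_distr)
  also have "\<dots> = (\<Prod>b\<in>Basis. (complex_vec u - complex_vec l) \<bullet> b)"
  proof (intro emeasure_lborel_box)
    have "\<forall>i. complex_vec l $ i \<le> complex_vec u $ i"
      using le' by (simp add: complex_vec_def forall_2)
    then show "complex_vec l \<bullet> b \<le> complex_vec u \<bullet> b" if "b \<in> Basis" for b
      using that by (auto simp: Basis_vec_def inner_axis)
  qed
  also have "(\<Prod>b\<in>Basis. (complex_vec u - complex_vec l) \<bullet> b) = (\<Prod>i\<in>UNIV. (complex_vec u - complex_vec l) $ i)"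
    by (intro prod.reindex_bij_witness[where i="\<lambda>i. axis i 1" and j="\<lambda>b. SOME i. b = axis i 1"])
      (auto simp: Basis_vec_def inner_axis axis_eq_axis)
  finally show "emeasure (distr lborel borel vec_complex) (box l u) = (\<Prod>b\<in>Basis. (u - l) \<bullet> b)"
    by (simp add: Basis_complex_def complex_vec_def UNIV_2)
qed simp

lemma lebesgue_distr_vec_complex: "distr lebesgue lebesgue vec_complex = lebesgue"
  and measurable_vec_complex_lebesgue [measurable]: "vec_complex \<in> lebesgue \<rightarrow>\<^sub>M lebesgue"
proof -
  have X: "vec_complex \<in> lebesgue \<rightarrow>\<^sub>M lborel"
    by (simp add: measurable_completion)
  have d: "distr lebesgue lborel vec_complex = lborel"
  proof -
    have "distr lebesgue lborel vec_complex = distr lborel lborel vec_complex"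
      by (rule distr_completion) simp
    also have "\<dots> = distr lborel borel vec_complex"
      by (rule distr_cong) auto
    finally show ?thesis by (simp add: lborel_distr_vec_complex)
  qed
  show "vec_complex \<in> lebesgue \<rightarrow>\<^sub>M lebesgue"
    by (rule completion.measurable_completion2[OF X]) (simp add: d)
  show "distr lebesgue lebesgue vec_complex = lebesgue"
    using completion.completion_distr_eq[OF X] d by simp
qed

text \<open>No finiteness is assumed: if the image had finite measure, the Jacobian would be
  absolutely integrable, so a divergent Jacobian integral forces an image of infinite
  measure.\<close>

lemma emeasure_lebesgue_differentiable_image:
  fixes f :: "real^'n::{finite,wellorder} \<Rightarrow> real^'n::_"
  assumes S: "S \<in> sets lebesgue"
      and der: "\<And>x. x \<in> S \<Longrightarrow> (f has_derivative f' x) (at x within S)"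
      and inj: "inj_on f S"
  shows "emeasure lebesgue (f ` S) = (\<integral>\<^sup>+x\<in>S. ennreal \<bar>det (matrix (f' x))\<bar> \<partial>lebesgue)"
proof -
  let ?J = "\<lambda>x. \<bar>det (matrix (f' x))\<bar>"
  have fS: "f ` S \<in> sets lebesgue"
    using S der by (intro differentiable_image_in_sets_lebesgue)
      (auto simp: differentiable_on_def differentiable_def)
  have J: "?J \<in> borel_measurable (lebesgue_on S)"
    using borel_measurable_det_Jacobian[OF S der] by measurable
  have eq: "(\<integral>\<^sup>+x\<in>S. ennreal (?J x) \<partial>lebesgue) = (\<integral>\<^sup>+x. ennreal (?J x) \<partial>lebesgue_on S)"
    using S by (simp add: nn_integral_restrict_space)
  show ?thesis
  proof (cases "(\<integral>\<^sup>+x. ennreal (?J x) \<partial>lebesgue_on S) = \<infinity>")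
    case False
    then have int: "integrable (lebesgue_on S) ?J"
      using J by (intro integrableI_nonneg) (auto simp: top.not_eq_extremum)
    then have "(?J has_integral integral\<^sup>L (lebesgue_on S) ?J) S"
      using S by (rule has_integral_integral_lebesgue_on)
    then have "f ` S \<in> lmeasurable \<and> measure lebesgue (f ` S) = integral\<^sup>L (lebesgue_on S) ?J"
      using has_measure_differentiable_image[OF S der inj] by blast
    then show ?thesis
      using nn_integral_eq_integral[OF int] by (simp add: eq emeasure_eq_measure2)
  next
    case True
    have "f ` S \<notin> lmeasurable"
    proof
      assume "f ` S \<in> lmeasurable"
      then have "?J absolutely_integrable_on S"
        using measurable_differentiable_image_alt[OF S der inj] by blast
      then have "integrable (lebesgue_on S) ?J"
        using S by (simp add: set_integrable_def integrable_restrict_space)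
      then show False
        using nn_integral_eq_integral[of "lebesgue_on S" ?J] True by simp
    qed
    then have "\<not> emeasure lebesgue (f ` S) < \<infinity>"
      using fS by (simp add: fmeasurable_def)
    then show ?thesis
      unfolding eq True by (metis infinity_ennreal_def top.not_eq_extremum)
  qed
qed

lemma holomorphic_borel_measurable:
  assumes "f holomorphic_on S" "open S"
  shows "f \<in> borel_measurable (lebesgue_on S)"
  using assms by (intro continuous_imp_measurable_on_sets_lebesgue holomorphic_on_imp_continuous_on) auto

lemma emeasure_conformal_image:
  assumes S: "S \<in> sets lebesgue" and "S \<subseteq> U" "open U" "\<psi> holomorphic_on U" "inj_on \<psi> S"
  shows "\<psi> ` S \<in> sets lebesgue"
    and "emeasure lebesgue (\<psi> ` S) = (\<integral>\<^sup>+z\<in>S. ennreal ((cmod (deriv \<psi> z))\<^sup>2) \<partial>lebesgue)"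
proof -
  have der: "(\<psi> has_field_derivative deriv \<psi> z) (at z)" if "z \<in> S" for z
    using assms that holomorphic_derivI by blast
  then have "\<psi> differentiable_on S"
    by (auto simp: differentiable_on_def differentiable_def has_field_derivative_def
         intro: has_derivative_at_withinI)
  then show im: "\<psi> ` S \<in> sets lebesgue"
    using S by (intro differentiable_image_in_sets_lebesgue) auto
  let ?S = "vec_complex -` S"
  define g where "g = complex_vec \<circ> \<psi> \<circ> vec_complex"
  define g' where "g' v = complex_vec \<circ> (*) (deriv \<psi> (vec_complex v)) \<circ> vec_complex" for v
  have S': "?S \<in> sets lebesgue"
    using measurable_sets[OF measurable_vec_complex_lebesgue S] by simp
  have bl: "bounded_linear vec_complex" "bounded_linear complex_vec"
    using linear_vec_complex linear_complex_vec linear_conv_bounded_linear by blast+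
  have dg: "(g has_derivative g' v) (at v within ?S)" if "v \<in> ?S" for v
  proof -
    have "(\<psi> has_derivative (*) (deriv \<psi> (vec_complex v))) (at (vec_complex v))"
      using der[of "vec_complex v"] that by (simp add: has_field_derivative_def)
    from diff_chain_at[OF diff_chain_at[OF bounded_linear_imp_has_derivative[OF bl(1)] this]
        bounded_linear_imp_has_derivative[OF bl(2)]]
    show ?thesis
      unfolding g_def g'_def comp_assoc by (rule has_derivative_at_withinI)
  qed
  have inj: "inj_on g ?S"
  proof (rule inj_onI)
    fix x y assume "x \<in> ?S" "y \<in> ?S" "g x = g y"
    then have "vec_complex (g x) = vec_complex (g y)" by simp
    then have "\<psi> (vec_complex x) = \<psi> (vec_complex y)"
      by (simp add: g_def)
    then have "vec_complex x = vec_complex y"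
      using \<open>inj_on \<psi> S\<close> \<open>x \<in> ?S\<close> \<open>y \<in> ?S\<close> by (auto dest: inj_onD)
    then show "x = y"
      by (metis vec_complex_inverse(1))
  qed
  \<comment> \<open>Multiplication by x + iy has, in the basis 1, i, the matrix with rows (x, -y)
    and (y, x), whose determinant is x^2 + y^2.\<close>
  have det: "\<bar>det (matrix (g' v))\<bar> = (cmod (deriv \<psi> (vec_complex v)))\<^sup>2" for v
  proof -
    have "vec_complex (axis 1 1) = 1" "vec_complex (axis 2 1) = \<i>"
      by (auto simp: vec_complex_def complex_eq_iff axis_def)
    then show ?thesis
      by (simp add: det_2 matrix_def g'_def complex_vec_def cmod_power2) (simp add: power2_eq_square)
  qed
  have "g ` ?S = vec_complex -` (\<psi> ` S)"
  proof (intro set_eqI iffI)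
    fix v assume "v \<in> vec_complex -` (\<psi> ` S)"
    then obtain z where z: "z \<in> S" "vec_complex v = \<psi> z" by auto
    then have "v = g (complex_vec z)"
      by (metis comp_apply g_def vec_complex_inverse)
    then show "v \<in> g ` ?S"
      using z by auto
  qed (auto simp: g_def)
  then have "emeasure lebesgue (\<psi> ` S) = emeasure lebesgue (g ` ?S)"
    using im by (subst lebesgue_distr_vec_complex[symmetric], subst emeasure_distr) auto
  also have "\<dots> = (\<integral>\<^sup>+v\<in>?S. ennreal ((cmod (deriv \<psi> (vec_complex v)))\<^sup>2) \<partial>lebesgue)"
    using emeasure_lebesgue_differentiable_image[OF S' dg inj] by (simp add: det)
  also have "\<dots> = (\<integral>\<^sup>+z\<in>S. ennreal ((cmod (deriv \<psi> z))\<^sup>2) \<partial>distr lebesgue lebesgue vec_complex)"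
  proof -
    have "deriv \<psi> \<in> borel_measurable (lebesgue_on U)"
      using assms by (intro holomorphic_borel_measurable holomorphic_deriv)
    then have "deriv \<psi> \<in> borel_measurable (lebesgue_on S)"
      using S \<open>S \<subseteq> U\<close> by (simp add: measurable_restrict_mono)
    then have "(\<lambda>z. ennreal ((cmod (deriv \<psi> z))\<^sup>2)) \<in> borel_measurable (lebesgue_on S)"
      by measurable
    then have "(\<lambda>z. ennreal ((cmod (deriv \<psi> z))\<^sup>2) * indicator S z) \<in> borel_measurable lebesgue"
      using S by (subst (asm) borel_measurable_restrict_space_iff_ennreal) auto
    then have "(\<lambda>z. ennreal ((cmod (deriv \<psi> z))\<^sup>2) * indicator S z) \<in> borel_measurable (distr lebesgue lebesgue vec_complex)"
      by simp
    from nn_integral_distr[OF measurable_vec_complex_lebesgue this]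
    show ?thesis
      by (simp add: indicator_def vimage_def)
  qed
  finally show "emeasure lebesgue (\<psi> ` S) = (\<integral>\<^sup>+z\<in>S. ennreal ((cmod (deriv \<psi> z))\<^sup>2) \<partial>lebesgue)"
    by (simp add: lebesgue_distr_vec_complex)
qed

text \<open>As an identity of measures, the change of variables covers nonnegative and integrable functions alike.\<close>
lemma distr_conformal:
  assumes U: "open U" and hol: "\<psi> holomorphic_on U" and inj: "inj_on \<psi> U"
  shows measurable_conformal: "\<psi> \<in> lebesgue_on U \<rightarrow>\<^sub>M lebesgue_on (\<psi> ` U)"
    and "distr (density (lebesgue_on U) (\<lambda>z. ennreal ((cmod (deriv \<psi> z))\<^sup>2))) (lebesgue_on (\<psi> ` U)) \<psi>
         = lebesgue_on (\<psi> ` U)"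
proof -
  have V: "open (\<psi> ` U)"
    using assms open_mapping_thm3 by blast
  obtain h where h: "h holomorphic_on \<psi> ` U" "\<And>z. z \<in> U \<Longrightarrow> h (\<psi> z) = z"
    using holomorphic_has_inverse[OF hol U inj] by metis
  \<comment> \<open>Preimages under \<psi> are images under the holomorphic inverse
    \<open>h\<close>, and differentiable images of Lebesgue sets are Lebesgue sets. Continuity of
    \<psi> alone would only handle preimages of Borel sets.\<close>
  have pre: "\<psi> -` A \<inter> U = h ` A" if "A \<subseteq> \<psi> ` U" for A
    using h that by (auto simp: image_iff) force+
  show m: "\<psi> \<in> lebesgue_on U \<rightarrow>\<^sub>M lebesgue_on (\<psi> ` U)"
  proof (rule measurableI)
    fix A assume "A \<in> sets (lebesgue_on (\<psi> ` U))"
    then have A: "A \<in> sets lebesgue" "A \<subseteq> \<psi> ` U"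
      using V by (auto simp: sets_restrict_space_iff)
    have "inj_on h A"
      using A h by (intro inj_onI) (metis imageE subsetD)
    then have "h ` A \<in> sets lebesgue"
      using emeasure_conformal_image(1)[OF A V h(1)] by blast
    then show "\<psi> -` A \<inter> space (lebesgue_on U) \<in> sets (lebesgue_on U)"
      using U pre[OF A(2)] by (auto simp: sets_restrict_space_iff space_restrict_space)
  qed (auto simp: space_restrict_space)
  note dm[measurable] = holomorphic_borel_measurable[OF holomorphic_deriv[OF hol U] U]
  show "distr (density (lebesgue_on U) (\<lambda>z. ennreal ((cmod (deriv \<psi> z))\<^sup>2))) (lebesgue_on (\<psi> ` U)) \<psi>
         = lebesgue_on (\<psi> ` U)"
  proof (rule measure_eqI)
    fix A assume "A \<in> sets (distr (density (lebesgue_on U) (\<lambda>z. ennreal ((cmod (deriv \<psi> z))\<^sup>2))) (lebesgue_on (\<psi> ` U)) \<psi>)"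
    then have A: "A \<in> sets (lebesgue_on (\<psi> ` U))" by simp
    then have A': "A \<in> sets lebesgue" "A \<subseteq> \<psi> ` U"
      using V by (auto simp: sets_restrict_space_iff)
    let ?B = "\<psi> -` A \<inter> U"
    have B: "?B \<in> sets (lebesgue_on U)"
      using measurable_sets[OF m A] by (simp add: space_restrict_space)
    then have B': "?B \<in> sets lebesgue"
      using U by (auto simp: sets_restrict_space_iff)
    have "emeasure (distr (density (lebesgue_on U) (\<lambda>z. ennreal ((cmod (deriv \<psi> z))\<^sup>2))) (lebesgue_on (\<psi> ` U)) \<psi>) A
      = emeasure (density (lebesgue_on U) (\<lambda>z. ennreal ((cmod (deriv \<psi> z))\<^sup>2))) ?B"
      using m A by (subst emeasure_distr) (auto simp: space_restrict_space)
    also have "\<dots> = (\<integral>\<^sup>+z\<in>?B. ennreal ((cmod (deriv \<psi> z))\<^sup>2) \<partial>lebesgue_on U)"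
      using B by (subst emeasure_density) auto
    also have "\<dots> = (\<integral>\<^sup>+z\<in>?B. ennreal ((cmod (deriv \<psi> z))\<^sup>2) \<partial>lebesgue)"
      using U by (subst nn_integral_restrict_space) (auto intro!: nn_integral_cong simp: indicator_def)
    also have "\<dots> = emeasure lebesgue (\<psi> ` ?B)"
      using emeasure_conformal_image(2)[OF B' _ U hol inj_on_subset[OF inj]] by simp
    also have "\<psi> ` ?B = A"
      using A' by blast
    finally show "emeasure (distr (density (lebesgue_on U) (\<lambda>z. ennreal ((cmod (deriv \<psi> z))\<^sup>2))) (lebesgue_on (\<psi> ` U)) \<psi>) A
      = emeasure (lebesgue_on (\<psi> ` U)) A"
      using V A' by (simp add: emeasure_restrict_space)
  qed simp
qed

lemma nn_integral_conformal:
  assumes U: "open U" and hol: "\<psi> holomorphic_on U" and inj: "inj_on \<psi> U"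
    and f: "f \<in> borel_measurable (lebesgue_on (\<psi> ` U))"
  shows "(\<integral>\<^sup>+w. f w \<partial>lebesgue_on (\<psi> ` U)) = (\<integral>\<^sup>+z. ennreal ((cmod (deriv \<psi> z))\<^sup>2) * f (\<psi> z) \<partial>lebesgue_on U)"
proof -
  note dm[measurable] = holomorphic_borel_measurable[OF holomorphic_deriv[OF hol U] U]
  note m[measurable] = measurable_conformal[OF U hol inj]
  show ?thesis
    using f by (subst distr_conformal(2)[OF U hol inj, symmetric])
      (simp add: nn_integral_distr nn_integral_density)
qed

lemma integral_conformal:
  fixes f :: "complex \<Rightarrow> 'b::{banach, second_countable_topology}"
  assumes U: "open U" and hol: "\<psi> holomorphic_on U" and inj: "inj_on \<psi> U"
    and f: "f \<in> borel_measurable (lebesgue_on (\<psi> ` U))"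
  shows "(\<integral>w. f w \<partial>lebesgue_on (\<psi> ` U)) = (\<integral>z. (cmod (deriv \<psi> z))\<^sup>2 *\<^sub>R f (\<psi> z) \<partial>lebesgue_on U)"
    and "integrable (lebesgue_on (\<psi> ` U)) f \<longleftrightarrow> integrable (lebesgue_on U) (\<lambda>z. (cmod (deriv \<psi> z))\<^sup>2 *\<^sub>R f (\<psi> z))"
proof -
  note dm[measurable] = holomorphic_borel_measurable[OF holomorphic_deriv[OF hol U] U]
  note m[measurable] = measurable_conformal[OF U hol inj]
  show "(\<integral>w. f w \<partial>lebesgue_on (\<psi> ` U)) = (\<integral>z. (cmod (deriv \<psi> z))\<^sup>2 *\<^sub>R f (\<psi> z) \<partial>lebesgue_on U)"
    using f by (subst distr_conformal(2)[OF U hol inj, symmetric])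
      (simp add: integral_distr integral_density)
  show "integrable (lebesgue_on (\<psi> ` U)) f \<longleftrightarrow> integrable (lebesgue_on U) (\<lambda>z. (cmod (deriv \<psi> z))\<^sup>2 *\<^sub>R f (\<psi> z))"
    using f by (subst distr_conformal(2)[OF U hol inj, symmetric])
      (simp add: integrable_distr_eq integrable_density)
qed

section \<open>Mean values and the Bergman kernel\<close>

text \<open>Cauchy's formula at 0 for the function \<open>H (u * z)\<close> of \<open>u\<close>,
  which is holomorphic on a neighbourhood of the closed disc in the sense needed because
  \<open>cmod z < 1\<close>.\<close>

lemma circle_mean_value:
  assumes "H holomorphic_on ball 0 1" "cmod z < 1"
  shows "((\<lambda>x. H (cis (2 * pi * x) * z)) has_integral H 0) {0..1}"
proof -
  have "(\<lambda>u. H (u * z)) holomorphic_on cball 0 1"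
  proof (rule holomorphic_on_compose_gen[OF _ assms(1), unfolded o_def])
    show "(\<lambda>u. u * z) ` cball 0 1 \<subseteq> ball 0 1"
    proof clarify
      fix u :: complex assume "u \<in> cball 0 1"
      then have "cmod u * cmod z \<le> cmod z"
        by (simp add: mult_left_le_one_le)
      then show "u * z \<in> ball 0 1"
        using assms(2) by (simp add: norm_mult)
    qed
  qed (intro holomorphic_intros)
  from Cauchy_integral_circlepath_simple[OF this, of 0]
  have "((\<lambda>u. H (u * z) / u) has_contour_integral 2 * of_real pi * \<i> * H 0) (circlepath 0 1)"
    by simp
  then have "((\<lambda>x. H (circlepath 0 1 x * z) / circlepath 0 1 x * vector_derivative (circlepath 0 1) (at x within {0..1}))
     has_integral 2 * of_real pi * \<i> * H 0) {0..1}"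
    by (simp add: has_contour_integral_def)
  moreover have "H (circlepath 0 1 x * z) / circlepath 0 1 x * vector_derivative (circlepath 0 1) (at x within {0..1})
    = 2 * of_real pi * \<i> * H (cis (2 * pi * x) * z)" if "x \<in> {0..1}" for x
  proof -
    have "circlepath 0 1 x = cis (2 * pi * x)"
      by (simp add: circlepath cis_conv_exp mult_ac)
    then show ?thesis
      using that by (simp add: vector_derivative_circlepath01 cis_conv_exp mult_ac)
  qed
  ultimately have "((\<lambda>x. 2 * of_real pi * \<i> * H (cis (2 * pi * x) * z)) has_integral 2 * of_real pi * \<i> * H 0) {0..1}"
    using has_integral_cong by (metis (no_types, lifting))
  then have "((\<lambda>x. inverse (2 * of_real pi * \<i>) * (2 * of_real pi * \<i> * H (cis (2 * pi * x) * z)))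
     has_integral inverse (2 * of_real pi * \<i>) * (2 * of_real pi * \<i> * H 0)) {0..1}"
    by (rule has_integral_mult_right)
  then show ?thesis
    by (simp add: field_simps)
qed

text \<open>Rotations preserve area, so the integral equals its average over all rotations. By
  Fubini this average may be taken first, where the mean value on circles makes it the constant
  \<open>H 0\<close>. Polar coordinates are thereby avoided.\<close>

lemma disc_mean_value:
  assumes hol: "H holomorphic_on ball 0 1" and int: "integrable (lebesgue_on (ball 0 1)) H"
  shows "(\<integral>z. H z \<partial>lebesgue_on (ball 0 1)) = of_real pi * H 0"
proof -
  let ?M = "lebesgue_on (ball 0 1 :: complex set)" and ?N = "restrict_space lborel {0..1::real}"
  \<comment> \<open>Extension by 0 makes the function Borel on the whole plane, so that its
    composition with the rotation is jointly measurable for Fubini.\<close>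
  define h where "h z = (if z \<in> ball 0 1 then H z else 0)" for z
  have h[measurable]: "h \<in> borel_measurable borel"
    unfolding h_def using hol
    by (intro borel_measurable_continuous_on_if holomorphic_on_imp_continuous_on) auto
  have rot: "(\<lambda>z. cis a * z) ` ball 0 1 = ball 0 1" for a
  proof (intro set_eqI iffI)
    fix z :: complex assume "z \<in> ball 0 1"
    then have "cis (-a) * z \<in> ball 0 1" "z = cis a * (cis (-a) * z)"
      by (simp_all add: norm_mult mult.assoc[symmetric] cis_mult)
    then show "z \<in> (\<lambda>z. cis a * z) ` ball 0 1" by blast
  qed (auto simp: norm_mult)
  have drot: "deriv (\<lambda>z. cis a * z) z = cis a" for a z
    by (rule DERIV_imp_deriv) (auto intro!: derivative_eq_intros)
  have injrot: "inj_on (\<lambda>z. cis a * z) (ball 0 1)" for a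
    by (auto simp: inj_on_def)
  have holrot: "(\<lambda>z. cis a * z) holomorphic_on ball 0 1" for a
    by (intro holomorphic_intros)
  have hm: "h \<in> borel_measurable ?M"
    using h by (simp add: measurable_restrict_space1 measurable_completion)
  have hint: "integrable ?M h"
    using int by (subst Bochner_Integration.integrable_cong[where g=H]) (auto simp: h_def)
  have hI: "integral\<^sup>L ?M h = integral\<^sup>L ?M H"
    by (rule Bochner_Integration.integral_cong) (auto simp: h_def)
  have r1: "(\<integral>z. h (cis a * z) \<partial>?M) = integral\<^sup>L ?M h" for a
    using integral_conformal(1)[OF open_ball holrot[of a] injrot[of a], unfolded rot drot, OF hm] by simp
  have r2: "(\<integral>z. norm (h (cis a * z)) \<partial>?M) = (\<integral>z. norm (h z) \<partial>?M)" for a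
    using integral_conformal(1)[OF open_ball holrot[of a] injrot[of a], unfolded rot drot, of "\<lambda>z. norm (h z)"] hm by simp
  have r3: "integrable ?M (\<lambda>z. h (cis a * z))" for a
    using integral_conformal(2)[OF open_ball holrot[of a] injrot[of a], unfolded rot drot, OF hm] hint by simp
  interpret M: finite_measure ?M
    by (rule finite_measure_lebesgue_on) simp
  interpret N: finite_measure ?N
    by (rule finite_measureI) (auto simp: emeasure_restrict_space space_restrict_space)
  interpret pair_sigma_finite ?N ?M ..
  have [measurable]: "(\<lambda>x. x) \<in> ?M \<rightarrow>\<^sub>M borel"
    by (simp add: measurable_restrict_space1 measurable_completion)
  have [measurable]: "(\<lambda>x. x) \<in> ?N \<rightarrow>\<^sub>M borel"
    by (simp add: measurable_restrict_space1)
  have [measurable]: "(\<lambda>x. cis (2 * pi * x)) \<in> borel_measurable ?N"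
    by (intro measurable_restrict_space1) (auto intro!: borel_measurable_continuous_onI continuous_intros)
  have meas: "(\<lambda>(x, z). h (cis (2 * pi * x) * z)) \<in> borel_measurable (?N \<Otimes>\<^sub>M ?M)"
    by measurable
  have "integrable (?N \<Otimes>\<^sub>M ?M) (\<lambda>(x, z). h (cis (2 * pi * x) * z))"
    by (rule Fubini_integrable[OF meas]) (auto simp: r2 r3)
  from Fubini_integral[OF this]
  have "(\<integral>z. \<integral>x. h (cis (2 * pi * x) * z) \<partial>?N \<partial>?M) = (\<integral>x. \<integral>z. h (cis (2 * pi * x) * z) \<partial>?M \<partial>?N)" .
  also have "\<dots> = integral\<^sup>L ?M h"
    by (simp add: r1 measure_restrict_space)
  finally have 1: "(\<integral>z. \<integral>x. h (cis (2 * pi * x) * z) \<partial>?N \<partial>?M) = integral\<^sup>L ?M H"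
    by (simp add: hI)
  have c: "(\<integral>x. h (cis (2 * pi * x) * z) \<partial>?N) = H 0" if "z \<in> ball 0 1" for z
  proof -
    have eq: "h (cis (2 * pi * x) * z) = H (cis (2 * pi * x) * z)" for x
      using that by (simp add: h_def norm_mult)
    have "continuous_on {0..1} (\<lambda>x. H (cis (2 * pi * x) * z))"
      by (rule continuous_on_compose2[OF holomorphic_on_imp_continuous_on[OF hol]])
         (use that in \<open>auto intro!: continuous_intros simp: norm_mult\<close>)
    then have "set_integrable lborel {0..1} (\<lambda>x. H (cis (2 * pi * x) * z))"
      by (rule borel_integrable_atLeastAtMost')
    from set_borel_integral_eq_integral(2)[OF this]
    have "(LINT x:{0..1}|lborel. H (cis (2 * pi * x) * z)) = H 0"
      using circle_mean_value[OF hol] that by (auto simp: integral_unique)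
    then show ?thesis
      by (simp add: eq integral_restrict_space set_lebesgue_integral_def)
  qed
  have "(\<integral>z. \<integral>x. h (cis (2 * pi * x) * z) \<partial>?N \<partial>?M) = (\<integral>z. H 0 \<partial>?M)"
    by (rule Bochner_Integration.integral_cong) (auto simp: c)
  also have "\<dots> = of_real pi * H 0"
    by (simp add: measure_restrict_space content_ball scaleR_conv_of_real unit_ball_vol_2[simplified])
  finally show ?thesis
    using 1 by simp
qed

text \<open>The mean value property is applied to the holomorphic function \<open>h^2\<close>, whose
  norm is the desired integrand; if the integral diverges there is nothing to prove.\<close>

lemma norm_sq_le_disc_mean:
  assumes hol: "h holomorphic_on ball c r" and r: "r > 0"
  shows "ennreal ((cmod (h c))\<^sup>2) \<le> ennreal (1 / (pi * r\<^sup>2)) * (\<integral>\<^sup>+z\<in>ball c r. ennreal ((cmod (h z))\<^sup>2) \<partial>lebesgue)"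
proof (cases "(\<integral>\<^sup>+z\<in>ball c r. ennreal ((cmod (h z))\<^sup>2) \<partial>lebesgue) = \<infinity>")
  case True
  then show ?thesis
    using r by (simp add: ennreal_mult_top)
next
  case False
  let ?\<psi> = "\<lambda>u. c + of_real r * u"
  have im: "?\<psi> ` ball 0 1 = ball c r"
  proof (intro set_eqI iffI)
    fix z assume "z \<in> ball c r"
    then have "(z - c) / of_real r \<in> ball 0 1" "z = ?\<psi> ((z - c) / of_real r)"
      using r by (simp_all add: dist_norm norm_divide norm_minus_commute)
    then show "z \<in> ?\<psi> ` ball 0 1" by blast
  qed (use r in \<open>auto simp: dist_norm norm_mult\<close>)
  have d: "deriv ?\<psi> u = of_real r" for u
    by (rule DERIV_imp_deriv) (auto intro!: derivative_eq_intros)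
  have inj: "inj_on ?\<psi> (ball 0 1)" using r by (auto simp: inj_on_def)
  have hp: "?\<psi> holomorphic_on ball 0 1" by (intro holomorphic_intros)
  define H where "H u = (h (?\<psi> u))\<^sup>2" for u
  have H: "H holomorphic_on ball 0 1"
    unfolding H_def using holomorphic_on_compose_gen[OF hp hol] im
    by (auto intro!: holomorphic_intros simp: o_def)
  have hm[measurable]: "h \<in> borel_measurable (lebesgue_on (ball c r))"
    using hol by (intro holomorphic_borel_measurable) auto
  have Hm: "H \<in> borel_measurable (lebesgue_on (ball 0 1))"
    using H by (intro holomorphic_borel_measurable) auto
  have "(\<integral>\<^sup>+z. ennreal ((cmod (h z))\<^sup>2) \<partial>lebesgue_on (ball c r))
      = (\<integral>\<^sup>+u. ennreal (r\<^sup>2) * ennreal (cmod (H u)) \<partial>lebesgue_on (ball 0 1))"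
    using nn_integral_conformal[OF open_ball hp inj, of "\<lambda>z. ennreal ((cmod (h z))\<^sup>2)"]
    by (simp add: im d H_def norm_power)
  also have "\<dots> = ennreal (r\<^sup>2) * (\<integral>\<^sup>+u. ennreal (cmod (H u)) \<partial>lebesgue_on (ball 0 1))"
    using Hm by (intro nn_integral_cmult) auto
  finally have eq: "(\<integral>\<^sup>+z\<in>ball c r. ennreal ((cmod (h z))\<^sup>2) \<partial>lebesgue)
     = ennreal (r\<^sup>2) * (\<integral>\<^sup>+u. ennreal (cmod (H u)) \<partial>lebesgue_on (ball 0 1))"
    by (simp add: nn_integral_restrict_space)
  then have fin: "(\<integral>\<^sup>+u. ennreal (cmod (H u)) \<partial>lebesgue_on (ball 0 1)) < \<infinity>"
    using False r by (auto simp: ennreal_mult_eq_top_iff top.not_eq_extremum[symmetric])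
  then have int: "integrable (lebesgue_on (ball 0 1)) H"
    using Hm by (simp add: integrable_iff_bounded)
  have "pi * (cmod (h c))\<^sup>2 = cmod (\<integral>z. H z \<partial>lebesgue_on (ball 0 1))"
    unfolding disc_mean_value[OF H int] by (simp add: norm_mult H_def norm_power)
  then have le: "ennreal (pi * (cmod (h c))\<^sup>2) \<le> (\<integral>\<^sup>+u. ennreal (cmod (H u)) \<partial>lebesgue_on (ball 0 1))"
    using integral_norm_bound_ennreal[OF int] by simp
  have "ennreal ((cmod (h c))\<^sup>2) = ennreal (1/(pi * r\<^sup>2)) * (ennreal (r\<^sup>2) * ennreal (pi * (cmod (h c))\<^sup>2))"
    using r by (simp add: ennreal_mult[symmetric])
  also have "\<dots> \<le> ennreal (1/(pi * r\<^sup>2)) * (ennreal (r\<^sup>2) * (\<integral>\<^sup>+u. ennreal (cmod (H u)) \<partial>lebesgue_on (ball 0 1)))"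
    by (intro mult_left_mono le) auto
  finally show ?thesis
    unfolding eq .
qed

section \<open>The Bergman kernel of a simply connected domain\<close>

lemma integrable_mult_L2:
  fixes f h :: "'a \<Rightarrow> complex"
  assumes [measurable]: "f \<in> borel_measurable M" "h \<in> borel_measurable M"
    and f: "(\<integral>\<^sup>+z. ennreal ((cmod (f z))\<^sup>2) \<partial>M) < \<infinity>" and h: "(\<integral>\<^sup>+z. ennreal ((cmod (h z))\<^sup>2) \<partial>M) < \<infinity>"
  shows "integrable M (\<lambda>z. f z * cnj (h z))"
proof (rule integrableI_bounded)
  have [measurable]: "cnj \<in> borel_measurable borel"
    by (intro borel_measurable_continuous_onI continuous_intros)
  show "(\<lambda>z. f z * cnj (h z)) \<in> borel_measurable M" by measurable
  have "(\<integral>\<^sup>+z. ennreal (norm (f z * cnj (h z))) \<partial>M) \<le> (\<integral>\<^sup>+z. ennreal ((cmod (f z))\<^sup>2) + ennreal ((cmod (h z))\<^sup>2) \<partial>M)"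
  proof (rule nn_integral_mono)
    fix z
    have "cmod (f z) * cmod (h z) \<le> (cmod (f z))\<^sup>2 + (cmod (h z))\<^sup>2"
      using sum_squares_bound[of "cmod (f z)" "cmod (h z)"] zero_le_power2[of "cmod (f z)"]
        zero_le_power2[of "cmod (h z)"] by linarith
    then show "ennreal (norm (f z * cnj (h z))) \<le> ennreal ((cmod (f z))\<^sup>2) + ennreal ((cmod (h z))\<^sup>2)"
      by (simp add: norm_mult ennreal_plus[symmetric] ennreal_leI del: ennreal_plus)
  qed
  also have "\<dots> = (\<integral>\<^sup>+z. ennreal ((cmod (f z))\<^sup>2) \<partial>M) + (\<integral>\<^sup>+z. ennreal ((cmod (h z))\<^sup>2) \<partial>M)"
    by (rule nn_integral_add) measurable
  also have "\<dots> < \<infinity>" using f h by simp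
  finally show "(\<integral>\<^sup>+z. ennreal (norm (f z * cnj (h z))) \<partial>M) < \<infinity>" .
qed

lemma Moebius_deriv:
  assumes "cmod a < 1" "cmod w < 1"
  shows "(Moebius_function 0 a has_field_derivative (1 - (cmod a)\<^sup>2) / (1 - cnj a * w)\<^sup>2) (at w)"
proof -
  have nz: "1 - cnj a * w \<noteq> 0"
  proof
    assume "1 - cnj a * w = 0"
    then have "cmod a * cmod w = 1"
      by (metis complex_mod_cnj eq_iff_diff_eq_0 norm_mult norm_one)
    moreover have "cmod a * cmod w < 1"
      using assms by (metis mult.right_neutral mult_le_one mult_strict_mono norm_ge_zero less_eq_real_def mult_less_cancel_left1 mult.commute not_less)
    ultimately show False by simp
  qed
  have "(\<lambda>z. (z - a) / (1 - cnj a * z)) = Moebius_function 0 a"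
    by (auto simp: Moebius_function_simple)
  moreover have "((\<lambda>z. (z - a) / (1 - cnj a * z)) has_field_derivative
     ((1 - cnj a * w) + (w - a) * cnj a) / (1 - cnj a * w)\<^sup>2) (at w)"
    using nz by (auto intro!: derivative_eq_intros simp: power2_eq_square)
  moreover have "(1 - cnj a * w) + (w - a) * cnj a = of_real (1 - (cmod a)\<^sup>2)"
    by (simp add: algebra_simps complex_norm_square[symmetric] del: of_real_diff) (simp add: complex_norm_square algebra_simps)
  ultimately show ?thesis by simp
qed

text \<open>Up to a constant factor, \<open>k\<close> is the Bergman kernel of the image domain at
  \<open>\<psi> a\<close>. It is the derivative of the conformal map of the domain onto the disc
  that sends \<open>\<psi> a\<close> to 0; pulled back along the inverse of that map it becomes the
  constant 1, and the reproducing property becomes the mean value property at 0.\<close>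

lemma Bergman_kernel_reproducing:
  assumes \<psi>: "\<psi> holomorphic_on unit_disc" "inj_on \<psi> unit_disc" and a: "cmod a < 1"
  obtains k where "k holomorphic_on \<psi> ` unit_disc"
    "(\<integral>\<^sup>+z. ennreal ((cmod (k z))\<^sup>2) \<partial>lebesgue_on (\<psi> ` unit_disc)) < \<infinity>"
    "\<And>w. cmod w < 1 \<Longrightarrow> k (\<psi> w) * deriv \<psi> w = (1 - (cmod a)\<^sup>2) / (1 - cnj a * w)\<^sup>2"
    "\<And>h. h holomorphic_on \<psi> ` unit_disc \<Longrightarrow>
       (\<integral>\<^sup>+z. ennreal ((cmod (h z))\<^sup>2) \<partial>lebesgue_on (\<psi> ` unit_disc)) < \<infinity> \<Longrightarrow>
       (\<integral>z. h z * cnj (k z) \<partial>lebesgue_on (\<psi> ` unit_disc)) = of_real (pi * (1 - (cmod a)\<^sup>2)) * deriv \<psi> a * h (\<psi> a)"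
proof -
  let ?D = "unit_disc" and ?\<Omega> = "\<psi> ` unit_disc"
  obtain \<kappa> where \<kappa>: "\<kappa> holomorphic_on ?\<Omega>"
      "\<And>z. z \<in> ?D \<Longrightarrow> deriv \<psi> z * deriv \<kappa> (\<psi> z) = 1" "\<And>z. z \<in> ?D \<Longrightarrow> \<kappa> (\<psi> z) = z"
    using holomorphic_has_inverse[OF \<psi>(1) open_ball \<psi>(2)] by metis
  have \<Omega>: "open ?\<Omega>"
    using \<psi> open_mapping_thm3 by blast
  let ?n = "Moebius_function 0 a" and ?m = "Moebius_function 0 (-a)"
  have nd: "(?n has_field_derivative deriv ?n w) (at w)" "deriv ?n w = (1 - (cmod a)\<^sup>2) / (1 - cnj a * w)\<^sup>2" if "cmod w < 1" for w
    using Moebius_deriv[OF a that] DERIV_imp_deriv by metis+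
  have md: "(?m has_field_derivative deriv ?m w) (at w)" "deriv ?m w = (1 - (cmod a)\<^sup>2) / (1 + cnj a * w)\<^sup>2" if "cmod w < 1" for w
    using Moebius_deriv[of "-a" w] a that DERIV_imp_deriv[OF Moebius_deriv[of "-a" w]] by auto
  have mhol: "?m holomorphic_on ?D" "?n holomorphic_on ?D"
    using a by (auto intro: Moebius_function_holomorphic)
  have mlt: "cmod (?m w) < 1" "cmod (?n w) < 1" if "cmod w < 1" for w
    using a that Moebius_function_norm_lt_1 by auto
  have nm: "?n (?m w) = w" "?m (?n w) = w" if "cmod w < 1" for w
    using Moebius_function_compose[of a "-a" w] Moebius_function_compose[of "-a" a w] a that by auto
  have mim: "?m ` ?D = ?D"
    using mlt nm by (auto simp: image_iff) (metis mem_ball_0)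
  \<comment> \<open>The disc is reparametrised by the automorphism taking 0 to \<open>a\<close>, so
    that \<open>\<Psi> 0 = \<psi> a\<close>.\<close>
  define \<Psi> where "\<Psi> = \<psi> \<circ> ?m"
  have \<Psi>hol: "\<Psi> holomorphic_on ?D"
    unfolding \<Psi>_def by (rule holomorphic_on_compose) (use mhol \<psi> mim in auto)
  have \<Psi>im: "\<Psi> ` ?D = ?\<Omega>"
    unfolding \<Psi>_def image_comp[symmetric] mim ..
  have \<Psi>inj: "inj_on \<Psi> ?D"
    unfolding \<Psi>_def by (rule comp_inj_on) (use nm mim \<psi> in \<open>auto intro: inj_on_inverseI[of _ ?n]\<close>)
  have \<Psi>d: "deriv \<Psi> u = deriv \<psi> (?m u) * deriv ?m u" if "cmod u < 1" for u
  proof -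
    have "(\<psi> has_field_derivative deriv \<psi> (?m u)) (at (?m u))"
      using \<psi>(1) mlt[OF that] by (intro holomorphic_derivI[where S="?D"]) auto
    from DERIV_chain[OF this md(1)[OF that]] show ?thesis
      unfolding \<Psi>_def by (rule DERIV_imp_deriv)
  qed
  \<comment> \<open>By the chain rule this is the derivative of \<open>?n\<close> composed with
    \<kappa>, the inverse of \<Psi>.\<close>
  define k where "k z = deriv ?n (\<kappa> z) * deriv \<kappa> z" for z
  have \<kappa>im: "\<kappa> ` ?\<Omega> \<subseteq> ?D" using \<kappa>(3) by auto
  have khol: "k holomorphic_on ?\<Omega>"
    unfolding k_def
    by (intro holomorphic_intros holomorphic_on_compose_gen[OF \<kappa>(1) _ \<kappa>im, unfolded o_def] holomorphic_deriv mhol \<kappa> \<Omega>) auto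
  have k1: "k (\<psi> w) * deriv \<psi> w = (1 - (cmod a)\<^sup>2) / (1 - cnj a * w)\<^sup>2" if "cmod w < 1" for w
    using \<kappa>(2,3)[of w] that nd(2)[OF that] by (simp add: k_def mult.assoc) (simp add: mult.commute)
  have k2: "k (\<Psi> u) * deriv \<Psi> u = 1" if u: "cmod u < 1" for u
  proof -
    have "(?n \<circ> ?m has_field_derivative deriv ?n (?m u) * deriv ?m u) (at u)"
      by (rule DERIV_chain[OF nd(1)[OF mlt(1)[OF u]] md(1)[OF u]])
    then have "((\<lambda>x. x) has_field_derivative deriv ?n (?m u) * deriv ?m u) (at u)"
      by (rule has_field_derivative_transform_within_open[of _ _ _ ?D]) (use u nm in auto)
    then have "deriv ?n (?m u) * deriv ?m u = 1"
      using DERIV_ident DERIV_unique by blast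
    moreover have "k (\<Psi> u) * deriv \<Psi> u = deriv ?n (?m u) * deriv ?m u * (deriv \<psi> (?m u) * deriv \<kappa> (\<psi> (?m u)))"
    proof -
      have "\<kappa> (\<Psi> u) = ?m u" "\<Psi> u = \<psi> (?m u)"
        using \<kappa>(3)[of "?m u"] mlt[OF u] by (simp_all add: \<Psi>_def)
      then show ?thesis
        unfolding k_def \<Psi>d[OF u] by (simp only: mult_ac)
    qed
    ultimately show ?thesis
      using \<kappa>(2)[of "?m u"] mlt[OF u] by simp
  qed
  \<comment> \<open>One of the two factors of the Jacobian |\<Psi>'|^2 cancels against the conjugate
    of \<open>k\<close>, which leaves a holomorphic integrand.\<close>
  have k3: "(cmod (deriv \<Psi> u))\<^sup>2 *\<^sub>R (x * cnj (k (\<Psi> u))) = x * deriv \<Psi> u" if "cmod u < 1" for u x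
  proof -
    have "complex_of_real ((cmod (deriv \<Psi> u))\<^sup>2) * cnj (k (\<Psi> u)) = deriv \<Psi> u * cnj (k (\<Psi> u) * deriv \<Psi> u)"
      unfolding complex_norm_square complex_cnj_mult by (simp only: mult_ac)
    then have "complex_of_real ((cmod (deriv \<Psi> u))\<^sup>2) * cnj (k (\<Psi> u)) = deriv \<Psi> u"
      unfolding k2[OF that] by simp
    moreover have "(cmod (deriv \<Psi> u))\<^sup>2 *\<^sub>R (x * cnj (k (\<Psi> u))) = x * (complex_of_real ((cmod (deriv \<Psi> u))\<^sup>2) * cnj (k (\<Psi> u)))"
      unfolding scaleR_conv_of_real by (simp only: mult_ac)
    ultimately show ?thesis by (simp only:)
  qed
  have km[measurable]: "k \<in> borel_measurable (lebesgue_on ?\<Omega>)"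
    using khol \<Omega> by (intro holomorphic_borel_measurable) auto
  have "(\<integral>\<^sup>+z. ennreal ((cmod (k z))\<^sup>2) \<partial>lebesgue_on ?\<Omega>)
      = (\<integral>\<^sup>+u. ennreal ((cmod (deriv \<Psi> u))\<^sup>2) * ennreal ((cmod (k (\<Psi> u)))\<^sup>2) \<partial>lebesgue_on ?D)"
    using nn_integral_conformal[OF open_ball \<Psi>hol \<Psi>inj, of "\<lambda>z. ennreal ((cmod (k z))\<^sup>2)"] by (simp add: \<Psi>im)
  also have "\<dots> = (\<integral>\<^sup>+u. 1 \<partial>lebesgue_on ?D)"
  proof (intro nn_integral_cong)
    fix u assume "u \<in> space (lebesgue_on ?D)"
    then have "cmod u < 1" by (simp add: space_restrict_space)
    from arg_cong[OF k2[OF this], of "\<lambda>x. (cmod x)\<^sup>2"]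
    show "ennreal ((cmod (deriv \<Psi> u))\<^sup>2) * ennreal ((cmod (k (\<Psi> u)))\<^sup>2) = 1"
      by (simp add: ennreal_mult'[symmetric] norm_mult power_mult_distrib mult.commute)
  qed
  also have "\<dots> < \<infinity>"
    using emeasure_bounded_finite[OF bounded_ball, of "0::complex" 1] by (simp add: emeasure_restrict_space)
  finally have kL2: "(\<integral>\<^sup>+z. ennreal ((cmod (k z))\<^sup>2) \<partial>lebesgue_on ?\<Omega>) < \<infinity>" .
  have rep: "(\<integral>z. h z * cnj (k z) \<partial>lebesgue_on ?\<Omega>) = of_real (pi * (1 - (cmod a)\<^sup>2)) * deriv \<psi> a * h (\<psi> a)"
    if h: "h holomorphic_on ?\<Omega>" "(\<integral>\<^sup>+z. ennreal ((cmod (h z))\<^sup>2) \<partial>lebesgue_on ?\<Omega>) < \<infinity>" for h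
  proof -
    have hm[measurable]: "h \<in> borel_measurable (lebesgue_on ?\<Omega>)"
      using h \<Omega> by (intro holomorphic_borel_measurable) auto
    have int: "integrable (lebesgue_on ?\<Omega>) (\<lambda>z. h z * cnj (k z))"
      by (rule integrable_mult_L2) (use h kL2 in auto)
    have m: "(\<lambda>z. h z * cnj (k z)) \<in> borel_measurable (lebesgue_on (\<Psi> ` ?D))"
      using int unfolding \<Psi>im by (rule borel_measurable_integrable)
    have "(\<integral>z. h z * cnj (k z) \<partial>lebesgue_on ?\<Omega>) = (\<integral>u. (cmod (deriv \<Psi> u))\<^sup>2 *\<^sub>R (h (\<Psi> u) * cnj (k (\<Psi> u))) \<partial>lebesgue_on ?D)"
      using integral_conformal(1)[OF open_ball \<Psi>hol \<Psi>inj m] by (simp add: \<Psi>im)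
    also have "\<dots> = (\<integral>u. h (\<Psi> u) * deriv \<Psi> u \<partial>lebesgue_on ?D)"
      by (rule Bochner_Integration.integral_cong) (auto simp: k3)
    also have "\<dots> = of_real pi * (h (\<Psi> 0) * deriv \<Psi> 0)"
    proof (rule disc_mean_value)
      show "(\<lambda>u. h (\<Psi> u) * deriv \<Psi> u) holomorphic_on ball 0 1"
        by (intro holomorphic_intros holomorphic_on_compose_gen[OF \<Psi>hol h(1), unfolded o_def] holomorphic_deriv \<Psi>hol) (auto simp: \<Psi>im)
      have "integrable (lebesgue_on ?D) (\<lambda>u. (cmod (deriv \<Psi> u))\<^sup>2 *\<^sub>R (h (\<Psi> u) * cnj (k (\<Psi> u))))"
        using integral_conformal(2)[OF open_ball \<Psi>hol \<Psi>inj m] int by (simp add: \<Psi>im)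
      also have "?this \<longleftrightarrow> integrable (lebesgue_on ?D) (\<lambda>u. h (\<Psi> u) * deriv \<Psi> u)"
        by (rule Bochner_Integration.integrable_cong) (auto simp: k3)
      finally show "integrable (lebesgue_on ?D) (\<lambda>u. h (\<Psi> u) * deriv \<Psi> u)" .
    qed
    also have "?m 0 = a" by (simp add: Moebius_function_simple)
    then have "of_real pi * (h (\<Psi> 0) * deriv \<Psi> 0) = of_real (pi * (1 - (cmod a)\<^sup>2)) * deriv \<psi> a * h (\<psi> a)"
      using \<Psi>d[of 0] md(2)[of 0] by (simp add: \<Psi>_def mult_ac)
    finally show ?thesis .
  qed
  show ?thesis
    by (rule that[OF khol kL2 k1 rep])
qed

lemma borel_measurable_dA: "borel_measurable (restrict_space dA S) = borel_measurable (lebesgue_on S)"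
  by (rule measurable_cong_sets) (auto simp: sets_restrict_space dA_def)

lemma nn_integral_dA:
  assumes S: "S \<in> sets lebesgue" and f: "f \<in> borel_measurable (lebesgue_on S)"
  shows "(\<integral>\<^sup>+z\<in>S. f z \<partial>dA) = ennreal (1/pi) * (\<integral>\<^sup>+z. f z \<partial>lebesgue_on S)"
proof -
  have m: "(\<lambda>z. f z * indicator S z) \<in> borel_measurable lebesgue"
    using f S by (subst (asm) borel_measurable_restrict_space_iff_ennreal) auto
  have "(\<integral>\<^sup>+z\<in>S. f z \<partial>dA) = (\<integral>\<^sup>+z. ennreal (1/pi) * (f z * indicator S z) \<partial>lebesgue)"
    unfolding dA_def using m by (subst nn_integral_density) auto
  also have "\<dots> = ennreal (1/pi) * (\<integral>\<^sup>+z. f z * indicator S z \<partial>lebesgue)"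
    using m by (rule nn_integral_cmult)
  finally show ?thesis
    using S by (simp add: nn_integral_restrict_space)
qed

lemma set_integral_dA:
  fixes f :: "complex \<Rightarrow> complex"
  assumes S: "S \<in> sets lebesgue" and f: "f \<in> borel_measurable (lebesgue_on S)"
  shows "(LINT z:S|dA. f z) = (1/pi) *\<^sub>R (\<integral>z. f z \<partial>lebesgue_on S)"
proof -
  have m: "(\<lambda>z. indicator S z *\<^sub>R f z) \<in> borel_measurable lebesgue"
    using f S by (subst (asm) borel_measurable_restrict_space_iff) auto
  have "(LINT z:S|dA. f z) = (\<integral>z. (1/pi) *\<^sub>R (indicator S z *\<^sub>R f z) \<partial>lebesgue)"
    unfolding set_lebesgue_integral_def dA_def using m by (subst integral_density) auto
  also have "\<dots> = (1/pi) *\<^sub>R (\<integral>z. indicator S z *\<^sub>R f z \<partial>lebesgue)"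
    by (rule integral_scaleR_right)
  finally show ?thesis
    using S by (simp add: integral_restrict_space)
qed

lemma ennreal_mult_pos_less_top: "c > 0 \<Longrightarrow> ennreal c * x < \<infinity> \<Longrightarrow> x < \<infinity>"
  by (auto simp: ennreal_mult_less_top)

text \<open>Testing the orthogonality of \<open>f - g\<close> to holomorphic functions with the
  kernel expresses \<open>g (\<psi> a)\<close> as an integral of \<open>f\<close>. After the change
  of variables one factor |\<psi>'| is absorbed by the kernel, and \<open>1 - (cmod a)^2\<close>
  cancels from both sides.\<close>

lemma Bergman_projection_pointwise:
  assumes \<psi>: "\<psi> holomorphic_on unit_disc" "inj_on \<psi> unit_disc" "\<psi> ` unit_disc = \<Omega>"
    and proj: "is_bergman_proj \<Omega> f g" and a: "cmod a < 1"
  shows "ennreal (cmod (g (\<psi> a)) * cmod (deriv \<psi> a)) \<le>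
    ennreal (1/pi) * (\<integral>\<^sup>+w. ennreal (cmod (f (\<psi> w)) * cmod (deriv \<psi> w) / (cmod (1 - cnj a * w))\<^sup>2) \<partial>lebesgue_on unit_disc)"
proof -
  let ?M = "lebesgue_on \<Omega>"
  have \<Omega>: "open \<Omega>" using \<psi> open_mapping_thm3 by blast
  then have \<Omega>s: "\<Omega> \<in> sets lebesgue" by auto
  obtain k where k: "k holomorphic_on \<Omega>"
    "(\<integral>\<^sup>+z. ennreal ((cmod (k z))\<^sup>2) \<partial>?M) < \<infinity>"
    "\<And>w. cmod w < 1 \<Longrightarrow> k (\<psi> w) * deriv \<psi> w = (1 - (cmod a)\<^sup>2) / (1 - cnj a * w)\<^sup>2"
    "\<And>h. h holomorphic_on \<Omega> \<Longrightarrow> (\<integral>\<^sup>+z. ennreal ((cmod (h z))\<^sup>2) \<partial>?M) < \<infinity> \<Longrightarrow>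
       (\<integral>z. h z * cnj (k z) \<partial>?M) = of_real (pi * (1 - (cmod a)\<^sup>2)) * deriv \<psi> a * h (\<psi> a)"
    by (rule Bergman_kernel_reproducing[OF \<psi>(1,2) a, unfolded \<psi>(3)]) blast
  have hm: "h \<in> borel_measurable ?M" if "h holomorphic_on \<Omega>" for h
    using that \<Omega> by (intro holomorphic_borel_measurable) auto
  have L2: "h \<in> borel_measurable ?M \<and> (\<integral>\<^sup>+z. ennreal ((cmod (h z))\<^sup>2) \<partial>?M) < \<infinity>" if "L2_on \<Omega> h" for h
  proof -
    have m: "h \<in> borel_measurable ?M"
      using that by (simp add: L2_on_def borel_measurable_dA)
    then have "(\<integral>\<^sup>+z\<in>\<Omega>. ennreal ((cmod (h z))\<^sup>2) \<partial>dA) = ennreal (1/pi) * (\<integral>\<^sup>+z. ennreal ((cmod (h z))\<^sup>2) \<partial>?M)"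
      by (intro nn_integral_dA \<Omega>s) measurable
    then show ?thesis
      using m that ennreal_mult_pos_less_top[of "1/pi"] by (simp add: L2_on_def)
  qed
  have fL: "f \<in> borel_measurable ?M" "(\<integral>\<^sup>+z. ennreal ((cmod (f z))\<^sup>2) \<partial>?M) < \<infinity>"
    and gL: "g \<in> borel_measurable ?M" "(\<integral>\<^sup>+z. ennreal ((cmod (g z))\<^sup>2) \<partial>?M) < \<infinity>" and ghol: "g holomorphic_on \<Omega>"
    using proj L2 by (auto simp: is_bergman_proj_def)
  note [measurable] = fL(1) gL(1) hm[OF k(1)]
  have [measurable]: "cnj \<in> borel_measurable borel"
    by (intro borel_measurable_continuous_onI continuous_intros)
  have "L2_on \<Omega> k"
    unfolding L2_on_def borel_measurable_dA
    using k(2) hm[OF k(1)] by (subst nn_integral_dA[OF \<Omega>s]) (auto simp: ennreal_mult_less_top)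
  then have "(LINT z:\<Omega>|dA. (f z - g z) * cnj (k z)) = 0"
    using proj k(1) by (auto simp: is_bergman_proj_def)
  moreover have "(LINT z:\<Omega>|dA. (f z - g z) * cnj (k z)) = (1/pi) *\<^sub>R (\<integral>z. (f z - g z) * cnj (k z) \<partial>?M)"
    by (rule set_integral_dA[OF \<Omega>s]) measurable
  ultimately have "(\<integral>z. (f z - g z) * cnj (k z) \<partial>?M) = 0"
    by simp
  moreover have fi: "integrable ?M (\<lambda>z. f z * cnj (k z))" and gi: "integrable ?M (\<lambda>z. g z * cnj (k z))"
    using fL gL k(2) hm[OF k(1)] by (auto intro: integrable_mult_L2)
  ultimately have "(\<integral>z. f z * cnj (k z) \<partial>?M) = (\<integral>z. g z * cnj (k z) \<partial>?M)"
    by (simp add: left_diff_distrib)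
  also have "\<dots> = of_real (pi * (1 - (cmod a)\<^sup>2)) * deriv \<psi> a * g (\<psi> a)"
    by (rule k(4)[OF ghol gL(2)])
  finally have eq: "(\<integral>z. f z * cnj (k z) \<partial>?M) = of_real (pi * (1 - (cmod a)\<^sup>2)) * deriv \<psi> a * g (\<psi> a)" .
  have a2: "1 - (cmod a)\<^sup>2 > 0"
    using a by (simp add: power_less_one_iff abs_square_less_1)
  have "ennreal (pi * (1 - (cmod a)\<^sup>2)) * ennreal (cmod (g (\<psi> a)) * cmod (deriv \<psi> a)) = ennreal (cmod (\<integral>z. f z * cnj (k z) \<partial>?M))"
    unfolding eq using a2 by (simp add: norm_mult ennreal_mult'[symmetric] mult_ac del: of_real_mult of_real_diff)
  also have "\<dots> \<le> (\<integral>\<^sup>+z. ennreal (cmod (f z * cnj (k z))) \<partial>?M)"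
    by (rule integral_norm_bound_ennreal[OF fi])
  also have "\<dots> = (\<integral>\<^sup>+w. ennreal ((cmod (deriv \<psi> w))\<^sup>2) * ennreal (cmod (f (\<psi> w) * cnj (k (\<psi> w)))) \<partial>lebesgue_on unit_disc)"
    using nn_integral_conformal[OF open_ball \<psi>(1,2), of "\<lambda>z. ennreal (cmod (f z * cnj (k z)))"] by (simp add: \<psi>(3))
  also have "\<dots> = (\<integral>\<^sup>+w. ennreal (1 - (cmod a)\<^sup>2) * ennreal (cmod (f (\<psi> w)) * cmod (deriv \<psi> w) / (cmod (1 - cnj a * w))\<^sup>2) \<partial>lebesgue_on unit_disc)"
  proof (rule nn_integral_cong)
    fix w assume "w \<in> space (lebesgue_on unit_disc)"
    then have "cmod w < 1" by (simp add: space_restrict_space)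
    from arg_cong[OF k(3)[OF this], of cmod]
    have "cmod (k (\<psi> w)) * cmod (deriv \<psi> w) = (1 - (cmod a)\<^sup>2) / (cmod (1 - cnj a * w))\<^sup>2"
    proof -
      have "cmod (1 - (complex_of_real (cmod a))\<^sup>2) = 1 - (cmod a)\<^sup>2"
        using a2 by (metis abs_of_pos norm_of_real of_real_1 of_real_diff of_real_power)
      then show ?thesis
        using \<open>cmod (k (\<psi> w) * deriv \<psi> w) = _\<close> by (simp add: norm_mult norm_divide norm_power)
    qed
    then have "(cmod (deriv \<psi> w))\<^sup>2 * cmod (f (\<psi> w) * cnj (k (\<psi> w))) = cmod (f (\<psi> w)) * cmod (deriv \<psi> w) * ((1 - (cmod a)\<^sup>2) / (cmod (1 - cnj a * w))\<^sup>2)"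
      by (simp add: norm_mult power2_eq_square mult_ac)
    also have "\<dots> = (1 - (cmod a)\<^sup>2) * (cmod (f (\<psi> w)) * cmod (deriv \<psi> w) / (cmod (1 - cnj a * w))\<^sup>2)"
      by simp
    finally show "ennreal ((cmod (deriv \<psi> w))\<^sup>2) * ennreal (cmod (f (\<psi> w) * cnj (k (\<psi> w)))) =
      ennreal (1 - (cmod a)\<^sup>2) * ennreal (cmod (f (\<psi> w)) * cmod (deriv \<psi> w) / (cmod (1 - cnj a * w))\<^sup>2)"
      using a2 by (simp only: ennreal_mult'[symmetric] zero_le_power2 less_imp_le)
  qed
  also have "\<dots> = ennreal (1 - (cmod a)\<^sup>2) * (\<integral>\<^sup>+w. ennreal (cmod (f (\<psi> w)) * cmod (deriv \<psi> w) / (cmod (1 - cnj a * w))\<^sup>2) \<partial>lebesgue_on unit_disc)"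
  proof (rule nn_integral_cmult)
    note [measurable] = measurable_compose[OF measurable_conformal[OF open_ball \<psi>(1,2), unfolded \<psi>(3)] fL(1)]
    have [measurable]: "deriv \<psi> \<in> borel_measurable (lebesgue_on unit_disc)"
      using \<psi>(1) by (intro holomorphic_borel_measurable holomorphic_deriv) auto
    have [measurable]: "(\<lambda>w. w) \<in> borel_measurable (lebesgue_on unit_disc)"
      by (simp add: measurable_restrict_space1 measurable_completion)
    show "(\<lambda>w. ennreal (cmod (f (\<psi> w)) * cmod (deriv \<psi> w) / (cmod (1 - cnj a * w))\<^sup>2)) \<in> borel_measurable (lebesgue_on unit_disc)"
      by measurable
  qed
  finally have le: "ennreal (pi * (1 - (cmod a)\<^sup>2)) * ennreal (cmod (g (\<psi> a)) * cmod (deriv \<psi> a)) \<le>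
     ennreal (1 - (cmod a)\<^sup>2) * (\<integral>\<^sup>+w. ennreal (cmod (f (\<psi> w)) * cmod (deriv \<psi> w) / (cmod (1 - cnj a * w))\<^sup>2) \<partial>lebesgue_on unit_disc)"
    (is "?l \<le> _ * ?R") .
  have "ennreal (cmod (g (\<psi> a)) * cmod (deriv \<psi> a)) = ennreal (1 / (pi * (1 - (cmod a)\<^sup>2))) * ?l"
    using a2 by (simp add: ennreal_mult'[symmetric] mult.assoc[symmetric])
  also have "\<dots> \<le> ennreal (1 / (pi * (1 - (cmod a)\<^sup>2))) * (ennreal (1 - (cmod a)\<^sup>2) * ?R)"
    by (rule mult_left_mono[OF le]) simp
  also have "\<dots> = ennreal (1/pi) * ?R"
    using a2 by (simp add: ennreal_mult'[symmetric] mult.assoc[symmetric])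
  finally show ?thesis .
qed

section \<open>Geometry of Carleson boxes\<close>

text \<open>Dividing by the reference point moves it to 1, where real part at least 1/2 and
  imaginary part at most \<delta> bound the angle through the arctangent. Some angle is produced
  rather than \<open>Arg\<close>, which jumps across the negative axis.\<close>

lemma polar_near:
  assumes "R > 0" "cmod (z - of_real R * cis \<alpha>) \<le> \<delta> * R" "\<delta> \<le> 1/2"
  obtains \<theta> where "z = of_real (cmod z) * cis \<theta>" "\<bar>\<theta> - \<alpha>\<bar> \<le> 2 * \<delta>"
proof -
  define v where "v = z / (of_real R * cis \<alpha>)"
  have z: "z = v * (of_real R * cis \<alpha>)"
    using assms by (simp add: v_def)
  have "z - of_real R * cis \<alpha> = (v - 1) * (of_real R * cis \<alpha>)"
    by (simp add: z algebra_simps)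
  then have "cmod (z - of_real R * cis \<alpha>) = cmod (v - 1) * R"
    using assms by (simp add: norm_mult)
  then have v1: "cmod (v - 1) \<le> \<delta>"
    using assms by simp
  have re: "Re v \<ge> 1/2" and im: "\<bar>Im v\<bar> \<le> \<delta>"
    using abs_Re_le_cmod[of "v-1"] abs_Im_le_cmod[of "v-1"] v1 assms by auto
  define x where "x = Im v / Re v"
  have "\<bar>x\<bar> \<le> \<delta> / (1/2)"
    unfolding x_def abs_divide by (rule frac_le) (use re im in auto)
  then have x: "\<bar>x\<bar> \<le> 2 * \<delta>" by simp
  have s: "cmod v = Re v * sqrt (1 + x\<^sup>2)"
  proof -
    have "1 + x\<^sup>2 = ((Re v)\<^sup>2 + (Im v)\<^sup>2) / (Re v)\<^sup>2"
      using re by (simp add: x_def power_divide field_simps)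
    then show ?thesis
      using re by (simp add: real_sqrt_divide cmod_def)
  qed
  have "sqrt (1 + x\<^sup>2) > 0"
    by (simp add: add_pos_nonneg)
  then have v: "v = of_real (cmod v) * cis (arctan x)"
    using re unfolding s by (simp add: complex_eq_iff cos_arctan sin_arctan x_def)
  have "z = of_real (cmod z) * cis (\<alpha> + arctan x)"
  proof -
    have "cmod z = cmod v * R"
      using assms by (simp add: z norm_mult)
    then show ?thesis
      using z v by (metis (no_types, opaque_lifting) cis_mult mult.assoc mult.commute of_real_mult)
  qed
  moreover have "\<bar>arctan x\<bar> \<le> \<bar>x\<bar>"
    by (rule abs_arctan_le)
  ultimately show ?thesis
    using that[of "\<alpha> + arctan x"] x by simp
qed

lemma Qbox_iff: "z \<in> Qbox \<theta>0 l \<longleftrightarrow>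
  cmod z < 1 \<and> 1 - cmod z \<le> l \<and> (\<exists>\<theta>. z = of_real (cmod z) * cis \<theta> \<and> \<bar>\<theta> - \<theta>0\<bar> \<le> l / 2)"
proof
  assume "z \<in> Qbox \<theta>0 l"
  then obtain r \<theta> where r: "cmod z < 1" "z = of_real r * cis \<theta>" "0 \<le> r" "1 - r \<le> l" "\<bar>\<theta> - \<theta>0\<bar> \<le> l / 2"
    by (auto simp: Qbox_def)
  have cz: "cmod z = r"
    unfolding r(2) using r(3) by (simp add: norm_mult)
  show "cmod z < 1 \<and> 1 - cmod z \<le> l \<and> (\<exists>\<theta>. z = of_real (cmod z) * cis \<theta> \<and> \<bar>\<theta> - \<theta>0\<bar> \<le> l / 2)"
    using r unfolding cz by blast
next
  assume *: "cmod z < 1 \<and> 1 - cmod z \<le> l \<and> (\<exists>\<theta>. z = of_real (cmod z) * cis \<theta> \<and> \<bar>\<theta> - \<theta>0\<bar> \<le> l / 2)"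
  then have "z \<in> unit_disc" "0 \<le> cmod z" by simp_all
  with * show "z \<in> Qbox \<theta>0 l"
    unfolding Qbox_def by blast
qed

lemma Qbox_subset_disc: "Qbox \<theta>0 l \<subseteq> unit_disc"
  by (auto simp: Qbox_def)

lemma Qbox_borel [measurable]: "Qbox \<theta>0 l \<in> sets borel"
proof -
  let ?K = "(\<lambda>(r,\<theta>). of_real r * cis \<theta>) ` ({max 0 (1-l)..1} \<times> {\<theta>0 - l/2..\<theta>0 + l/2})"
  have "compact ?K"
    by (intro compact_continuous_image compact_Times compact_Icc)
      (auto intro!: continuous_intros simp: split_beta)
  moreover have "Qbox \<theta>0 l = ball 0 1 \<inter> ?K"
    unfolding Qbox_def by (fastforce simp: norm_mult abs_if split: if_splits)
  ultimately show ?thesis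
    by (metis borel_compact borel_open open_ball sets.Int)
qed

text \<open>For \<open>m = 1\<close> this is the bottom half of the box, the union of its two dyadic
  children; the top half is the difference of the box and this strip.\<close>

definition strip :: "real \<Rightarrow> real \<Rightarrow> nat \<Rightarrow> complex set" where
  "strip \<theta>0 l m = Qbox \<theta>0 l \<inter> {z. 1 - cmod z \<le> l / 2 ^ m}"

lemma strip_borel [measurable]: "strip \<theta>0 l m \<in> sets borel"
  unfolding strip_def by measurable

lemma strip_0: "strip \<theta>0 l 0 = Qbox \<theta>0 l"
  by (auto simp: strip_def Qbox_iff)

lemma strip_subset: "strip \<theta>0 l m \<subseteq> Qbox \<theta>0 l"
  by (auto simp: strip_def)

text \<open>Passing to a child halves the box and lowers the level by one, so the absolute height of
  the strip is unchanged. Iterating this reduces every level to the case of one bottom half.\<close>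

lemma strip_Suc:
  assumes "l > 0"
  shows "strip \<theta>0 l (Suc m) = strip (\<theta>0 - l/4) (l/2) m \<union> strip (\<theta>0 + l/4) (l/2) m"
proof (intro set_eqI iffI)
  fix z assume z: "z \<in> strip \<theta>0 l (Suc m)"
  then obtain \<theta> where t: "cmod z < 1" "1 - cmod z \<le> l / 2 ^ Suc m" "z = of_real (cmod z) * cis \<theta>" "\<bar>\<theta> - \<theta>0\<bar> \<le> l/2"
    by (auto simp: strip_def Qbox_iff)
  have "l / 2 ^ Suc m \<le> l / 2"
    using assms by (intro divide_left_mono) auto
  then have "1 - cmod z \<le> l/2" "1 - cmod z \<le> l/2/2^m"
    using t by auto
  moreover have "\<bar>\<theta> - (\<theta>0 - l/4)\<bar> \<le> l/2/2 \<or> \<bar>\<theta> - (\<theta>0 + l/4)\<bar> \<le> l/2/2"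
    using t(4) by linarith
  ultimately show "z \<in> strip (\<theta>0 - l/4) (l/2) m \<union> strip (\<theta>0 + l/4) (l/2) m"
    unfolding strip_def Qbox_iff Un_iff Int_iff mem_Collect_eq using t by blast
next
  fix z assume "z \<in> strip (\<theta>0 - l/4) (l/2) m \<union> strip (\<theta>0 + l/4) (l/2) m"
  then obtain \<theta> where t: "cmod z < 1" "1 - cmod z \<le> l/2" "1 - cmod z \<le> l/2 / 2 ^ m" "z = of_real (cmod z) * cis \<theta>"
     "\<bar>\<theta> - (\<theta>0 - l/4)\<bar> \<le> l/2/2 \<or> \<bar>\<theta> - (\<theta>0 + l/4)\<bar> \<le> l/2/2"
    by (auto simp: strip_def Qbox_iff)
  from t(5) have "\<bar>\<theta> - \<theta>0\<bar> \<le> l/2"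
    by linarith
  moreover have "1 - cmod z \<le> l" "1 - cmod z \<le> l/2^Suc m"
    using assms t by auto
  ultimately show "z \<in> strip \<theta>0 l (Suc m)"
    unfolding strip_def Qbox_iff Int_iff mem_Collect_eq using t by blast
qed

text \<open>The two children share only the ray through \<open>cis \<theta>0\<close>, which lies on
  a line.\<close>

lemma Qbox_halves_negligible:
  assumes "0 < l" "l \<le> 1"
  shows "Qbox (\<theta>0 - l/4) (l/2) \<inter> Qbox (\<theta>0 + l/4) (l/2) \<in> null_sets lebesgue"
proof -
  have "Qbox (\<theta>0 - l/4) (l/2) \<inter> Qbox (\<theta>0 + l/4) (l/2) \<subseteq> {z. (\<i> * cis \<theta>0) \<bullet> z = 0}"
  proof
    fix z assume "z \<in> Qbox (\<theta>0 - l/4) (l/2) \<inter> Qbox (\<theta>0 + l/4) (l/2)"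
    then obtain \<theta> \<theta>' where t: "z = of_real (cmod z) * cis \<theta>" "z = of_real (cmod z) * cis \<theta>'"
      "\<bar>\<theta> - (\<theta>0 - l/4)\<bar> \<le> l/2/2" "\<bar>\<theta>' - (\<theta>0 + l/4)\<bar> \<le> l/2/2"
      by (auto simp: Qbox_iff)
    show "z \<in> {z. (\<i> * cis \<theta>0) \<bullet> z = 0}"
    proof (cases "z = 0")
      case False
      then have "cis \<theta> = cis \<theta>'"
        using t(1,2) by (metis mult_cancel_left norm_eq_zero of_real_eq_0_iff)
      then have "sin (\<theta>' - \<theta>) = 0"
        by (simp add: sin_diff cis.ctr complex_eq_iff)
      \<comment> \<open>Box angles are measured in radians in \<open>Qbox\<close>, so
        \<open>l \<le> 1\<close> keeps the two representing angles less than a half turn apart and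
        they cannot differ by a multiple of pi.\<close>
      moreover have "0 \<le> \<theta>' - \<theta>" "\<theta>' - \<theta> < pi"
        using t(3,4) assms pi_gt3 by (auto simp: abs_if split: if_splits)
      ultimately have "\<theta>' = \<theta>"
        using sin_gt_zero[of "\<theta>' - \<theta>"] by linarith
      then have "\<theta> = \<theta>0"
        using t(3,4) by (simp add: abs_if split: if_splits)
      then have "z = of_real (cmod z) * cis \<theta>0"
        using t by simp
      then obtain r where "z = of_real r * cis \<theta>0" ..
      then show ?thesis
        by (simp add: inner_complex_def)
    qed simp
  qed
  moreover have "negligible {z. (\<i> * cis \<theta>0) \<bullet> z = 0}"
    by (rule negligible_hyperplane) simp
  ultimately show ?thesis
    using negligible_iff_null_sets negligible_subset by blast
qed

lemma emeasure_lebesgue_ball_complex: "r \<ge> 0 \<Longrightarrow> emeasure lebesgue (ball (c::complex) r) = ennreal (pi * r\<^sup>2)"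
  by (simp add: emeasure_ball) (metis of_nat_numeral unit_ball_vol_2)

text \<open>A point of the box is within \<open>l\<close> of its radial projection to the circle,
  which is within \<open>l/2\<close> of \<open>cis \<theta>0\<close>; hence a disc of radius
  \<open>2 * l\<close> contains the box.\<close>

lemma emeasure_Qbox_le:
  assumes "0 < l" "l \<le> 1"
  shows "emeasure lebesgue (Qbox \<theta>0 l) \<le> ennreal (4 * pi * l\<^sup>2)"
proof -
  have "Qbox \<theta>0 l \<subseteq> ball (cis \<theta>0) (2 * l)"
  proof
    fix z assume "z \<in> Qbox \<theta>0 l"
    then obtain \<theta> where t: "cmod z < 1" "1 - cmod z \<le> l" "z = of_real (cmod z) * cis \<theta>" "\<bar>\<theta> - \<theta>0\<bar> \<le> l/2"
      by (auto simp: Qbox_iff)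
    have "dist (cis \<theta>) (cis \<theta>0) \<le> \<bar>\<theta> - \<theta>0\<bar>"
    proof -
      have "cis \<theta> - cis \<theta>0 = cis \<theta>0 * (exp (\<i> * of_real (\<theta> - \<theta>0)) - 1)"
        by (simp add: algebra_simps cis_conv_exp exp_diff del: of_real_diff) (simp add: algebra_simps exp_add[symmetric])
      then have "cmod (cis \<theta> - cis \<theta>0) = 2 * \<bar>sin ((\<theta> - \<theta>0)/2)\<bar>"
        by (simp add: norm_mult dist_exp_i_1 del: of_real_diff)
      then show ?thesis
        using abs_sin_x_le_abs_x[of "(\<theta> - \<theta>0)/2"] by (simp add: dist_norm)
    qed
    moreover have "dist z (cis \<theta>) = 1 - cmod z"
    proof -
      have "z - cis \<theta> = of_real (cmod z - 1) * cis \<theta>"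
        using t(3) by (simp add: algebra_simps)
      then show ?thesis
        using t(1) by (simp add: dist_norm norm_mult del: of_real_diff)
    qed
    ultimately have "dist z (cis \<theta>0) < 2 * l"
      using t assms dist_triangle[of z "cis \<theta>0" "cis \<theta>"] by linarith
    then show "z \<in> ball (cis \<theta>0) (2 * l)"
      by (simp add: dist_commute)
  qed
  then have "emeasure lebesgue (Qbox \<theta>0 l) \<le> emeasure lebesgue (ball (cis \<theta>0) (2 * l))"
    by (intro emeasure_mono) auto
  also have "\<dots> = ennreal (4 * pi * l\<^sup>2)"
    using assms by (subst emeasure_lebesgue_ball_complex) (auto simp: power2_eq_square algebra_simps)
  finally show ?thesis .
qed

text \<open>A disc around the point at depth \<open>3*l/4\<close> stays in the top half. The centre
  has modulus at least 1/4, so the radius \<open>l/16\<close> is at most \<open>l/4\<close> times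
  that modulus, and the angle moves by at most \<open>l/2\<close>.\<close>

lemma emeasure_Qbox_top_ge:
  assumes "0 < l" "l \<le> 1"
  shows "ennreal (pi * l\<^sup>2 / 256) \<le> emeasure lebesgue (Qbox \<theta>0 l - strip \<theta>0 l 1)"
proof -
  let ?R = "1 - 3*l/4"
  have "ball (of_real ?R * cis \<theta>0) (l/16) \<subseteq> Qbox \<theta>0 l - strip \<theta>0 l 1"
  proof
    fix z assume "z \<in> ball (of_real ?R * cis \<theta>0) (l/16)"
    then have z: "cmod (z - of_real ?R * cis \<theta>0) < l/16"
      by (simp add: dist_norm norm_minus_commute)
    have R: "?R \<ge> 1/4" using assms by simp
    have "l/4 * (1/4) \<le> l/4 * ?R"
      using R assms by (intro mult_left_mono) auto
    then have "cmod (z - of_real ?R * cis \<theta>0) \<le> l/4 * ?R"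
      using z by linarith
    then obtain \<theta> where t: "z = of_real (cmod z) * cis \<theta>" "\<bar>\<theta> - \<theta>0\<bar> \<le> 2 * (l/4)"
      by (rule polar_near[rotated]) (use R assms in auto)
    have "cmod (of_real ?R * cis \<theta>0) = \<bar>?R\<bar>"
      by (simp only: norm_mult norm_of_real norm_cis mult_1_right)
    then have "cmod (of_real ?R * cis \<theta>0) = ?R"
      using R by linarith
    then have "\<bar>cmod z - ?R\<bar> < l/16"
      using z norm_triangle_ineq3[of z "of_real ?R * cis \<theta>0"] by linarith
    then have "cmod z < 1" "1 - cmod z \<le> l" "\<not> 1 - cmod z \<le> l / 2"
      using assms by linarith+
    then show "z \<in> Qbox \<theta>0 l - strip \<theta>0 l 1"
      using t by (auto simp: strip_def Qbox_iff)
  qed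
  then have "emeasure lebesgue (ball (of_real ?R * cis \<theta>0) (l/16)) \<le> emeasure lebesgue (Qbox \<theta>0 l - strip \<theta>0 l 1)"
    by (intro emeasure_mono) auto
  moreover have "emeasure lebesgue (ball (of_real ?R * cis \<theta>0) (l/16)) = ennreal (pi * l\<^sup>2 / 256)"
    using assms by (subst emeasure_lebesgue_ball_complex) (auto simp: power_divide)
  ultimately show ?thesis
    by simp
qed

text \<open>Since \<open>l \<le> 1/2\<close>, the modulus of \<open>z\<close> is at least 1/2, so a
  displacement below \<open>l/8\<close> changes the angle by at most \<open>l/2\<close>. The doubled
  box has room for exactly this much.\<close>

lemma ball_subset_Qbox_double:
  assumes "0 < l" "l \<le> 1/2" and z: "z \<in> Qbox \<theta>0 l"
  shows "ball z ((1 - cmod z)/8) \<subseteq> Qbox \<theta>0 (2*l)"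
proof
  fix x assume x: "x \<in> ball z ((1 - cmod z)/8)"
  obtain \<theta> where t: "cmod z < 1" "1 - cmod z \<le> l" "z = of_real (cmod z) * cis \<theta>" "\<bar>\<theta> - \<theta>0\<bar> \<le> l/2"
    using z by (auto simp: Qbox_iff)
  have r: "cmod z \<ge> 1/2" using t assms by simp
  have xz: "cmod (x - z) < (1 - cmod z)/8"
    using x by (simp add: dist_norm norm_minus_commute)
  also have "\<dots> \<le> l/4 * cmod z"
  proof -
    have "l/4 * (1/2) \<le> l/4 * cmod z"
      using r assms by (intro mult_left_mono) auto
    moreover have "(1 - cmod z) / 8 \<le> l/4 * (1/2)"
      using t(2) by simp
    ultimately show ?thesis
      by (rule order_trans[rotated])
  qed
  finally have "cmod (x - of_real (cmod z) * cis \<theta>) \<le> l/4 * cmod z"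
    unfolding t(3)[symmetric] by linarith
  then obtain \<theta>' where "x = of_real (cmod x) * cis \<theta>'" "\<bar>\<theta>' - \<theta>\<bar> \<le> 2 * (l/4)"
    by (rule polar_near[rotated]) (use r assms in auto)
  moreover have 8: "8 * \<bar>cmod x - cmod z\<bar> < 1 - cmod z"
  proof -
    have "8 * \<bar>cmod x - cmod z\<bar> \<le> 8 * cmod (x - z)"
      by (intro mult_left_mono norm_triangle_ineq3) simp
    also have "\<dots> < 1 - cmod z"
      using xz by simp
    finally show ?thesis .
  qed
  moreover from calculation have "\<bar>\<theta>' - \<theta>0\<bar> \<le> 2*l/2"
    using t by linarith
  moreover have "cmod x < 1" "1 - cmod x \<le> 2 * l"
    using 8 t(1,2) assms(1) by (auto simp: abs_if split: if_splits)
  ultimately show "x \<in> Qbox \<theta>0 (2*l)"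
    unfolding Qbox_iff by (intro conjI exI[of _ \<theta>'])
qed

lemma near_in_Qbox:
  assumes "0 < l" "l \<le> 1/2" "cmod z < 1" "1 - cmod w \<le> l/8" "1 - cmod z \<le> l" "cmod (z - w) \<le> l/8"
  shows "z \<in> Qbox (Arg w) l"
proof -
  have r: "cmod w \<ge> 1/2" using assms by simp
  have w: "w = of_real (cmod w) * cis (Arg w)"
    by (metis rcis_cmod_Arg rcis_def)
  have "l/4 * (1/2) \<le> l/4 * cmod w"
    using r assms by (intro mult_left_mono) auto
  then have "cmod (z - of_real (cmod w) * cis (Arg w)) \<le> l/4 * cmod w"
    unfolding w[symmetric] using assms(6) by linarith
  then obtain \<theta> where "z = of_real (cmod z) * cis \<theta>" "\<bar>\<theta> - Arg w\<bar> \<le> 2 * (l/4)"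
    by (rule polar_near[rotated]) (use r assms in auto)
  then show ?thesis
    unfolding Qbox_iff using assms by (intro conjI exI[of _ \<theta>]) auto
qed

text \<open>The third bound rests on |1 - cnj z * w|^2 - |z - w|^2 = (1 - |z|^2) * (1 - |w|^2).
  Together the bounds confine each level set of the Bergman kernel to a Carleson box of comparable
  size.\<close>

lemma one_minus_norm_le:
  assumes "cmod z < 1" "cmod w < 1"
  shows "1 - cmod z \<le> cmod (1 - cnj z * w)" "1 - cmod w \<le> cmod (1 - cnj z * w)"
    and "cmod (z - w) \<le> cmod (1 - cnj z * w)"
proof -
  have "1 - cmod z * cmod w \<le> cmod (1 - cnj z * w)"
    using norm_triangle_ineq2[of 1 "cnj z * w"] by (simp add: norm_mult)
  moreover have "cmod z * cmod w \<le> cmod z" "cmod z * cmod w \<le> cmod w"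
    using assms by (simp_all add: mult_left_le mult_left_le_one_le)
  ultimately show "1 - cmod z \<le> cmod (1 - cnj z * w)" "1 - cmod w \<le> cmod (1 - cnj z * w)"
    by linarith+
  have "(cmod (1 - cnj z * w))\<^sup>2 - (cmod (z - w))\<^sup>2 = (1 - (cmod z)\<^sup>2) * (1 - (cmod w)\<^sup>2)"
    unfolding cmod_power2 by (simp add: power2_eq_square algebra_simps)
  moreover have "(1 - (cmod z)\<^sup>2) * (1 - (cmod w)\<^sup>2) \<ge> 0"
    using assms by (intro mult_nonneg_nonneg) (auto simp: power_le_one)
  ultimately have "(cmod (z - w))\<^sup>2 \<le> (cmod (1 - cnj z * w))\<^sup>2"
    by linarith
  then show "cmod (z - w) \<le> cmod (1 - cnj z * w)"
    by (rule power2_le_imp_le) simp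
qed

lemma unit_disc_subset_sectors: "unit_disc \<subseteq> (\<Union>j<7::nat. Qbox (real j) 1)"
proof
  fix z :: complex assume "z \<in> unit_disc"
  then have z: "cmod z < 1" by simp
  define \<theta> where "\<theta> = Arg2pi z"
  have t: "0 \<le> \<theta>" "\<theta> < 2 * pi" "z = of_real (cmod z) * cis \<theta>"
    using Arg2pi[of z] by (auto simp: \<theta>_def is_Arg_def cis_conv_exp)
  \<comment> \<open>Boxes of size 1 span one radian, so seven of them centred at 0, ..., 6 cover a
    full turn: the nearest integer to an angle below 6.5 is at most 6.\<close>
  define j where "j = nat \<lfloor>\<theta> + 1/2\<rfloor>"
  have "\<theta> < 6.5"
    using t pi_approx by (simp add: pi_less_4)
  then have "\<lfloor>\<theta> + 1/2\<rfloor> < 7"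
    by linarith
  then have "j < 7" "real j = of_int \<lfloor>\<theta> + 1/2\<rfloor>"
    using t unfolding j_def by linarith+
  moreover from this have "\<bar>\<theta> - real j\<bar> \<le> 1/2"
    by linarith
  ultimately show "z \<in> (\<Union>j<7::nat. Qbox (real j) 1)"
    unfolding Qbox_iff using z t by (intro UN_I[of j]) (auto simp: Qbox_iff)
qed

section \<open>A dyadic Schur test\<close>

text \<open>Young's inequality after dividing by the bounds \<open>X\<close> and \<open>Y\<close>.
  The hypotheses are upper bounds, so the integrals never need to be computed; a zero bound is
  treated apart because the normalisation would divide by it.\<close>

lemma nn_integral_Holder:
  fixes f g :: "'a \<Rightarrow> real"
  assumes pq: "p > 1" "q > 1" "1/p + 1/q = 1"
    and [measurable]: "f \<in> borel_measurable M" "g \<in> borel_measurable M"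
    and nn: "\<And>x. f x \<ge> 0" "\<And>x. g x \<ge> 0"
    and X: "(\<integral>\<^sup>+x. ennreal (f x powr p) \<partial>M) \<le> ennreal X" "X \<ge> 0"
    and Y: "(\<integral>\<^sup>+x. ennreal (g x powr q) \<partial>M) \<le> ennreal Y" "Y \<ge> 0"
  shows "(\<integral>\<^sup>+x. ennreal (f x * g x) \<partial>M) \<le> ennreal (X powr (1/p) * Y powr (1/q))"
proof (cases "X = 0 \<or> Y = 0")
  case True
  have "AE x in M. f x * g x = 0"
  proof (cases "X = 0")
    case True
    then have "(\<integral>\<^sup>+x. ennreal (f x powr p) \<partial>M) = 0"
      using X by simp
    then have "AE x in M. ennreal (f x powr p) = 0"
      by (subst (asm) nn_integral_0_iff_AE) auto
    then show ?thesis
      by eventually_elim (auto simp: ennreal_eq_0_iff)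
  next
    case False
    then have "(\<integral>\<^sup>+x. ennreal (g x powr q) \<partial>M) = 0"
      using Y \<open>X = 0 \<or> Y = 0\<close> by simp
    then have "AE x in M. ennreal (g x powr q) = 0"
      by (subst (asm) nn_integral_0_iff_AE) auto
    then show ?thesis
      by eventually_elim (auto simp: ennreal_eq_0_iff)
  qed
  then have "(\<integral>\<^sup>+x. ennreal (f x * g x) \<partial>M) = (\<integral>\<^sup>+x. 0 \<partial>M)"
    by (intro nn_integral_cong_AE) (auto elim: eventually_mono)
  then show ?thesis by simp
next
  case False
  then have XY: "X > 0" "Y > 0" using X Y by auto
  define c where "c = X powr (1/p) * Y powr (1/q)"
  have c: "c > 0" using XY by (simp add: c_def)
  have young: "f x * g x \<le> c * (f x powr p / (p * X) + g x powr q / (q * Y))" for x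
  proof -
    have "(f x / X powr (1/p)) * (g x / Y powr (1/q)) \<le> (f x / X powr (1/p)) powr p / p + (g x / Y powr (1/q)) powr q / q"
      by (rule Youngs_inequality) (use pq nn in auto)
    also have "(f x / X powr (1/p)) powr p = f x powr p / X"
      using XY pq nn by (simp add: powr_divide powr_powr)
    also have "(g x / Y powr (1/q)) powr q = g x powr q / Y"
      using XY pq nn by (simp add: powr_divide powr_powr)
    finally have "f x * g x / c \<le> f x powr p / (p * X) + g x powr q / (q * Y)"
      by (simp add: c_def mult.commute)
    then show ?thesis
      using c by (simp add: pos_divide_le_eq mult.commute)
  qed
  have "(\<integral>\<^sup>+x. ennreal (f x * g x) \<partial>M)
      \<le> (\<integral>\<^sup>+x. ennreal c * (ennreal (1/(p*X)) * ennreal (f x powr p) + ennreal (1/(q*Y)) * ennreal (g x powr q)) \<partial>M)"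
  proof (intro nn_integral_mono)
    fix x
    have "ennreal (f x * g x) \<le> ennreal (c * (f x powr p / (p * X) + g x powr q / (q * Y)))"
      by (rule ennreal_leI[OF young])
    also have "\<dots> = ennreal c * (ennreal (1/(p*X)) * ennreal (f x powr p) + ennreal (1/(q*Y)) * ennreal (g x powr q))"
      using c pq XY by (simp add: ennreal_mult'[symmetric] ennreal_plus[symmetric] del: ennreal_plus)
    finally show "ennreal (f x * g x) \<le> \<dots>" .
  qed
  also have "\<dots> = ennreal c * (ennreal (1/(p*X)) * (\<integral>\<^sup>+x. ennreal (f x powr p) \<partial>M)
      + ennreal (1/(q*Y)) * (\<integral>\<^sup>+x. ennreal (g x powr q) \<partial>M))"
    by (simp add: nn_integral_cmult nn_integral_add)
  also have "\<dots> \<le> ennreal c * (ennreal (1/(p*X)) * ennreal X + ennreal (1/(q*Y)) * ennreal Y)"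
    by (intro mult_left_mono add_mono X Y) auto
  also have "\<dots> = ennreal (c * (1/p + 1/q))"
    using c pq(1,2) XY by (simp add: ennreal_mult'[symmetric] ennreal_plus[symmetric] del: ennreal_plus)
  finally show ?thesis
    by (simp add: pq(3) c_def)
qed

text \<open>Measured from the largest index \<open>n\<close> in \<open>S\<close>, the terms are
  dominated by a geometric sequence in \<open>n - k\<close>, because already
  \<open>2 ^ n * x \<le> 1\<close>. Hence the bound does not depend on \<open>x\<close>.\<close>

lemma dyadic_geometric_sum:
  fixes x s :: real
  assumes "x > 0" "s > 0" "finite S" and S: "\<And>k. k \<in> S \<Longrightarrow> 2 ^ k * x \<le> 1"
  shows "(\<Sum>k\<in>S. (2 ^ k * x) powr s) \<le> 1 / (1 - 2 powr (- s))"
proof (cases "S = {}")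
  case True
  have "2 powr (-s) < 1" using assms by (simp add: powr_less_one)
  then show ?thesis using True by simp
next
  case False
  define n where "n = Max S"
  define r where "r = 2 powr (-s)"
  have r: "0 < r" "r < 1" using assms by (auto simp: r_def powr_less_one)
  have n: "n \<in> S" "\<And>k. k \<in> S \<Longrightarrow> k \<le> n"
    using False assms by (auto simp: n_def)
  have "(\<Sum>k\<in>S. (2 ^ k * x) powr s) \<le> (\<Sum>k\<in>S. r ^ (n - k))"
  proof (rule sum_mono)
    fix k assume k: "k \<in> S"
    have "2 ^ n = 2 ^ (n - k) * (2::real) ^ k"
      using n(2)[OF k] by (simp flip: power_add)
    then have "2 ^ (n - k) * (2 ^ k * x) \<le> 1"
      using S[OF n(1)] by (simp add: mult.assoc)
    then have "2 ^ k * x \<le> 2 powr (- real (n - k))"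
      by (simp add: powr_minus powr_realpow field_simps)
    then have "(2 ^ k * x) powr s \<le> (2 powr (- real (n - k))) powr s"
      using assms by (intro powr_mono2) auto
    also have "\<dots> = r ^ (n - k)"
      by (simp add: r_def powr_powr powr_power mult.commute)
    finally show "(2 ^ k * x) powr s \<le> r ^ (n - k)" .
  qed
  also have "\<dots> \<le> (\<Sum>k\<le>n. r ^ (n - k))"
    using n r by (intro sum_mono2) auto
  also have "\<dots> = (\<Sum>j\<le>n. r ^ j)"
    by (rule sum.nat_diff_reindex[of _ "Suc n", unfolded lessThan_Suc_atMost, simplified])
  also have "\<dots> \<le> (\<Sum>j. r ^ j)"
    using r by (intro sum_le_suminf summable_geometric) auto
  also have "\<dots> = 1 / (1 - r)"
    using r by (intro suminf_geometric) auto
  finally show ?thesis by (simp add: r_def)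
qed

lemma finite_dyadic_small: "(x::real) > 0 \<Longrightarrow> finite {k. 2 ^ k * x \<le> 1}"
proof -
  assume x: "x > 0"
  obtain n where n: "1 / x < 2 ^ n"
    using real_arch_pow[of 2 "1/x"] by auto
  have "k \<le> n" if "2 ^ k * x \<le> 1" for k
  proof (rule ccontr)
    assume "\<not> k \<le> n"
    then have "(2::real) ^ n \<le> 2 ^ k" by (intro power_increasing) auto
    then have "1 / x < 2 ^ k" using n by linarith
    then show False using x that by (simp add: field_simps)
  qed
  then have "{k. 2 ^ k * x \<le> 1} \<subseteq> {..n}"
    by blast
  then show ?thesis
    by (rule finite_subset) simp
qed

text \<open>Hoelder for counting measure, with \<open>c k\<close> split as
  \<open>c k * t k powr (- \<eta> / p)\<close> times \<open>t k powr (\<eta> / p)\<close>. The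
  second factor has a controlled sum, so the power of a sum is exchanged for a weighted sum of
  powers.\<close>

lemma powr_sum_le:
  fixes c t :: "nat \<Rightarrow> real"
  assumes p: "p > 1" and "finite S" and c: "\<And>k. c k \<ge> 0" and t: "\<And>k. t k > 0" and "\<eta> > 0"
    and K: "(\<Sum>k\<in>S. t k powr (\<eta> / (p - 1))) \<le> K"
  shows "(\<Sum>k\<in>S. c k) powr p \<le> K powr (p - 1) * (\<Sum>k\<in>S. c k powr p * t k powr (- \<eta>))"
proof -
  define q where "q = p / (p - 1)"
  have q: "q > 1" "1/p + 1/q = 1" using p by (auto simp: q_def field_simps)
  define X where "X = (\<Sum>k\<in>S. c k powr p * t k powr (- \<eta>))"
  have K0: "K \<ge> 0"
    using K by (rule order_trans[rotated]) (auto intro: sum_nonneg)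
  have X0: "X \<ge> 0" by (auto simp: X_def intro: sum_nonneg)
  have "(\<integral>\<^sup>+k. ennreal ((c k * t k powr (- \<eta> / p)) * (t k powr (\<eta> / p))) \<partial>count_space S)
      \<le> ennreal (X powr (1/p) * K powr (1/q))"
  proof (rule nn_integral_Holder)
    show "(\<integral>\<^sup>+k. ennreal ((c k * t k powr (- \<eta> / p)) powr p) \<partial>count_space S) \<le> ennreal X"
      using \<open>finite S\<close> p c t
      by (simp add: nn_integral_count_space_finite X_def powr_mult powr_powr)
    have "(t k powr (\<eta> / p)) powr q = t k powr (\<eta> / (p - 1))" for k
      using p by (simp add: q_def powr_powr field_simps)
    then show "(\<integral>\<^sup>+k. ennreal ((t k powr (\<eta> / p)) powr q) \<partial>count_space S) \<le> ennreal K"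
      using \<open>finite S\<close> K by (simp add: nn_integral_count_space_finite ennreal_leI)
  qed (use p q c X0 K0 in auto)
  moreover have eq: "(c k * t k powr (- \<eta> / p)) * (t k powr (\<eta> / p)) = c k" for k
    using t[of k] by (simp add: mult.assoc powr_add[symmetric])
  ultimately have "(\<Sum>k\<in>S. ennreal (c k)) \<le> ennreal (X powr (1/p) * K powr (1/q))"
    using \<open>finite S\<close> unfolding eq by (simp add: nn_integral_count_space_finite)
  then have "(\<Sum>k\<in>S. c k) \<le> X powr (1/p) * K powr (1/q)"
    using c by (simp add: sum_ennreal)
  then have "(\<Sum>k\<in>S. c k) powr p \<le> (X powr (1/p) * K powr (1/q)) powr p"
    using p c by (intro powr_mono2) (auto intro: sum_nonneg)
  also have "\<dots> = X * K powr (p - 1)"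
    using p X0 by (simp add: powr_mult powr_powr q_def)
  finally show ?thesis by (simp add: X_def mult.commute)
qed

text \<open>Take the largest \<open>k\<close> with \<open>2 ^ k * r \<le> 2\<close>; by maximality
  \<open>2 ^ k * r\<close> exceeds 1.\<close>

lemma dyadic_kernel_bound:
  assumes "0 < r" "r \<le> (2::real)"
  obtains k :: nat where "r \<le> 2 / 2 ^ k" "1 / r\<^sup>2 \<le> 4 ^ k"
proof -
  define S where "S = {k. 2 ^ k * (r/2) \<le> 1}"
  have S: "finite S" "0 \<in> S"
    using assms finite_dyadic_small[of "r/2"] by (auto simp: S_def)
  define k where "k = Max S"
  have "k \<in> S" unfolding k_def using S by (intro Max_in) auto
  then have k1: "r \<le> 2 / 2 ^ k" by (simp add: S_def field_simps)
  have "Suc k \<notin> S" using S by (metis Max_ge Suc_n_not_le_n k_def)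
  then have "1 \<le> 2 ^ k * r" by (simp add: S_def)
  then have "1 \<le> (2 ^ k * r)\<^sup>2" by (simp add: one_le_power)
  also have "(2 ^ k * r)\<^sup>2 = 4 ^ k * r\<^sup>2"
    by (simp add: power_mult_distrib power2_eq_square flip: power_mult_distrib)
  finally have "1 / r\<^sup>2 \<le> 4 ^ k"
    using assms by (simp add: field_simps)
  then show ?thesis using k1 that by blast
qed

text \<open>The factor \<open>(2 ^ k * d x) powr (- \<eta>)\<close> in the two-weight condition is the self-improvement that
  makes the sum over the scales \<open>k\<close> converge geometrically in both variables.\<close>
lemma dyadic_schur_bound:
  fixes M :: "'a measure" and E :: "nat \<Rightarrow> ('a \<times> 'a) set" and d \<omega> F G :: "'a \<Rightarrow> real"
  assumes "sigma_finite_measure M" and p: "p > 1" and \<eta>: "\<eta> > 0" and C: "C > 0"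
    and E[measurable]: "\<And>k. E k \<in> sets (M \<Otimes>\<^sub>M M)"
    and d[measurable]: "d \<in> borel_measurable M" and \<omega>[measurable]: "\<omega> \<in> borel_measurable M"
    and F[measurable]: "F \<in> borel_measurable M"
    and sym: "\<And>k z w. (z, w) \<in> E k \<Longrightarrow> (w, z) \<in> E k"
    and small: "\<And>k z w. (z, w) \<in> E k \<Longrightarrow> 2 ^ k * d z \<le> 1"
    and pos: "\<And>z. d z > 0" "\<And>z. \<omega> z > 0" "\<And>z. F z \<ge> 0" "\<And>z. G z \<ge> 0"
    and cond: "\<And>k w. w \<in> space M \<Longrightarrow> \<exists>a b. 0 \<le> a \<and> 0 \<le> b \<and>
      (\<forall>z. (w, z) \<in> E k \<longrightarrow>
        (\<integral>\<^sup>+x. ennreal (\<omega> x powr (- 1 / (p - 1)) * (2 ^ k * d x) powr (- \<eta>)) * indicator (E k) (z, x) \<partial>M) \<le> ennreal a) \<and>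
      (\<integral>\<^sup>+z. ennreal (\<omega> z * (2 ^ k * d z) powr (- \<eta>)) * indicator (E k) (w, z) \<partial>M) \<le> ennreal b \<and>
      (4 ^ k) powr p * b * a powr (p - 1) \<le> C"
    and G: "\<And>z. z \<in> space M \<Longrightarrow>
      ennreal (G z) \<le> (\<Sum>k. ennreal (4 ^ k) * (\<integral>\<^sup>+w. ennreal (F w) * indicator (E k) (z, w) \<partial>M))"
  shows "(\<integral>\<^sup>+z. ennreal (G z powr p * \<omega> z) \<partial>M)
    \<le> ennreal ((1 / (1 - 2 powr (- \<eta> / (p - 1)))) powr (p - 1) * C * (1 / (1 - 2 powr (- \<eta> * (p - 1)))))
      * (\<integral>\<^sup>+z. ennreal (F z powr p * \<omega> z) \<partial>M)"
proof -
  interpret sigma_finite_measure M by fact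
  interpret pair_sigma_finite M M ..
  define I where "I = (\<integral>\<^sup>+z. ennreal (F z powr p * \<omega> z) \<partial>M)"
  define t where "t k z = 2 ^ k * d z" for k z
  have t[measurable]: "t k \<in> borel_measurable M" for k
    unfolding t_def by measurable
  have tpos: "t k z > 0" for k z
    by (simp add: t_def pos)
  define q where "q = p / (p - 1)"
  have q: "q > 1" "1/p + 1/q = 1" using p by (auto simp: q_def field_simps)
  \<comment> \<open>\<open>X\<close> and \<open>W\<close> are the two integrals of the first Hoelder
    inequality, with \<open>F\<close> split as
    \<open>F * \<omega> powr (1/p) * t powr (\<eta> * (p - 1) / p)\<close> times the reciprocal of
    the weights. The positive power of \<open>t\<close> attached to \<open>F\<close> will later sum
    over the scales.\<close>
  define X where "X k z = (\<integral>\<^sup>+w. ennreal (F w powr p * \<omega> w * t k w powr (\<eta> * (p - 1))) * indicator (E k) (z, w) \<partial>M)" for k z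
  define W where "W k z = (\<integral>\<^sup>+x. ennreal (\<omega> x powr (- 1 / (p - 1)) * t k x powr (- \<eta>)) * indicator (E k) (z, x) \<partial>M)" for k z
  have Xm[measurable]: "X k \<in> borel_measurable M" for k
    unfolding X_def by measurable
  have Wm[measurable]: "W k \<in> borel_measurable M" for k
    unfolding W_def by measurable
  define K1 where "K1 = 1 / (1 - 2 powr (- \<eta> / (p - 1)))"
  define K2 where "K2 = 1 / (1 - 2 powr (- \<eta> * (p - 1)))"
  have K1: "K1 > 0" using p \<eta> by (auto simp: K1_def powr_less_one divide_neg_pos)
  have K2: "K2 > 0" using p \<eta> by (auto simp: K2_def powr_less_one mult_neg_pos)
  show ?thesis
  proof (cases "I = \<infinity>")
    case True
    have "ennreal (K1 powr (p - 1) * C * K2) * I = \<infinity>"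
      unfolding True using K1 K2 C by (simp add: ennreal_mult_top)
    then show ?thesis
      unfolding I_def K1_def K2_def by simp
  next
    case False
    have XI: "X k z \<le> I" for k z
      unfolding X_def I_def
    proof (rule nn_integral_mono)
      fix w
      have "F w powr p * \<omega> w * t k w powr (\<eta> * (p - 1)) \<le> F w powr p * \<omega> w" if "(z, w) \<in> E k"
      proof -
        have "t k w \<le> 1" using small[OF sym[OF that]] by (simp add: t_def)
        then have "t k w powr (\<eta> * (p - 1)) \<le> 1"
          using tpos[of k w] \<eta> p by (intro powr_le1) auto
        then show ?thesis
          using pos(2)[of w] by (intro mult_left_le) auto
      qed
      then show "ennreal (F w powr p * \<omega> w * t k w powr (\<eta> * (p - 1))) * indicator (E k) (z, w) \<le> ennreal (F w powr p * \<omega> w)"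
        by (auto simp: indicator_def ennreal_leI)
    qed
    have Xfin: "X k z \<noteq> \<infinity>" for k z
      using XI[of k z] False by (auto simp: top_unique)
    have zero: "X k z = 0" "W k z = 0" if "\<not> t k z \<le> 1" for k z
    proof -
      have "(z, w) \<notin> E k" for w using small that by (auto simp: t_def)
      then show "X k z = 0" "W k z = 0" by (auto simp: X_def W_def)
    qed
    \<comment> \<open>\<open>cond\<close> controls \<open>W k z\<close> only when \<open>z\<close>
      has a neighbour at scale \<open>k\<close>; without one the section of \<open>E k\<close> at
      \<open>z\<close> is empty and the integral vanishes.\<close>
    have Wfin: "W k z \<noteq> \<infinity>" if "z \<in> space M" for k z
    proof (cases "\<exists>w\<in>space M. (z, w) \<in> E k")
      case True
      then obtain w where w: "w \<in> space M" "(w, z) \<in> E k" using sym by blast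
      then obtain a where "W k z \<le> ennreal a"
        using cond[OF w(1), of k] unfolding W_def t_def by blast
      then show ?thesis by (auto simp: top_unique)
    next
      case False
      then have "W k z = (\<integral>\<^sup>+x. 0 \<partial>M)"
        unfolding W_def by (intro nn_integral_cong) (auto simp: indicator_def)
      then show ?thesis by simp
    qed
    define x where "x k z = enn2real (X k z)" for k z
    define y where "y k z = enn2real (W k z)" for k z
    have Xx: "X k z = ennreal (x k z)" for k z
      using Xfin[of k z] by (simp add: x_def less_top)
    have Wy: "W k z = ennreal (y k z)" if "z \<in> space M" for k z
      using Wfin[OF that, of k] by (simp add: y_def less_top)
    have xy0: "x k z \<ge> 0" "y k z \<ge> 0" for k z by (auto simp: x_def y_def)
    have ym[measurable]: "y k \<in> borel_measurable M" for k
      unfolding y_def by measurable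
    have inner: "(\<integral>\<^sup>+w. ennreal (F w) * indicator (E k) (z, w) \<partial>M) \<le> ennreal (x k z powr (1/p) * y k z powr (1/q))"
      if z: "z \<in> space M" for k z
    proof -
      let ?i = "\<lambda>w. indicator (E k) (z, w) :: real"
      have [measurable]: "?i \<in> borel_measurable M"
        using z by measurable
      let ?f = "\<lambda>w. F w * \<omega> w powr (1/p) * t k w powr (\<eta> * (p - 1) / p) * ?i w"
      let ?g = "\<lambda>w. \<omega> w powr (- 1/p) * t k w powr (- \<eta> * (p - 1) / p) * ?i w"
      have "(\<integral>\<^sup>+w. ennreal (?f w * ?g w) \<partial>M) \<le> ennreal (x k z powr (1/p) * y k z powr (1/q))"
      proof (rule nn_integral_Holder)
        have "?f w powr p = F w powr p * \<omega> w * t k w powr (\<eta> * (p - 1)) * ?i w" for w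
          using p pos(2)[of w] tpos[of k w] pos(3)[of w] by (simp add: powr_mult powr_powr indicator_def)
        then show "(\<integral>\<^sup>+w. ennreal (?f w powr p) \<partial>M) \<le> ennreal (x k z)"
          unfolding Xx[symmetric] X_def
          by (intro nn_integral_mono) (auto simp: indicator_def)
        have e: "- (\<eta> * (p - 1)) / p * q = - \<eta>" "- 1 / p * q = - 1 / (p - 1)"
          using p by (auto simp: q_def field_simps)
        have "?g w powr q = \<omega> w powr (- 1 / (p - 1)) * t k w powr (- \<eta>) * ?i w" for w
          using q pos(2)[of w] tpos[of k w] e by (simp add: powr_mult powr_powr indicator_def)
        then show "(\<integral>\<^sup>+w. ennreal (?g w powr q) \<partial>M) \<le> ennreal (y k z)"
          unfolding Wy[OF z, symmetric] W_def
          by (intro nn_integral_mono) (auto simp: indicator_def)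
        show "?f \<in> borel_measurable M" "?g \<in> borel_measurable M" by measurable
      qed (use p q pos xy0 in auto)
      moreover have fg: "?f w * ?g w = F w * ?i w" for w
      proof -
        have "\<omega> w powr (1/p) * \<omega> w powr (- 1/p) = 1" "t k w powr (\<eta> * (p - 1) / p) * t k w powr (- \<eta> * (p - 1) / p) = 1"
          using pos(2)[of w] tpos[of k w] by (simp_all add: powr_add[symmetric])
        then have "F w * (\<omega> w powr (1/p) * \<omega> w powr (- 1/p)) * (t k w powr (\<eta> * (p - 1) / p) * t k w powr (- \<eta> * (p - 1) / p)) * ?i w * ?i w = F w * ?i w"
          by (simp add: indicator_def)
        then show ?thesis by (simp only: mult_ac)
      qed
      moreover have "ennreal (F w) * indicator (E k) (z, w) = ennreal (F w * ?i w)" for w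
        by (simp add: indicator_def)
      ultimately show ?thesis
        by (simp only: fg)
    qed
    \<comment> \<open>The second Hoelder inequality, now over the scales. Only the finitely many
      \<open>k\<close> with \<open>2 ^ k * d z \<le> 1\<close> contribute, and on them the powers of
      \<open>t k z\<close> form a geometric sum.\<close>
    have step: "ennreal (G z powr p) \<le> ennreal (K1 powr (p - 1)) *
        (\<Sum>k. ennreal ((4 ^ k) powr p * y k z powr (p - 1) * t k z powr (- \<eta>)) * X k z)" if z: "z \<in> space M" for z
    proof -
      let ?S = "{k. 2 ^ k * d z \<le> 1}"
      have fin: "finite ?S" using finite_dyadic_small pos by blast
      define c where "c k = 4 ^ k * (x k z powr (1/p) * y k z powr (1/q))" for k
      have c0: "c k \<ge> 0" for k by (simp add: c_def)
      have cz: "c k = 0" if "k \<notin> ?S" for k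
        using zero[of k z] that by (simp add: c_def x_def t_def)
      have "ennreal (G z) \<le> (\<Sum>k. ennreal (c k))"
      proof (rule order_trans[OF G[OF z]], rule suminf_le)
        fix k
        have "ennreal (4 ^ k) * (\<integral>\<^sup>+w. ennreal (F w) * indicator (E k) (z, w) \<partial>M)
            \<le> ennreal (4 ^ k) * ennreal (x k z powr (1/p) * y k z powr (1/q))"
          by (rule mult_left_mono[OF inner[OF z]]) simp
        also have "\<dots> = ennreal (c k)"
          unfolding c_def by (rule ennreal_mult[symmetric]) auto
        finally show "ennreal (4 ^ k) * (\<integral>\<^sup>+w. ennreal (F w) * indicator (E k) (z, w) \<partial>M) \<le> ennreal (c k)" .
      qed auto
      also have "\<dots> = (\<Sum>k\<in>?S. ennreal (c k))"
        using fin cz by (intro suminf_finite) auto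
      also have "\<dots> = ennreal (\<Sum>k\<in>?S. c k)"
        using c0 by (simp add: sum_ennreal)
      finally have "G z \<le> (\<Sum>k\<in>?S. c k)"
        using c0 by (simp add: sum_nonneg)
      then have "G z powr p \<le> (\<Sum>k\<in>?S. c k) powr p"
        using p pos by (intro powr_mono2) auto
      also have "\<dots> \<le> K1 powr (p - 1) * (\<Sum>k\<in>?S. c k powr p * t k z powr (- \<eta>))"
      proof (rule powr_sum_le[OF p fin c0 _ \<eta>])
        have "(\<Sum>k\<in>?S. (2 ^ k * d z) powr (\<eta> / (p - 1))) \<le> 1 / (1 - 2 powr (- (\<eta> / (p - 1))))"
          by (rule dyadic_geometric_sum) (use pos p \<eta> fin in auto)
        then show "(\<Sum>k\<in>?S. t k z powr (\<eta> / (p - 1))) \<le> K1"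
          by (simp add: t_def K1_def)
      qed (rule tpos)
      finally have "ennreal (G z powr p) \<le> ennreal (K1 powr (p - 1) * (\<Sum>k\<in>?S. c k powr p * t k z powr (- \<eta>)))"
        by (rule ennreal_leI)
      also have "\<dots> = ennreal (K1 powr (p - 1)) * (\<Sum>k\<in>?S. ennreal (c k powr p * t k z powr (- \<eta>)))"
      proof -
        have "(\<Sum>k\<in>?S. ennreal (c k powr p * t k z powr (- \<eta>))) = ennreal (\<Sum>k\<in>?S. c k powr p * t k z powr (- \<eta>))"
          by (rule sum_ennreal) simp
        then show ?thesis
          by (simp only: ennreal_mult'[OF powr_ge_zero])
      qed
      also have "\<dots> \<le> ennreal (K1 powr (p - 1)) * (\<Sum>k. ennreal (c k powr p * t k z powr (- \<eta>)))"
        using fin by (intro mult_left_mono sum_le_suminf) auto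
      also have "(\<lambda>k. ennreal (c k powr p * t k z powr (- \<eta>))) =
        (\<lambda>k. ennreal ((4 ^ k) powr p * y k z powr (p - 1) * t k z powr (- \<eta>)) * X k z)"
      proof
        fix k
        have "1 / q * p = p - 1" using p by (simp add: q_def)
        then have "c k powr p = (4 ^ k) powr p * x k z * y k z powr (p - 1)"
          using p xy0[where k=k and z=z] unfolding c_def by (simp add: powr_mult powr_powr)
        then show "ennreal (c k powr p * t k z powr (- \<eta>)) =
            ennreal ((4 ^ k) powr p * y k z powr (p - 1) * t k z powr (- \<eta>)) * X k z"
          using xy0[where k=k and z=z] by (simp add: Xx ennreal_mult'[symmetric] ennreal_mult''[symmetric] mult_ac)
      qed
      finally show ?thesis .
    qed
    define A where "A k z = ennreal ((4 ^ k) powr p * y k z powr (p - 1) * t k z powr (- \<eta>) * \<omega> z)" for k z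
    define B where "B k w = ennreal (F w powr p * \<omega> w * t k w powr (\<eta> * (p - 1)))" for k w
    have Am[measurable]: "A k \<in> borel_measurable M" for k unfolding A_def by measurable
    have Bm[measurable]: "B k \<in> borel_measurable M" for k unfolding B_def by measurable
    \<comment> \<open>Here it matters that in \<open>cond\<close> the bound \<open>a\<close> is
      chosen for \<open>w\<close> and serves all its neighbours \<open>z\<close>:
      \<open>y k z\<close> can be replaced by \<open>a\<close>, and what remains is the integral
      bounded by \<open>b\<close>.\<close>
    have Abound: "(\<integral>\<^sup>+z. A k z * indicator (E k) (z, w) \<partial>M) \<le> ennreal C * indicator {w. t k w \<le> 1} w" if w: "w \<in> space M" for k w
    proof -
      obtain a b where ab: "0 \<le> a" "0 \<le> b" "\<And>z. (w, z) \<in> E k \<Longrightarrow> W k z \<le> ennreal a"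
        "(\<integral>\<^sup>+z. ennreal (\<omega> z * t k z powr (- \<eta>)) * indicator (E k) (w, z) \<partial>M) \<le> ennreal b"
        "(4 ^ k) powr p * b * a powr (p - 1) \<le> C"
        using cond[OF w, of k] unfolding W_def t_def by blast
      show ?thesis
      proof (cases "t k w \<le> 1")
        case True
        have "(\<integral>\<^sup>+z. A k z * indicator (E k) (z, w) \<partial>M) \<le>
           (\<integral>\<^sup>+z. ennreal ((4 ^ k) powr p * a powr (p - 1)) * (ennreal (\<omega> z * t k z powr (- \<eta>)) * indicator (E k) (w, z)) \<partial>M)"
        proof (rule nn_integral_mono)
          fix z assume z: "z \<in> space M"
          show "A k z * indicator (E k) (z, w) \<le> ennreal ((4 ^ k) powr p * a powr (p - 1)) * (ennreal (\<omega> z * t k z powr (- \<eta>)) * indicator (E k) (w, z))"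
          proof (cases "(z, w) \<in> E k")
            case True
            then have wz: "(w, z) \<in> E k" by (rule sym)
            have "y k z \<le> a"
              using ab(3)[OF wz] Wy[OF z, of k] ab(1) by simp
            then have "y k z powr (p - 1) \<le> a powr (p - 1)"
              using p xy0 by (intro powr_mono2) auto
            then have "(4 ^ k) powr p * y k z powr (p - 1) * t k z powr (- \<eta>) * \<omega> z
              \<le> (4 ^ k) powr p * a powr (p - 1) * t k z powr (- \<eta>) * \<omega> z"
              using pos(2)[of z] by (intro mult_right_mono mult_left_mono) auto
            then show ?thesis
              using True wz pos(2)[of z] by (simp add: A_def ennreal_mult'[symmetric] ennreal_leI mult_ac)
          qed simp
        qed
        also have "\<dots> = ennreal ((4 ^ k) powr p * a powr (p - 1)) * (\<integral>\<^sup>+z. ennreal (\<omega> z * t k z powr (- \<eta>)) * indicator (E k) (w, z) \<partial>M)"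
          using w by (intro nn_integral_cmult) measurable
        also have "\<dots> \<le> ennreal ((4 ^ k) powr p * a powr (p - 1)) * ennreal b"
          by (intro mult_left_mono ab) auto
        also have "\<dots> \<le> ennreal C"
          using ab(5) ab(2) by (simp add: ennreal_mult''[symmetric] mult_ac ennreal_leI)
        finally show ?thesis using True by simp
      next
        case False
        have "(z, w) \<notin> E k" for z using small[OF sym] False unfolding t_def by blast
        then show ?thesis by simp
      qed
    qed
    have "(\<integral>\<^sup>+z. ennreal (G z powr p * \<omega> z) \<partial>M) \<le> (\<integral>\<^sup>+z. ennreal (K1 powr (p - 1)) * (\<Sum>k. A k z * X k z) \<partial>M)"
    proof (rule nn_integral_mono)
      fix z assume z: "z \<in> space M"
      have "ennreal (G z powr p * \<omega> z) = ennreal (\<omega> z) * ennreal (G z powr p)"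
        using pos(2)[of z] by (simp add: ennreal_mult'[symmetric] mult.commute)
      also have "\<dots> \<le> ennreal (\<omega> z) * (ennreal (K1 powr (p - 1)) *
        (\<Sum>k. ennreal ((4 ^ k) powr p * y k z powr (p - 1) * t k z powr (- \<eta>)) * X k z))"
        by (intro mult_left_mono step z) simp
      also have "\<dots> = ennreal (K1 powr (p - 1)) * (\<Sum>k. ennreal (\<omega> z) * (ennreal ((4 ^ k) powr p * y k z powr (p - 1) * t k z powr (- \<eta>)) * X k z))"
        by (simp add: ennreal_suminf_cmult mult_ac)
      also have "(\<lambda>k. ennreal (\<omega> z) * (ennreal ((4 ^ k) powr p * y k z powr (p - 1) * t k z powr (- \<eta>)) * X k z)) = (\<lambda>k. A k z * X k z)"
        using pos(2)[of z] by (auto simp: A_def ennreal_mult' ennreal_mult'' mult_ac)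
      finally show "ennreal (G z powr p * \<omega> z) \<le> ennreal (K1 powr (p - 1)) * (\<Sum>k. A k z * X k z)" .
    qed
    also have "\<dots> = ennreal (K1 powr (p - 1)) * (\<Sum>k. \<integral>\<^sup>+z. A k z * X k z \<partial>M)"
      by (simp add: nn_integral_cmult nn_integral_suminf)
    also have "\<dots> \<le> ennreal (K1 powr (p - 1)) * (\<Sum>k. \<integral>\<^sup>+w. ennreal C * (B k w * indicator {w. t k w \<le> 1} w) \<partial>M)"
    proof (intro mult_left_mono suminf_le)
      \<comment> \<open>Fubini moves the integration over \<open>z\<close> inside, next to the
        factor that the condition at \<open>w\<close> controls.\<close>
      fix k
      have "(\<integral>\<^sup>+z. A k z * X k z \<partial>M) = (\<integral>\<^sup>+z. \<integral>\<^sup>+w. A k z * (B k w * indicator (E k) (z, w)) \<partial>M \<partial>M)"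
        unfolding X_def B_def by (intro nn_integral_cong nn_integral_cmult[symmetric]) measurable
      also have "\<dots> = (\<integral>\<^sup>+w. \<integral>\<^sup>+z. A k z * (B k w * indicator (E k) (z, w)) \<partial>M \<partial>M)"
        by (rule Fubini') measurable
      also have "\<dots> = (\<integral>\<^sup>+w. B k w * (\<integral>\<^sup>+z. A k z * indicator (E k) (z, w) \<partial>M) \<partial>M)"
        by (intro nn_integral_cong, subst nn_integral_cmult[symmetric]) (auto simp: mult_ac)
      also have "\<dots> \<le> (\<integral>\<^sup>+w. B k w * (ennreal C * indicator {w. t k w \<le> 1} w) \<partial>M)"
        by (intro nn_integral_mono mult_left_mono Abound) auto
      also have "\<dots> = (\<integral>\<^sup>+w. ennreal C * (B k w * indicator {w. t k w \<le> 1} w) \<partial>M)"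
        by (simp add: mult_ac)
      finally show "(\<integral>\<^sup>+z. A k z * X k z \<partial>M) \<le> (\<integral>\<^sup>+w. ennreal C * (B k w * indicator {w. t k w \<le> 1} w) \<partial>M)" .
    qed auto
    also have "(\<Sum>k. \<integral>\<^sup>+w. ennreal C * (B k w * indicator {w. t k w \<le> 1} w) \<partial>M)
       = (\<integral>\<^sup>+w. (\<Sum>k. ennreal C * (B k w * indicator {w. t k w \<le> 1} w)) \<partial>M)"
    proof (rule nn_integral_suminf[symmetric])
      fix k
      have "(\<lambda>w. indicator {w. t k w \<le> 1} w :: ennreal) \<in> borel_measurable M"
        unfolding indicator_def by measurable
      then show "(\<lambda>w. ennreal C * (B k w * indicator {w. t k w \<le> 1} w)) \<in> borel_measurable M"
        by measurable
    qed
    also have "\<dots> \<le> (\<integral>\<^sup>+w. ennreal (C * K2) * ennreal (F w powr p * \<omega> w) \<partial>M)"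
    proof (rule nn_integral_mono)
      \<comment> \<open>All scales carry the same constant \<open>C\<close>; the factor
        \<open>t k w powr (\<eta> * (p - 1))\<close> saved in the first Hoelder step makes their sum
        converge.\<close>
      fix w
      have "(\<Sum>k. ennreal (t k w powr (\<eta> * (p - 1))) * indicator {w. t k w \<le> 1} w) \<le> ennreal K2"
      proof -
        let ?S = "{k. 2 ^ k * d w \<le> 1}"
        have fin: "finite ?S" using finite_dyadic_small pos by blast
        have "(\<Sum>k. ennreal (t k w powr (\<eta> * (p - 1))) * indicator {w. t k w \<le> 1} w)
            = (\<Sum>k\<in>?S. ennreal (t k w powr (\<eta> * (p - 1))) * indicator {w. t k w \<le> 1} w)"
          by (rule suminf_finite[OF fin]) (auto simp: t_def)
        also have "\<dots> = ennreal (\<Sum>k\<in>?S. (2 ^ k * d w) powr (\<eta> * (p - 1)))"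
          by (subst sum_ennreal[symmetric]) (auto simp: t_def intro!: sum.cong)
        also have "\<dots> \<le> ennreal K2"
          unfolding K2_def minus_mult_left[symmetric]
          by (intro ennreal_leI dyadic_geometric_sum) (use pos p \<eta> fin in auto)
        finally show ?thesis .
      qed
      then have le: "ennreal (C * (F w powr p * \<omega> w)) * (\<Sum>k. ennreal (t k w powr (\<eta> * (p - 1))) * indicator {w. t k w \<le> 1} w)
          \<le> ennreal (C * (F w powr p * \<omega> w)) * ennreal K2"
        by (rule mult_left_mono) simp
      have "(\<Sum>k. ennreal C * (B k w * indicator {w. t k w \<le> 1} w))
          = (\<Sum>k. ennreal (C * (F w powr p * \<omega> w)) * (ennreal (t k w powr (\<eta> * (p - 1))) * indicator {w. t k w \<le> 1} w))"
        using C pos(2)[of w] by (intro suminf_cong) (auto simp: B_def ennreal_mult' ennreal_mult'' mult_ac)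
      also have "\<dots> = ennreal (C * (F w powr p * \<omega> w)) * (\<Sum>k. ennreal (t k w powr (\<eta> * (p - 1))) * indicator {w. t k w \<le> 1} w)"
        by (rule ennreal_suminf_cmult)
      also note le
      also have "ennreal (C * (F w powr p * \<omega> w)) * ennreal K2 = ennreal (C * K2) * ennreal (F w powr p * \<omega> w)"
        using C K2 pos(2)[of w] by (simp add: ennreal_mult'[symmetric] ennreal_mult''[symmetric] mult_ac)
      finally show "(\<Sum>k. ennreal C * (B k w * indicator {w. t k w \<le> 1} w)) \<le> ennreal (C * K2) * ennreal (F w powr p * \<omega> w)" .
    qed
    also have "\<dots> = ennreal (C * K2) * I"
      unfolding I_def by (rule nn_integral_cmult) measurable
    finally have "(\<integral>\<^sup>+z. ennreal (G z powr p * \<omega> z) \<partial>M) \<le> ennreal (K1 powr (p - 1)) * (ennreal (C * K2) * I)"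
      by (simp add: mult_left_mono)
    also have "\<dots> = ennreal (K1 powr (p - 1) * C * K2) * I"
      using C K2 by (simp add: ennreal_mult'[symmetric] mult.assoc[symmetric])
    finally show ?thesis
      unfolding I_def K1_def K2_def .
  qed
qed

section \<open>Mass distribution of weights in boxes\<close>

abbreviation disc_measure :: "complex measure" where "disc_measure \<equiv> lebesgue_on unit_disc"

abbreviation disc_mass :: "(complex \<Rightarrow> real) \<Rightarrow> complex set \<Rightarrow> ennreal" where
  "disc_mass v S \<equiv> \<integral>\<^sup>+z\<in>S. ennreal (v z) \<partial>disc_measure"

lemma Qbox_disc [measurable]: "Qbox \<theta> l \<in> sets disc_measure"
  using Qbox_subset_disc by (auto simp: sets_restrict_space_iff)

lemma strip_disc [measurable]: "strip \<theta> l m \<in> sets disc_measure"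
  using Qbox_subset_disc strip_subset by (force simp: sets_restrict_space_iff)

lemma emeasure_disc_measure: "A \<subseteq> unit_disc \<Longrightarrow> emeasure disc_measure A = emeasure lebesgue A"
  by (rule emeasure_restrict_space) auto

lemma AE_not_in_halves:
  assumes "0 < l" "l \<le> 1"
  shows "AE z in disc_measure. \<not> (z \<in> Qbox (\<theta> - l/4) (l/2) \<and> z \<in> Qbox (\<theta> + l/4) (l/2))"
proof -
  let ?N = "Qbox (\<theta> - l/4) (l/2) \<inter> Qbox (\<theta> + l/4) (l/2)"
  have "emeasure disc_measure ?N = 0"
    using Qbox_halves_negligible[OF assms, of \<theta>] Qbox_subset_disc by (subst emeasure_disc_measure) auto
  then have "?N \<in> null_sets disc_measure"
    by (auto simp: null_sets_def)
  from AE_not_in[OF this] show ?thesis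
    by eventually_elim auto
qed

text \<open>The strip of level \<open>m + 1\<close> is the union of the level \<open>m\<close>
  strips of the two children. These children tile the bottom half up to a null set, so one more
  factor \<kappa> comes from \<open>top\<close> applied to the parent.\<close>

lemma strip_mass_decay:
  fixes v :: "complex \<Rightarrow> real"
  assumes [measurable]: "v \<in> borel_measurable disc_measure"
    and top: "\<And>\<theta> l. 0 < l \<Longrightarrow> l \<le> 1 \<Longrightarrow>
      disc_mass v (strip \<theta> l 1) \<le> ennreal \<kappa> * disc_mass v (Qbox \<theta> l)"
    and \<kappa>: "\<kappa> \<ge> 0" and l: "0 < l" "l \<le> 1"
  shows "disc_mass v (strip \<theta> l m) \<le> ennreal (\<kappa> ^ m) * disc_mass v (Qbox \<theta> l)"
  using l
proof (induction m arbitrary: \<theta> l)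
  case 0
  then show ?case by (simp add: strip_0)
next
  case (Suc m)
  let ?J = "disc_mass v"
  let ?a = "\<theta> - l/4" and ?b = "\<theta> + l/4"
  have l2: "0 < l/2" "l/2 \<le> 1" using Suc.prems by auto
  have "?J (strip \<theta> l (Suc m)) \<le> (\<integral>\<^sup>+z. ennreal (v z) * indicator (strip ?a (l/2) m) z + ennreal (v z) * indicator (strip ?b (l/2) m) z \<partial>disc_measure)"
    unfolding strip_Suc[OF Suc.prems(1)] by (intro nn_integral_mono) (auto simp: indicator_def)
  also have "\<dots> = ?J (strip ?a (l/2) m) + ?J (strip ?b (l/2) m)"
    by (rule nn_integral_add) measurable
  also have "\<dots> \<le> ennreal (\<kappa> ^ m) * ?J (Qbox ?a (l/2)) + ennreal (\<kappa> ^ m) * ?J (Qbox ?b (l/2))"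
    by (intro add_mono Suc.IH l2)
  also have "\<dots> = ennreal (\<kappa> ^ m) * (\<integral>\<^sup>+z. ennreal (v z) * indicator (Qbox ?a (l/2)) z + ennreal (v z) * indicator (Qbox ?b (l/2)) z \<partial>disc_measure)"
    by (subst nn_integral_add) (auto simp: distrib_left)
  also have "(\<integral>\<^sup>+z. ennreal (v z) * indicator (Qbox ?a (l/2)) z + ennreal (v z) * indicator (Qbox ?b (l/2)) z \<partial>disc_measure)
     = ?J (strip \<theta> l 1)"
  proof (rule nn_integral_cong_AE)
    have s: "strip \<theta> l 1 = Qbox ?a (l/2) \<union> Qbox ?b (l/2)"
      using strip_Suc[OF Suc.prems(1), of \<theta> 0] by (simp add: strip_0)
    show "AE z in disc_measure. ennreal (v z) * indicator (Qbox ?a (l/2)) z + ennreal (v z) * indicator (Qbox ?b (l/2)) z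
      = ennreal (v z) * indicator (strip \<theta> l 1) z"
      using AE_not_in_halves[OF Suc.prems, of \<theta>] unfolding s
      by eventually_elim (auto simp: indicator_def)
  qed
  also have "ennreal (\<kappa> ^ m) * ?J (strip \<theta> l 1) \<le> ennreal (\<kappa> ^ m) * (ennreal \<kappa> * ?J (Qbox \<theta> l))"
    by (intro mult_left_mono top Suc.prems) auto
  also have "\<dots> = ennreal (\<kappa> ^ Suc m) * ?J (Qbox \<theta> l)"
    using \<kappa> by (simp add: ennreal_mult'' mult_ac)
  finally show ?case .
qed

text \<open>At relative depth t in the last strip of level \<open>m\<close> the weight
  \<open>t powr (- a)\<close> is at most \<open>(2 powr a) ^ Suc m\<close>. Summing over levels
  gives a geometric series of ratio \<open>2 powr a * \<kappa>\<close>.\<close>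

lemma strip_decay_imp_weighted_mass:
  fixes v :: "complex \<Rightarrow> real"
  assumes [measurable]: "v \<in> borel_measurable disc_measure" and v: "\<And>z. v z \<ge> 0"
    and decay: "\<And>m. disc_mass v (strip \<theta> l m) \<le> ennreal (\<kappa> ^ m) * disc_mass v (Qbox \<theta> l)"
    and \<kappa>: "\<kappa> \<ge> 0" and l: "0 < l" and a: "a \<ge> 0" "2 powr a * \<kappa> < 1"
  shows "(\<integral>\<^sup>+z\<in>Qbox \<theta> l. ennreal (v z * ((1 - cmod z) / l) powr (- a)) \<partial>disc_measure)
    \<le> ennreal (2 powr a / (1 - 2 powr a * \<kappa>)) * disc_mass v (Qbox \<theta> l)"
proof -
  let ?J = "disc_mass v"
  have pt: "ennreal (v z * ((1 - cmod z) / l) powr (- a)) * indicator (Qbox \<theta> l) z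
    \<le> (\<Sum>m. ennreal ((2 powr a) ^ Suc m) * (ennreal (v z) * indicator (strip \<theta> l m) z))" for z
  proof (cases "z \<in> Qbox \<theta> l")
    case True
    define t where "t = (1 - cmod z) / l"
    have t: "0 < t" "t \<le> 1" using True l by (auto simp: t_def Qbox_iff)
    define S where "S = {m. 2 ^ m * t \<le> 1}"
    have S: "finite S" "0 \<in> S" using t finite_dyadic_small by (auto simp: S_def)
    \<comment> \<open>The deepest strip that contains \<open>z\<close>; failure of the next level
      gives the lower bound for \<open>t\<close>.\<close>
    define m where "m = Max S"
    have "m \<in> S" using S by (auto simp: m_def intro: Max_in)
    then have m1: "2 ^ m * t \<le> 1" by (simp add: S_def)
    have "Suc m \<notin> S" using S by (metis Max_ge Suc_n_not_le_n m_def)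
    then have m2: "2 ^ Suc m * t > 1" by (simp add: S_def)
    have "z \<in> strip \<theta> l m"
      using True m1 l by (simp add: strip_def t_def field_simps)
    have "t powr (- a) \<le> (2 powr a) ^ Suc m"
    proof -
      have "1 \<le> (2 ^ Suc m * t) powr a"
        using m2 a by (intro ge_one_powr_ge_zero) auto
      also have "\<dots> = (2 powr a) ^ Suc m * t powr a"
        using t by (simp add: powr_mult powr_power powr_realpow[symmetric] powr_powr mult.commute del: power_Suc)
      finally show ?thesis
        using t by (simp add: powr_minus field_simps)
    qed
    then have "v z * t powr (- a) \<le> (2 powr a) ^ Suc m * v z"
      using v[of z] by (simp add: mult_left_mono mult.commute)
    then have "ennreal (v z * t powr (- a)) \<le> ennreal ((2 powr a) ^ Suc m) * (ennreal (v z) * indicator (strip \<theta> l m) z)"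
      using \<open>z \<in> strip \<theta> l m\<close> v[of z] by (simp add: ennreal_mult'[symmetric] ennreal_leI del: power_Suc)
    also have "\<dots> \<le> (\<Sum>m. ennreal ((2 powr a) ^ Suc m) * (ennreal (v z) * indicator (strip \<theta> l m) z))"
      using sum_le_suminf[of "\<lambda>m. ennreal ((2 powr a) ^ Suc m) * (ennreal (v z) * indicator (strip \<theta> l m) z)" "{m}"] by simp
    finally show ?thesis using True by (simp add: t_def)
  qed simp
  have "(\<integral>\<^sup>+z\<in>Qbox \<theta> l. ennreal (v z * ((1 - cmod z) / l) powr (- a)) \<partial>disc_measure)
    \<le> (\<integral>\<^sup>+z. (\<Sum>m. ennreal ((2 powr a) ^ Suc m) * (ennreal (v z) * indicator (strip \<theta> l m) z)) \<partial>disc_measure)"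
    by (intro nn_integral_mono pt)
  also have "\<dots> = (\<Sum>m. ennreal ((2 powr a) ^ Suc m) * ?J (strip \<theta> l m))"
    by (simp add: nn_integral_suminf nn_integral_cmult del: power_Suc)
  also have "\<dots> \<le> (\<Sum>m. ennreal (2 powr a * (2 powr a * \<kappa>) ^ m) * ?J (Qbox \<theta> l))"
  proof (rule suminf_le)
    fix m
    have "ennreal ((2 powr a) ^ Suc m) * ?J (strip \<theta> l m) \<le> ennreal ((2 powr a) ^ Suc m) * (ennreal (\<kappa> ^ m) * ?J (Qbox \<theta> l))"
      by (intro mult_left_mono decay) auto
    also have "\<dots> = ennreal (2 powr a * (2 powr a * \<kappa>) ^ m) * ?J (Qbox \<theta> l)"
      using \<kappa> by (simp add: ennreal_mult'[symmetric] mult.assoc[symmetric] power_mult_distrib)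
    finally show "ennreal ((2 powr a) ^ Suc m) * ?J (strip \<theta> l m) \<le> ennreal (2 powr a * (2 powr a * \<kappa>) ^ m) * ?J (Qbox \<theta> l)" .
  qed auto
  also have "\<dots> = (\<Sum>m. ennreal (2 powr a * (2 powr a * \<kappa>) ^ m)) * ?J (Qbox \<theta> l)"
    by (rule ennreal_suminf_multc)
  also have "(\<Sum>m. ennreal (2 powr a * (2 powr a * \<kappa>) ^ m)) = ennreal (2 powr a / (1 - 2 powr a * \<kappa>))"
  proof (rule suminf_ennreal_eq)
    have "(\<lambda>m. (2 powr a * \<kappa>) ^ m) sums (1 / (1 - 2 powr a * \<kappa>))"
      using \<kappa> a by (intro geometric_sums) auto
    from sums_mult[OF this, of "2 powr a"]
    show "(\<lambda>m. 2 powr a * (2 powr a * \<kappa>) ^ m) sums (2 powr a / (1 - 2 powr a * \<kappa>))" by simp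
  qed (use \<kappa> in auto)
  finally show ?thesis .
qed

text \<open>Hoelder on \<open>S\<close> bounds the p-th power of its m-mass by its v-mass times the
  dual mass of all of \<open>Q\<close> to the power \<open>p - 1\<close>, and the A_p inequality
  bounds this dual mass. This is the classical fact that an A_p weight gives a fixed share of its
  mass to every subset of fixed proportion.\<close>

lemma Ap_subset_mass:
  fixes m v v' :: "complex \<Rightarrow> real"
  assumes [measurable]: "v \<in> borel_measurable M" "v' \<in> borel_measurable M" "S \<in> sets M"
    and "S \<subseteq> Q" and p: "p > 1" and q: "q = p / (p - 1)"
    and nn: "\<And>z. v z \<ge> 0" "\<And>z. v' z \<ge> 0"
    and m: "\<And>z. z \<in> space M \<Longrightarrow> m z = v z powr (1/p) * v' z powr (1/q)"
    and V: "(\<integral>\<^sup>+z\<in>Q. ennreal (v z) \<partial>M) = ennreal V" "V \<ge> 0"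
    and V': "(\<integral>\<^sup>+z\<in>Q. ennreal (v' z) \<partial>M) = ennreal V'" "V' \<ge> 0"
    and Ap: "V * V' powr (p - 1) \<le> C * I powr p" and C: "C > 0" and I: "I > 0"
    and c: "c \<ge> 0" "ennreal (c * I) \<le> (\<integral>\<^sup>+z\<in>S. ennreal (m z) \<partial>M)"
  shows "ennreal (c powr p / C * V) \<le> (\<integral>\<^sup>+z\<in>S. ennreal (v z) \<partial>M)"
proof -
  have q1: "q > 1" "1/p + 1/q = 1" using p by (auto simp: q field_simps)
  have le: "(\<integral>\<^sup>+z\<in>S. ennreal (v z) \<partial>M) \<le> ennreal V" "(\<integral>\<^sup>+z\<in>S. ennreal (v' z) \<partial>M) \<le> ennreal V'"
    unfolding V(1)[symmetric] V'(1)[symmetric] using \<open>S \<subseteq> Q\<close>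
    by (auto intro!: nn_integral_mono simp: indicator_def)
  define U where "U = enn2real (\<integral>\<^sup>+z\<in>S. ennreal (v z) \<partial>M)"
  have U: "(\<integral>\<^sup>+z\<in>S. ennreal (v z) \<partial>M) = ennreal U" "U \<ge> 0"
    using le_less_trans[OF le(1) ennreal_less_top] by (auto simp: U_def)
  have "(\<integral>\<^sup>+z\<in>S. ennreal (m z) \<partial>M) = (\<integral>\<^sup>+z. ennreal ((v z powr (1/p) * indicator S z) * (v' z powr (1/q) * indicator S z)) \<partial>M)"
    by (intro nn_integral_cong) (auto simp: m indicator_def)
  also have "\<dots> \<le> ennreal (U powr (1/p) * V' powr (1/q))"
  proof (rule nn_integral_Holder[OF p q1])
    have "(\<integral>\<^sup>+z. ennreal ((v z powr (1/p) * indicator S z) powr p) \<partial>M) = (\<integral>\<^sup>+z\<in>S. ennreal (v z) \<partial>M)"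
      using p nn by (intro nn_integral_cong) (auto simp: indicator_def powr_powr)
    then show "(\<integral>\<^sup>+z. ennreal ((v z powr (1/p) * indicator S z) powr p) \<partial>M) \<le> ennreal U"
      using U by simp
    have "(\<integral>\<^sup>+z. ennreal ((v' z powr (1/q) * indicator S z) powr q) \<partial>M) = (\<integral>\<^sup>+z\<in>S. ennreal (v' z) \<partial>M)"
      using q1 nn by (intro nn_integral_cong) (auto simp: indicator_def powr_powr)
    then show "(\<integral>\<^sup>+z. ennreal ((v' z powr (1/q) * indicator S z) powr q) \<partial>M) \<le> ennreal V'"
      using le by simp
  qed (use U V' in auto)
  finally have "c * I \<le> U powr (1/p) * V' powr (1/q)"
    using c(2) by (metis ennreal_le_iff mult_nonneg_nonneg order_trans powr_ge_zero)
  then have "(c * I) powr p \<le> (U powr (1/p) * V' powr (1/q)) powr p"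
    using c I p by (intro powr_mono2) auto
  also have "\<dots> = U * V' powr (p - 1)"
    using p U by (simp add: powr_mult powr_powr q)
  finally have "c powr p * I powr p \<le> U * V' powr (p - 1)"
    using c I by (simp add: powr_mult)
  then have "c powr p * I powr p * V \<le> U * V' powr (p - 1) * V"
    using V(2) by (rule mult_right_mono)
  also have "\<dots> = U * (V * V' powr (p - 1))" by simp
  also have "\<dots> \<le> U * (C * I powr p)"
    using U Ap by (intro mult_left_mono) auto
  finally have "(c powr p * V) * I powr p \<le> (U * C) * I powr p"
    by (simp add: mult_ac)
  then have "c powr p * V \<le> U * C"
    using I by (simp add: mult_le_cancel_right)
  then show ?thesis
    using C U by (simp add: field_simps ennreal_leI)
qed

section \<open>From normalised averages to masses of boxes\<close>

lemma avg_one_eq: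
  assumes S: "S \<in> sets lebesgue" "emeasure lebesgue S = ennreal s" "s > 0" and r: "r > 0"
    and [measurable]: "f \<in> borel_measurable (lebesgue_on S)"
  shows "avg r (\<lambda>_. 1) S f = (let X = (\<integral>\<^sup>+z. ennreal (\<bar>f z\<bar> powr r) \<partial>lebesgue_on S) in
     if X = \<infinity> then \<infinity> else ennreal ((enn2real X / s) powr (1/r)))"
proof -
  define X where "X = (\<integral>\<^sup>+z. ennreal (\<bar>f z\<bar> powr r) \<partial>lebesgue_on S)"
  have N: "(\<integral>\<^sup>+z\<in>S. ennreal (\<bar>f z\<bar> powr r * 1) \<partial>dA) = ennreal (1/pi) * X"
    unfolding X_def mult_1_right by (rule nn_integral_dA[OF S(1)]) measurable
  have "(\<integral>\<^sup>+z\<in>S. ennreal 1 \<partial>dA) = ennreal (1/pi) * (\<integral>\<^sup>+z. ennreal 1 \<partial>lebesgue_on S)"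
    by (rule nn_integral_dA[OF S(1)]) measurable
  also have "\<dots> = ennreal (s/pi)"
    using S by (simp add: emeasure_restrict_space space_restrict_space ennreal_mult'[symmetric])
  finally have D: "(\<integral>\<^sup>+z\<in>S. ennreal 1 \<partial>dA) = ennreal (s/pi)" .
  show ?thesis
  proof (cases "X = \<infinity>")
    case True
    then have "ennreal (1/pi) * X = \<infinity>"
      by (simp add: ennreal_mult_top)
    then show ?thesis
      unfolding avg_def N D Let_def X_def[symmetric] using True by (simp add: ennreal_top_divide)
  next
    case False
    define x where "x = enn2real X"
    have x: "X = ennreal x" "x \<ge> 0" using False by (auto simp: x_def less_top)
    have "ennreal (1/pi) * X / ennreal (s/pi) = ennreal (x / s)"
      using x S by (simp add: ennreal_mult'[symmetric] divide_ennreal)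
    then show ?thesis
      unfolding avg_def N D Let_def X_def[symmetric] using False x S by (simp add: x_def[symmetric])
  qed
qed

text \<open>Besides multiplying out the averages, this extracts finiteness from the bounded product.
  The weight is positive a.e. on a set of positive area, so neither average is 0; an infinite one
  would therefore make the product infinite.\<close>

lemma Bp_average_bound:
  assumes S: "S \<in> sets lebesgue" "emeasure lebesgue S = ennreal s" "s > 0" and p: "p > 1"
    and \<sigma>[measurable]: "\<sigma> \<in> borel_measurable (lebesgue_on S)" and pos: "AE z in lebesgue_on S. \<sigma> z > 0"
    and B: "avg 1 (\<lambda>_. 1) S \<sigma> * avg (1 / (p - 1)) (\<lambda>_. 1) S (\<lambda>z. 1 / \<sigma> z) \<le> ennreal C"
  obtains V V' where "(\<integral>\<^sup>+z. ennreal (\<sigma> z) \<partial>lebesgue_on S) = ennreal V" "V > 0"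
    "(\<integral>\<^sup>+z. ennreal (\<sigma> z powr (- 1 / (p - 1))) \<partial>lebesgue_on S) = ennreal V'" "V' > 0"
    "V * V' powr (p - 1) \<le> C * s powr p"
proof -
  define X where "X = (\<integral>\<^sup>+z. ennreal (\<sigma> z) \<partial>lebesgue_on S)"
  define Y where "Y = (\<integral>\<^sup>+z. ennreal (\<sigma> z powr (- 1 / (p - 1))) \<partial>lebesgue_on S)"
  have nz: "\<not> (AE z in lebesgue_on S. False)"
  proof
    assume "AE z in lebesgue_on S. False"
    then have "emeasure (lebesgue_on S) (space (lebesgue_on S)) = 0"
      by (subst (asm) AE_iff_measurable[OF sets.top]) auto
    then show False
      using S by (simp add: emeasure_restrict_space space_restrict_space)
  qed
  have nonzero: "(\<integral>\<^sup>+z. ennreal (h (\<sigma> z)) \<partial>lebesgue_on S) \<noteq> 0"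
    if [measurable]: "h \<in> borel_measurable borel" and h: "\<And>x. x > 0 \<Longrightarrow> h x > 0" for h :: "real \<Rightarrow> real"
  proof
    assume "(\<integral>\<^sup>+z. ennreal (h (\<sigma> z)) \<partial>lebesgue_on S) = 0"
    then have "AE z in lebesgue_on S. ennreal (h (\<sigma> z)) = 0"
      by (subst (asm) nn_integral_0_iff_AE) auto
    with pos have "AE z in lebesgue_on S. False"
      by eventually_elim (use h in \<open>force simp: ennreal_eq_0_iff\<close>)
    then show False using nz by simp
  qed
  have X0: "X \<noteq> 0" and Y0: "Y \<noteq> 0"
    using nonzero[of "\<lambda>x. x"] nonzero[of "\<lambda>x. x powr (- 1 / (p - 1))"] by (auto simp: X_def Y_def)
  have X1: "(\<integral>\<^sup>+z. ennreal (\<bar>\<sigma> z\<bar> powr 1) \<partial>lebesgue_on S) = X"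
    unfolding X_def using pos by (intro nn_integral_cong_AE) (auto elim!: eventually_mono)
  have Y1: "(\<integral>\<^sup>+z. ennreal (\<bar>1 / \<sigma> z\<bar> powr (1 / (p - 1))) \<partial>lebesgue_on S) = Y"
    unfolding Y_def using pos
    by (intro nn_integral_cong_AE) (auto elim!: eventually_mono simp: powr_divide powr_minus field_simps)
  have a1: "avg 1 (\<lambda>_. 1) S \<sigma> = (if X = \<infinity> then \<infinity> else ennreal (enn2real X / s))"
    using avg_one_eq[OF S zero_less_one \<sigma>] X1 S(3) by (simp add: Let_def)
  have a2: "avg (1 / (p - 1)) (\<lambda>_. 1) S (\<lambda>z. 1 / \<sigma> z) = (if Y = \<infinity> then \<infinity> else ennreal ((enn2real Y / s) powr (p - 1)))"
    using avg_one_eq[OF S, of "1/(p-1)" "\<lambda>z. 1 / \<sigma> z"] Y1 p by (simp add: Let_def)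
  have frac: "enn2real Z / s > 0" if "Z \<noteq> 0" "Z \<noteq> \<infinity>" for Z
    using that S(3) by (simp add: enn2real_positive_iff less_top zero_less_iff_neq_zero)
  have nz1: "avg 1 (\<lambda>_. 1) S \<sigma> \<noteq> 0"
    using frac[OF X0] by (cases "X = \<infinity>") (simp_all only: a1 ennreal_eq_0_iff not_le if_True if_False not_False_eq_True simp_thms ennreal_zero_neq_top infinity_ennreal_def ennreal_top_neq_zero)
  have nz2: "avg (1 / (p - 1)) (\<lambda>_. 1) S (\<lambda>z. 1 / \<sigma> z) \<noteq> 0"
    unfolding a2 using frac[OF Y0] by (cases "Y = \<infinity>") (auto simp: ennreal_eq_0_iff)
  have "X \<noteq> \<infinity>"
  proof
    assume "X = \<infinity>"
    then have "avg 1 (\<lambda>_. 1) S \<sigma> = \<infinity>" by (simp add: a1)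
    then show False using B nz2 by (simp add: ennreal_top_mult top_unique)
  qed
  have "Y \<noteq> \<infinity>"
  proof
    assume "Y = \<infinity>"
    then have "avg (1 / (p - 1)) (\<lambda>_. 1) S (\<lambda>z. 1 / \<sigma> z) = \<infinity>" by (simp add: a2)
    then show False using B nz1 by (simp add: ennreal_mult_top top_unique)
  qed
  define V where "V = enn2real X"
  define V' where "V' = enn2real Y"
  have V: "X = ennreal V" "V > 0"
    using \<open>X \<noteq> \<infinity>\<close> X0 by (auto simp: V_def less_top enn2real_positive_iff zero_less_iff_neq_zero)
  have V': "Y = ennreal V'" "V' > 0"
    using \<open>Y \<noteq> \<infinity>\<close> Y0 by (auto simp: V'_def less_top enn2real_positive_iff zero_less_iff_neq_zero)
  have "ennreal (V / s) * ennreal ((V' / s) powr (p - 1)) \<le> ennreal C"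
    using B \<open>X \<noteq> \<infinity>\<close> \<open>Y \<noteq> \<infinity>\<close> by (simp add: a1 a2 V_def[symmetric] V'_def[symmetric])
  then have "ennreal (V / s * (V' / s) powr (p - 1)) \<le> ennreal C"
    using V V' S(3) by (subst ennreal_mult) auto
  moreover have "V / s * (V' / s) powr (p - 1) > 0"
    using V V' S(3) by simp
  moreover have "x \<le> y" if "ennreal x \<le> ennreal y" "x > 0" for x y
    using that by (auto simp: ennreal_le_iff2)
  ultimately have le: "V / s * (V' / s) powr (p - 1) \<le> C"
    by blast
  have "V * V' powr (p - 1) = (V / s * (V' / s) powr (p - 1)) * s powr p"
  proof -
    have "s powr p = s * s powr (p - 1)"
      using S(3) by (simp add: powr_diff)
    then show ?thesis
      using V V' S(3) by (simp add: powr_divide)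
  qed
  also have "\<dots> \<le> C * s powr p"
    using le by (intro mult_right_mono) auto
  finally show ?thesis
    using that[OF V[unfolded X_def] V'[unfolded Y_def]] by blast
qed

lemma nn_integral_lebesgue_on_subset:
  assumes "S \<in> sets lebesgue" "S \<subseteq> T" "T \<in> sets lebesgue"
  shows "(\<integral>\<^sup>+z. f z \<partial>lebesgue_on S) = (\<integral>\<^sup>+z\<in>S. f z \<partial>lebesgue_on T)"
  using assms by (subst (1 2) nn_integral_restrict_space) (auto intro!: nn_integral_cong simp: indicator_def)

text \<open>The proportion 1/1024 is the quotient of the lower bound \<open>pi * l^2 / 256\<close>
  for the top half and the upper bound \<open>4 * pi * l^2\<close> for the box.\<close>

lemma Qbox_size:
  assumes "0 < l" "l \<le> 1"
  obtains s where "emeasure lebesgue (Qbox \<theta> l) = ennreal s" "s > 0" "pi * l\<^sup>2 / 256 \<le> s" "s \<le> 4 * pi * l\<^sup>2"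
    "ennreal (1/1024 * s) \<le> emeasure lebesgue (Qbox \<theta> l - strip \<theta> l 1)"
proof -
  define s where "s = enn2real (emeasure lebesgue (Qbox \<theta> l))"
  have s: "emeasure lebesgue (Qbox \<theta> l) = ennreal s"
    using le_less_trans[OF emeasure_Qbox_le[OF assms] ennreal_less_top] by (simp add: s_def)
  have up: "s \<le> 4 * pi * l\<^sup>2"
    using emeasure_Qbox_le[OF assms, of \<theta>] unfolding s by (simp add: ennreal_le_iff)
  have "emeasure lebesgue (Qbox \<theta> l - strip \<theta> l 1) \<le> emeasure lebesgue (Qbox \<theta> l)"
    by (intro emeasure_mono) auto
  then have "ennreal (pi * l\<^sup>2 / 256) \<le> ennreal s"
    using emeasure_Qbox_top_ge[OF assms, of \<theta>] s by simp
  moreover have "s \<ge> 0" by (simp add: s_def)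
  ultimately have low: "pi * l\<^sup>2 / 256 \<le> s"
    by (simp add: ennreal_le_iff)
  moreover have "pi * l\<^sup>2 / 256 > 0" using assms by simp
  ultimately have "s > 0" by linarith
  have "ennreal (1/1024 * s) \<le> ennreal (pi * l\<^sup>2 / 256)"
    using up by (intro ennreal_leI) simp
  then have "ennreal (1/1024 * s) \<le> emeasure lebesgue (Qbox \<theta> l - strip \<theta> l 1)"
    using emeasure_Qbox_top_ge[OF assms, of \<theta>] by (rule order_trans)
  then show ?thesis
    using that s \<open>s > 0\<close> low up by blast
qed

lemma strip_mass_of_top:
  fixes v :: "complex \<Rightarrow> real"
  assumes [measurable]: "v \<in> borel_measurable disc_measure"
    and V: "disc_mass v (Qbox \<theta> l) = ennreal V" "V \<ge> 0"
    and c: "ennreal (c * V) \<le> disc_mass v (Qbox \<theta> l - strip \<theta> l 1)" "0 \<le> c"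
  shows "disc_mass v (strip \<theta> l 1) \<le> ennreal (1 - c) * disc_mass v (Qbox \<theta> l)"
proof -
  let ?J = "disc_mass v"
  have "?J (Qbox \<theta> l) = (\<integral>\<^sup>+z. ennreal (v z) * indicator (strip \<theta> l 1) z + ennreal (v z) * indicator (Qbox \<theta> l - strip \<theta> l 1) z \<partial>disc_measure)"
    using strip_subset[of \<theta> l 1] by (intro nn_integral_cong) (auto simp: indicator_def)
  also have "\<dots> = ?J (strip \<theta> l 1) + ?J (Qbox \<theta> l - strip \<theta> l 1)"
    by (rule nn_integral_add) measurable
  finally have sum: "?J (Qbox \<theta> l) = ?J (strip \<theta> l 1) + ?J (Qbox \<theta> l - strip \<theta> l 1)" .
  have "?J (strip \<theta> l 1) + ennreal (c * V) \<le> ?J (strip \<theta> l 1) + ?J (Qbox \<theta> l - strip \<theta> l 1)"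
    by (rule add_left_mono[OF c(1)])
  then have "?J (strip \<theta> l 1) + ennreal (c * V) \<le> ennreal V"
    unfolding sum[symmetric] V(1) .
  moreover define x where "x = enn2real (?J (strip \<theta> l 1))"
  moreover have "?J (strip \<theta> l 1) < \<infinity>"
  proof -
    have "?J (strip \<theta> l 1) \<le> ennreal V"
      unfolding V(1)[symmetric] sum by simp
    then show ?thesis
      using le_less_trans[OF _ ennreal_less_top] by simp
  qed
  ultimately have x: "?J (strip \<theta> l 1) = ennreal x" "x \<ge> 0" "ennreal x + ennreal (c * V) \<le> ennreal V"
    by auto
  then have "x + c * V \<le> V"
    using V(2) c(2) by (simp add: ennreal_plus[symmetric] ennreal_le_iff del: ennreal_plus)
  then have "x \<le> (1 - c) * V"
    by (simp add: algebra_simps)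
  then have "ennreal x \<le> ennreal (1 - c) * ennreal V"
    using V(2) by (simp add: ennreal_mult''[symmetric] ennreal_leI)
  then show ?thesis by (simp only: V x)
qed

text \<open>The usual inequality between averages with respect to \<open>m dA\<close>, multiplied
  out by \<open>\<mu> powr p\<close>. With \<open>m = 1\<close> it expresses \<open>B_p\<close> for
  \<open>u\<close> itself; with \<open>m = u\<close> it expresses A_p for \<tau> relative to
  \<open>u dA\<close>, the factor \<open>u\<close> being absorbed into \<open>v\<close> and
  \<open>v'\<close>. Finiteness and positivity of all three masses are part of it.\<close>

definition Ap_boxes :: "(complex \<Rightarrow> real) \<Rightarrow> real \<Rightarrow> real \<Rightarrow> (complex \<Rightarrow> real) \<Rightarrow> (complex \<Rightarrow> real) \<Rightarrow> bool" where
  "Ap_boxes m p C v v' \<longleftrightarrow> (\<forall>\<theta> l. 0 < l \<longrightarrow> l \<le> 1 \<longrightarrow> (\<exists>V V' \<mu>. V > 0 \<and> V' > 0 \<and> \<mu> > 0 \<and>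
     disc_mass v (Qbox \<theta> l) = ennreal V \<and> disc_mass v' (Qbox \<theta> l) = ennreal V' \<and>
     disc_mass m (Qbox \<theta> l) = ennreal \<mu> \<and> V * V' powr (p - 1) \<le> C * \<mu> powr p))"

definition top_heavy :: "real \<Rightarrow> (complex \<Rightarrow> real) \<Rightarrow> bool" where
  "top_heavy c v \<longleftrightarrow> (\<forall>\<theta> l V. 0 < l \<longrightarrow> l \<le> 1 \<longrightarrow> disc_mass v (Qbox \<theta> l) = ennreal V \<longrightarrow> V \<ge> 0 \<longrightarrow>
     ennreal (c * V) \<le> disc_mass v (Qbox \<theta> l - strip \<theta> l 1))"

definition strip_decay :: "real \<Rightarrow> (complex \<Rightarrow> real) \<Rightarrow> bool" where
  "strip_decay \<kappa> v \<longleftrightarrow> (\<forall>\<theta> l n. 0 < l \<longrightarrow> l \<le> 1 \<longrightarrow>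
     disc_mass v (strip \<theta> l n) \<le> ennreal (\<kappa> ^ n) * disc_mass v (Qbox \<theta> l))"

lemma strip_decay_mono:
  assumes "strip_decay \<kappa>' v" "0 \<le> \<kappa>'" "\<kappa>' \<le> \<kappa>"
  shows "strip_decay \<kappa> v"
  unfolding strip_decay_def
proof (intro allI impI)
  fix \<theta> l n assume "0 < l" "l \<le> (1::real)"
  then have "disc_mass v (strip \<theta> l n) \<le> ennreal (\<kappa>' ^ n) * disc_mass v (Qbox \<theta> l)"
    using assms(1) unfolding strip_decay_def by blast
  also have "\<dots> \<le> ennreal (\<kappa> ^ n) * disc_mass v (Qbox \<theta> l)"
    using assms(2,3) by (intro mult_right_mono ennreal_leI power_mono) auto
  finally show "disc_mass v (strip \<theta> l n) \<le> ennreal (\<kappa> ^ n) * disc_mass v (Qbox \<theta> l)" .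
qed

lemma Ap_boxesE:
  assumes "Ap_boxes m p C v v'" "0 < l" "l \<le> 1"
  obtains V V' \<mu> where "V > 0" "V' > 0" "\<mu> > 0"
    "disc_mass v (Qbox \<theta> l) = ennreal V" "disc_mass v' (Qbox \<theta> l) = ennreal V'"
    "disc_mass m (Qbox \<theta> l) = ennreal \<mu>" "V * V' powr (p - 1) \<le> C * \<mu> powr p"
  using assms unfolding Ap_boxes_def by blast

text \<open>Top-heaviness passes from the reference weight \<open>m\<close> to \<open>v\<close>. It
  serves twice in succession: from area to \<open>u\<close>, and from \<open>u\<close> to the
  weights built from \<tau>.\<close>

lemma top_heavy_Ap_boxes:
  assumes Ap: "Ap_boxes m p C v v'" and p: "p > 1" and q: "q = p / (p - 1)"
    and [measurable]: "v \<in> borel_measurable disc_measure" "v' \<in> borel_measurable disc_measure"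
    and nn: "\<And>z. v z \<ge> 0" "\<And>z. v' z \<ge> 0"
    and m: "\<And>z. z \<in> unit_disc \<Longrightarrow> m z = v z powr (1/p) * v' z powr (1/q)" and C: "C > 0"
    and c: "top_heavy c m" "c \<ge> 0"
  shows "top_heavy (c powr p / C) v"
  unfolding top_heavy_def
proof (intro allI impI)
  fix \<theta> l V0 assume l: "0 < l" "l \<le> (1::real)" and V0: "disc_mass v (Qbox \<theta> l) = ennreal V0" "V0 \<ge> 0"
  let ?Q = "Qbox \<theta> l" and ?T = "Qbox \<theta> l - strip \<theta> l 1"
  obtain V V' \<mu> where b: "V > 0" "V' > 0" "\<mu> > 0" "disc_mass v ?Q = ennreal V" "disc_mass v' ?Q = ennreal V'"
    "disc_mass m ?Q = ennreal \<mu>" "V * V' powr (p - 1) \<le> C * \<mu> powr p"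
    using Ap_boxesE[OF Ap l] .
  have eqV: "V0 = V" using b(1,4) V0 by simp
  have "ennreal (c powr p / C * V) \<le> disc_mass v ?T"
  proof (rule Ap_subset_mass[where m=m and v'=v' and q=q and V'=V' and I=\<mu> and Q="?Q"])
    show "ennreal (c * \<mu>) \<le> disc_mass m ?T"
      using c(1) l b(3,6) unfolding top_heavy_def by simp
    show "m z = v z powr (1/p) * v' z powr (1/q)" if "z \<in> space disc_measure" for z
      using m that by (simp add: space_restrict_space)
  qed (use b C c p q nn in auto)
  then show "ennreal (c powr p / C * V0) \<le> disc_mass v ?T" by (simp only: eqV)
qed

lemma disc_mass_one: "S \<in> sets disc_measure \<Longrightarrow> disc_mass (\<lambda>_. 1) S = emeasure lebesgue S"
  using emeasure_disc_measure[of S] by (simp add: sets_restrict_space_iff)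

lemma top_heavy_one: "top_heavy (1/1024) (\<lambda>_. 1)"
  unfolding top_heavy_def
proof (intro allI impI)
  fix \<theta> l V assume l: "0 < l" "l \<le> (1::real)" and V: "disc_mass (\<lambda>_. 1) (Qbox \<theta> l) = ennreal V" "V \<ge> 0"
  obtain s where s: "emeasure lebesgue (Qbox \<theta> l) = ennreal s" "s > 0"
    "ennreal (1/1024 * s) \<le> emeasure lebesgue (Qbox \<theta> l - strip \<theta> l 1)"
    using Qbox_size[OF l] by metis
  then have "V = s" using V disc_mass_one[OF Qbox_disc, of \<theta> l] by simp
  then show "ennreal (1/1024 * V) \<le> disc_mass (\<lambda>_. 1) (Qbox \<theta> l - strip \<theta> l 1)"
    using s(3) disc_mass_one[OF sets.Diff[OF Qbox_disc strip_disc], of \<theta> l \<theta> l 1] by simp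
qed

lemma top_heavy_imp_strip_decay:
  assumes [measurable]: "v \<in> borel_measurable disc_measure" and c: "top_heavy c v" "c > 0"
    and fin: "\<And>\<theta> l. 0 < l \<Longrightarrow> l \<le> 1 \<Longrightarrow> disc_mass v (Qbox \<theta> l) < \<infinity>"
  obtains \<kappa> where "0 \<le> \<kappa>" "\<kappa> < 1" "strip_decay \<kappa> v"
proof (rule that[of "1 - min c 1"])
  have "disc_mass v (strip \<theta> l 1) \<le> ennreal (1 - min c 1) * disc_mass v (Qbox \<theta> l)" if l: "0 < l" "l \<le> 1" for \<theta> l
  proof -
    define V where "V = enn2real (disc_mass v (Qbox \<theta> l))"
    have V: "disc_mass v (Qbox \<theta> l) = ennreal V" "V \<ge> 0"
      using fin[OF l, of \<theta>] by (auto simp: V_def)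
    have "ennreal (min c 1 * V) \<le> ennreal (c * V)"
      using V(2) by (intro ennreal_leI mult_right_mono) auto
    also have "\<dots> \<le> disc_mass v (Qbox \<theta> l - strip \<theta> l 1)"
      using c(1) l V unfolding top_heavy_def by simp
    finally show ?thesis
      using V c(2) by (intro strip_mass_of_top[where V=V]) auto
  qed
  then show "strip_decay (1 - min c 1) v"
    unfolding strip_decay_def using c(2) by (auto intro!: strip_mass_decay)
qed (use c in auto)

lemma nn_integral_disc_finite:
  assumes [measurable]: "f \<in> borel_measurable disc_measure"
    and fin: "\<And>\<theta>. (\<integral>\<^sup>+z\<in>Qbox \<theta> 1. f z \<partial>disc_measure) < \<infinity>"
  shows "(\<integral>\<^sup>+z. f z \<partial>disc_measure) < \<infinity>"
proof -
  have "(\<integral>\<^sup>+z. f z \<partial>disc_measure) \<le> (\<integral>\<^sup>+z. (\<Sum>j<7::nat. f z * indicator (Qbox (real j) 1) z) \<partial>disc_measure)"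
  proof (rule nn_integral_mono)
    fix z assume "z \<in> space disc_measure"
    then have "z \<in> unit_disc" by (simp add: space_restrict_space)
    then obtain j :: nat where j: "j < 7" "z \<in> Qbox (real j) 1" using unit_disc_subset_sectors by auto
    then have "f z = f z * indicator (Qbox (real j) 1) z"
      by (simp add: indicator_def)
    also have "\<dots> \<le> (\<Sum>j<7::nat. f z * indicator (Qbox (real j) 1) z)"
      using j by (intro member_le_sum) auto
    finally show "f z \<le> (\<Sum>j<7::nat. f z * indicator (Qbox (real j) 1) z)" .
  qed
  also have "\<dots> = (\<Sum>j<7::nat. \<integral>\<^sup>+z\<in>Qbox (real j) 1. f z \<partial>disc_measure)"
    by (rule nn_integral_sum) measurable
  also have "\<dots> < \<infinity>"
    using fin by (simp add: ennreal_sum_less_top)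
  finally show ?thesis .
qed

section \<open>Weights induced by a conformal map\<close>

lemma root_bound:
  fixes X K0 t Y :: real
  assumes "N > 0" "X \<ge> 0" "K0 > 0" "t > 0" "Y > 0" and le: "X ^ N \<le> K0 / t\<^sup>2 * Y ^ N"
  shows "X \<le> K0 powr (1 / real N) * t powr (- 2 / real N) * Y"
proof -
  have "(K0 powr (1 / real N) * t powr (- 2 / real N) * Y) ^ N = K0 / t\<^sup>2 * Y ^ N"
  proof -
    have "(K0 powr (1 / real N)) ^ N = K0"
      using assms by (simp add: powr_power)
    moreover have "(t powr (- 2 / real N)) ^ N = t powr (- 2)"
      using assms by (simp add: powr_power)
    moreover have "t powr (- 2) = 1 / t\<^sup>2"
      using assms by (simp add: powr_minus powr_numeral divide_inverse)
    ultimately show ?thesis by (simp add: power_mult_distrib)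
  qed
  then have "X ^ N \<le> (K0 powr (1 / real N) * t powr (- 2 / real N) * Y) ^ N"
    using le by simp
  then show ?thesis
    using assms by (intro power_le_imp_le_base[of X "N - 1"]) auto
qed

locale conformal_Bekolle =
  fixes \<psi> :: "complex \<Rightarrow> complex" and u :: "complex \<Rightarrow> real"
  assumes hol: "\<psi> holomorphic_on unit_disc" and inj: "inj_on \<psi> unit_disc"
    and Bq: "\<And>q. q > 1 \<Longrightarrow> Bp_disc q (\<lambda>z. (cmod (deriv \<psi> z))\<^sup>2)"
  defines "u \<equiv> \<lambda>z. (cmod (deriv \<psi> z))\<^sup>2"
begin

lemma deriv_nz: "z \<in> unit_disc \<Longrightarrow> deriv \<psi> z \<noteq> 0"
  using holomorphic_injective_imp_regular[OF hol open_ball inj] by blast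

lemma u_pos: "z \<in> unit_disc \<Longrightarrow> u z > 0"
  using deriv_nz by (simp add: u_def)

lemma u_nonneg: "u z \<ge> 0"
  by (simp add: u_def)

lemma deriv_measurable [measurable]: "deriv \<psi> \<in> borel_measurable disc_measure"
  using hol by (intro holomorphic_borel_measurable holomorphic_deriv) auto

lemma u_measurable [measurable]: "u \<in> borel_measurable disc_measure"
  unfolding u_def by measurable

lemma norm_measurable_disc [measurable]: "cmod \<in> borel_measurable disc_measure"
  by (simp add: measurable_restrict_space1 measurable_completion)

lemma u_box:
  assumes q: "q > 1"
  obtains C where "C > 0" "Ap_boxes (\<lambda>_. 1) q C u (\<lambda>z. u z powr (- 1 / (q - 1)))"
proof -
  obtain C0 where C0: "\<And>\<theta> l. 0 < l \<Longrightarrow> l \<le> 1 \<Longrightarrow>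
      avg 1 (\<lambda>_. 1) (Qbox \<theta> l) u * avg (1 / (q - 1)) (\<lambda>_. 1) (Qbox \<theta> l) (\<lambda>z. 1 / u z) \<le> ennreal C0"
    using Bq[OF q] unfolding Bp_disc_def u_def by blast
  have "\<exists>V V' \<mu>. V > 0 \<and> V' > 0 \<and> \<mu> > 0 \<and> disc_mass u (Qbox \<theta> l) = ennreal V \<and>
       (\<integral>\<^sup>+z\<in>Qbox \<theta> l. ennreal (u z powr (- 1 / (q - 1))) \<partial>disc_measure) = ennreal V' \<and>
       (\<integral>\<^sup>+z\<in>Qbox \<theta> l. ennreal 1 \<partial>disc_measure) = ennreal \<mu> \<and> V * V' powr (q - 1) \<le> max C0 1 * \<mu> powr q"
    if l: "0 < l" "l \<le> 1" for \<theta> l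
  proof -
    let ?Q = "Qbox \<theta> l"
    have Q: "?Q \<in> sets lebesgue" "?Q \<subseteq> unit_disc" "unit_disc \<in> sets lebesgue" using Qbox_subset_disc by auto
    obtain s where s: "emeasure lebesgue ?Q = ennreal s" "s > 0" using Qbox_size[OF l] by blast
    have m: "u \<in> borel_measurable (lebesgue_on ?Q)"
      using u_measurable Q(2) by (meson measurable_restrict_mono)
    have "AE z in lebesgue_on ?Q. u z > 0"
      using Q(2) u_pos by (intro AE_I2) (auto simp: space_restrict_space)
    from Bp_average_bound[OF Q(1) s q m this C0[OF l]]
    obtain V V' where V: "(\<integral>\<^sup>+z. ennreal (u z) \<partial>lebesgue_on ?Q) = ennreal V" "V > 0"
       "(\<integral>\<^sup>+z. ennreal (u z powr (- 1 / (q - 1))) \<partial>lebesgue_on ?Q) = ennreal V'" "V' > 0"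
       "V * V' powr (q - 1) \<le> C0 * s powr q" .
    have "C0 * s powr q \<le> max C0 1 * s powr q" by (intro mult_right_mono) auto
    then have "V * V' powr (q - 1) \<le> max C0 1 * s powr q" using V(5) by linarith
    then show ?thesis
      using s V(1-4) disc_mass_one[OF Qbox_disc, of \<theta> l] unfolding nn_integral_lebesgue_on_subset[OF Q] by auto
  qed
  then show ?thesis
    by (intro that[of "max C0 1"]) (auto simp: Ap_boxes_def)
qed

text \<open>In B_2 the dual weight is \<open>1/u\<close>, and 1 is the geometric mean of
  \<open>u\<close> and \<open>1/u\<close>, so the proportion of area in the top half is inherited by
  \<open>u\<close>.\<close>

lemma u_top_heavy:
  obtains c where "c > 0" "top_heavy c u"
proof -
  obtain C where C: "C > 0" "Ap_boxes (\<lambda>_. 1) 2 C u (\<lambda>z. u z powr (- 1 / (2 - 1)))"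
    by (rule u_box[of 2]) auto
  have "1 = u z powr (1/2) * (u z powr (- 1 / (2 - 1))) powr (1/2)" if "z \<in> unit_disc" for z
    using u_pos[OF that] by (simp flip: powr_mult)
  then have "top_heavy ((1/1024) powr 2 / C) u"
    using C u_nonneg by (intro top_heavy_Ap_boxes[OF C(2) _ _ _ _ _ _ _ _ top_heavy_one, where q=2]) auto
  then show ?thesis using C(1) by (intro that[of "(1/1024) powr 2 / C"]) auto
qed

text \<open>For \<open>q = 1 + 1/N\<close> the dual weight of \<open>B\<^sub>q\<close> is \<open>u\<close> to the power \<open>-N\<close>, the squared modulus of a holomorphic
  function; its mean value property turns the integral condition into a pointwise lower bound for \<open>u\<close>.\<close>
lemma inverse_u_power_le:
  assumes z: "z \<in> unit_disc" and S: "ball z ((1 - cmod z)/8) \<subseteq> S" "S \<subseteq> unit_disc"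
  shows "ennreal ((1 / u z) ^ N) \<le> ennreal (64 / (pi * (1 - cmod z)\<^sup>2)) * (\<integral>\<^sup>+x\<in>S. ennreal (u x powr (- real N)) \<partial>disc_measure)"
proof -
  \<comment> \<open>The radius matches the disc that fits into the doubled box; its square produces
    the factor 64.\<close>
  define r where "r = (1 - cmod z)/8"
  have r: "r > 0" using z by (simp add: r_def)
  define h where "h x = inverse (deriv \<psi> x) ^ N" for x
  have hh: "(cmod (h x))\<^sup>2 = (1 / u x) ^ N" for x
  proof -
    have "(cmod (h x))\<^sup>2 = ((cmod (inverse (deriv \<psi> x)))\<^sup>2) ^ N"
      by (simp only: h_def norm_power power_mult[symmetric] mult.commute)
    also have "(cmod (inverse (deriv \<psi> x)))\<^sup>2 = 1 / u x"
      by (simp add: u_def norm_inverse power_inverse divide_inverse)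
    finally show ?thesis .
  qed
  have hu: "(cmod (h x))\<^sup>2 = u x powr (- real N)" if "x \<in> unit_disc" for x
    using u_pos[OF that] by (simp add: hh powr_minus powr_realpow power_divide field_simps)
  have "h holomorphic_on unit_disc"
    unfolding h_def using deriv_nz hol by (intro holomorphic_intros holomorphic_deriv) auto
  then have hb: "h holomorphic_on ball z r"
    using S by (auto simp: r_def intro: holomorphic_on_subset)
  have "ennreal ((1 / u z) ^ N) \<le> ennreal (1 / (pi * r\<^sup>2)) * (\<integral>\<^sup>+x\<in>ball z r. ennreal ((cmod (h x))\<^sup>2) \<partial>lebesgue)"
    using norm_sq_le_disc_mean[OF hb r] by (simp only: hh)
  also have "(\<integral>\<^sup>+x\<in>ball z r. ennreal ((cmod (h x))\<^sup>2) \<partial>lebesgue) \<le> (\<integral>\<^sup>+x\<in>S. ennreal (u x powr (- real N)) \<partial>disc_measure)"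
  proof -
    have "(\<integral>\<^sup>+x\<in>ball z r. ennreal ((cmod (h x))\<^sup>2) \<partial>lebesgue) \<le> (\<integral>\<^sup>+x. (ennreal (u x powr (- real N)) * indicator S x) * indicator unit_disc x \<partial>lebesgue)"
    proof (rule nn_integral_mono)
      fix x
      show "ennreal ((cmod (h x))\<^sup>2) * indicator (ball z r) x \<le> (ennreal (u x powr (- real N)) * indicator S x) * indicator unit_disc x"
      proof (cases "x \<in> ball z r")
        case True
        then have "x \<in> S" using S(1) unfolding r_def by blast
        then have "x \<in> S" "x \<in> unit_disc" using S(2) by blast+
        then show ?thesis using hu True by (simp add: indicator_def)
      qed simp
    qed
    then show ?thesis by (simp add: nn_integral_restrict_space)
  qed
  also have "1 / (pi * r\<^sup>2) = 64 / (pi * (1 - cmod z)\<^sup>2)"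
    by (simp add: r_def power_divide)
  finally show ?thesis by (simp add: mult_left_mono)
qed

text \<open>The mean value inequality costs the inverse square of the relative depth, but it
  concerns the N-th power of \<open>1/u\<close>, so taking roots leaves only the power
  \<open>- 2 / real N\<close>. The doubled box enters because the disc around \<open>z\<close> may
  leave the original one, and this restricts \<open>l\<close> to at most 1/2.\<close>

lemma inverse_u_le_box:
  assumes N: "N > 0"
  obtains K where "K > 0"
    "\<And>\<theta> l z \<mu>. 0 < l \<Longrightarrow> l \<le> 1/2 \<Longrightarrow> z \<in> Qbox \<theta> l \<Longrightarrow> disc_mass u (Qbox \<theta> l) = ennreal \<mu> \<Longrightarrow> \<mu> > 0 \<Longrightarrow>
       1 / u z \<le> K * ((1 - cmod z) / l) powr (- 2 / real N) * (l\<^sup>2 / \<mu>)"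
proof -
  have q: "1 + 1 / real N > 1" "- 1 / ((1 + 1 / real N) - 1) = - real N" "(1 + 1 / real N) - 1 = 1 / real N"
    using N by auto
  obtain C where C: "C > 0" and box: "Ap_boxes (\<lambda>_. 1) (1 + 1 / real N) C u (\<lambda>z. u z powr (- real N))"
    by (rule u_box[OF q(1), unfolded q(2)])
  \<comment> \<open>64/pi comes from the mean value over the small disc, \<open>C ^ N\<close> from
    the N-th power of the B_q inequality, and \<open>16 * pi * l^2\<close> bounds the area of the
    doubled box.\<close>
  define K0 where "K0 = 64 / pi * C ^ N * (16 * pi) ^ Suc N"
  have K0: "K0 > 0" using C by (simp add: K0_def)
  show ?thesis
  proof (rule that[of "K0 powr (1 / real N)"])
    fix \<theta> l z \<mu> assume l: "0 < l" "l \<le> (1/2::real)" and z: "z \<in> Qbox \<theta> l"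
      and \<mu>: "disc_mass u (Qbox \<theta> l) = ennreal \<mu>" "\<mu> > 0"
    have zD: "z \<in> unit_disc" using z Qbox_subset_disc by blast
    then have d: "1 - cmod z > 0" by simp
    let ?Q = "Qbox \<theta> (2*l)"
    have l2: "0 < 2*l" "2*l \<le> 1" using l by auto
    obtain V V' s where b: "V > 0" "V' > 0" "s > 0" "disc_mass u ?Q = ennreal V"
       "(\<integral>\<^sup>+z\<in>?Q. ennreal (u z powr (- real N)) \<partial>disc_measure) = ennreal V'"
       "(\<integral>\<^sup>+z\<in>?Q. ennreal 1 \<partial>disc_measure) = ennreal s" "V * V' powr (1 / real N) \<le> C * s powr (1 + 1 / real N)"
      by (rule Ap_boxesE[OF box l2, of \<theta>, unfolded q(3)])
    have s: "s \<le> 16 * pi * l\<^sup>2"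
    proof -
      have "ennreal s \<le> ennreal (4 * pi * (2*l)\<^sup>2)"
        using emeasure_Qbox_le[OF l2, of \<theta>] disc_mass_one[OF Qbox_disc, of \<theta> "2*l"] b(6) by simp
      then have "s \<le> 4 * pi * (2*l)\<^sup>2" by (simp add: ennreal_le_iff)
      then show ?thesis by (simp add: power_mult_distrib)
    qed
    have sub: "Qbox \<theta> l \<subseteq> ?Q"
    proof
      fix x assume "x \<in> Qbox \<theta> l"
      then obtain \<theta>' where x: "cmod x < 1" "1 - cmod x \<le> l" "x = of_real (cmod x) * cis \<theta>'" "\<bar>\<theta>' - \<theta>\<bar> \<le> l/2"
        unfolding Qbox_iff by blast
      then have "1 - cmod x \<le> 2*l" "\<bar>\<theta>' - \<theta>\<bar> \<le> 2*l/2" using l by auto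
      then show "x \<in> ?Q" unfolding Qbox_iff using x by blast
    qed
    have "ennreal \<mu> \<le> ennreal V"
      unfolding \<mu>(1)[symmetric] b(4)[symmetric] using sub by (intro nn_integral_mono) (auto simp: indicator_def)
    then have \<mu>V: "\<mu> \<le> V" using b(1) by (simp add: ennreal_le_iff)
    have "ennreal ((1 / u z) ^ N) \<le> ennreal (64 / (pi * (1 - cmod z)\<^sup>2)) * ennreal V'"
      unfolding b(5)[symmetric]
      by (rule inverse_u_power_le[OF zD ball_subset_Qbox_double[OF l z] Qbox_subset_disc])
    then have u1: "(1 / u z) ^ N \<le> 64 / (pi * (1 - cmod z)\<^sup>2) * V'"
      using b(2) d by (simp add: ennreal_mult'[symmetric] ennreal_le_iff)
    have "V' powr (1 / real N) \<le> C * s powr (1 + 1 / real N) / V"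
      using b(1,7) by (simp add: field_simps)
    then have "(V' powr (1 / real N)) ^ N \<le> (C * s powr (1 + 1 / real N) / V) ^ N"
      by (intro power_mono) auto
    then have "V' \<le> (C * s powr (1 + 1 / real N) / V) ^ N"
      using b(2) N by (simp add: powr_power)
    also have "(C * s powr (1 + 1 / real N) / V) ^ N = C ^ N * s ^ Suc N / V ^ N"
    proof -
      have "(s powr (1 + 1 / real N)) ^ N = (s powr (1 + 1 / real N)) powr real N"
        using b(3) by (simp add: powr_realpow)
      also have "\<dots> = s powr ((1 + 1 / real N) * real N)"
        by (rule powr_powr)
      also have "(1 + 1 / real N) * real N = real (Suc N)"
        using N by (simp add: field_simps)
      also have "s powr real (Suc N) = s ^ Suc N" using b(3) by (rule powr_realpow)
      finally show ?thesis by (simp add: power_divide power_mult_distrib)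
    qed
    also have "\<dots> \<le> C ^ N * (16 * pi * l\<^sup>2) ^ Suc N / \<mu> ^ N"
      using s b(3) C \<mu> \<mu>V by (intro frac_le mult_left_mono power_mono) auto
    finally have "64 / (pi * (1 - cmod z)\<^sup>2) * V' \<le> 64 / (pi * (1 - cmod z)\<^sup>2) * (C ^ N * (16 * pi * l\<^sup>2) ^ Suc N / \<mu> ^ N)"
      by (intro mult_left_mono) auto
    also have "\<dots> = K0 / ((1 - cmod z) / l)\<^sup>2 * (l\<^sup>2 / \<mu>) ^ N"
      by (simp add: K0_def power_divide power_mult_distrib)
    finally have "(1 / u z) ^ N \<le> K0 / ((1 - cmod z) / l)\<^sup>2 * (l\<^sup>2 / \<mu>) ^ N"
      using u1 by linarith
    then show "1 / u z \<le> K0 powr (1 / real N) * ((1 - cmod z) / l) powr (- 2 / real N) * (l\<^sup>2 / \<mu>)"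
      using N K0 d l \<mu> u_nonneg[of z] by (intro root_bound) auto
  qed (use K0 in simp)
qed

text \<open>A substitute for the boxes too large to be doubled. No normalisation by the mass of a
  box is kept, as only finitely many coarse scales depend on it.\<close>

lemma inverse_u_le_disc:
  assumes N: "N > 0"
  obtains K where "K > 0" "\<And>z. z \<in> unit_disc \<Longrightarrow> 1 / u z \<le> K * (1 - cmod z) powr (- 2 / real N)"
proof -
  have q: "1 + 1 / real N > 1" "- 1 / ((1 + 1 / real N) - 1) = - real N"
    using N by auto
  obtain C where box: "Ap_boxes (\<lambda>_. 1) (1 + 1 / real N) C u (\<lambda>z. u z powr (- real N))"
    by (rule u_box[OF q(1), unfolded q(2)])
  have "(\<integral>\<^sup>+z\<in>Qbox \<theta> 1. ennreal (u z powr (- real N)) \<partial>disc_measure) < \<infinity>" for \<theta>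
    by (rule Ap_boxesE[OF box zero_less_one order_refl, of \<theta>]) simp
  then have "(\<integral>\<^sup>+z. ennreal (u z powr (- real N)) \<partial>disc_measure) < \<infinity>"
    by (rule nn_integral_disc_finite[rotated]) measurable
  moreover have "(\<integral>\<^sup>+z\<in>unit_disc. ennreal (u z powr (- real N)) \<partial>disc_measure) = (\<integral>\<^sup>+z. ennreal (u z powr (- real N)) \<partial>disc_measure)"
    by (rule nn_integral_cong) (simp add: space_restrict_space)
  ultimately obtain Z where Z: "(\<integral>\<^sup>+z\<in>unit_disc. ennreal (u z powr (- real N)) \<partial>disc_measure) = ennreal Z" "Z \<ge> 0"
    by (intro that[of "enn2real (\<integral>\<^sup>+z. ennreal (u z powr (- real N)) \<partial>disc_measure)"]) auto
  \<comment> \<open>\<open>Z + 1\<close> in place of \<open>Z\<close> keeps the constant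
    positive.\<close>
  define K0 where "K0 = 64 / pi * (Z + 1)"
  have K0: "K0 > 0" using Z by (simp add: K0_def)
  show ?thesis
  proof (rule that[of "K0 powr (1 / real N)"])
    fix z :: complex assume zD: "z \<in> unit_disc"
    then have d: "1 - cmod z > 0" by simp
    have "ball z ((1 - cmod z)/8) \<subseteq> unit_disc"
    proof
      fix x assume "x \<in> ball z ((1 - cmod z)/8)"
      then have "8 * cmod (x - z) < 1 - cmod z" by (simp add: dist_norm norm_minus_commute)
      then have "cmod (x - z) < 1 - cmod z" using norm_ge_zero[of "x - z"] by linarith
      then show "x \<in> unit_disc" using norm_triangle_sub[of x z] by simp
    qed
    from inverse_u_power_le[OF zD this order_refl, of N]
    have "(1 / u z) ^ N \<le> 64 / (pi * (1 - cmod z)\<^sup>2) * Z"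
      using Z d by (simp add: ennreal_mult'[symmetric] ennreal_le_iff)
    also have "\<dots> \<le> 64 / (pi * (1 - cmod z)\<^sup>2) * (Z + 1)"
      by (intro mult_left_mono) auto
    also have "\<dots> = K0 / (1 - cmod z)\<^sup>2 * 1 ^ N"
      by (simp add: K0_def)
    finally have "1 / u z \<le> K0 powr (1 / real N) * (1 - cmod z) powr (- 2 / real N) * 1"
      using N K0 d u_nonneg[of z] by (intro root_bound) auto
    then show "1 / u z \<le> K0 powr (1 / real N) * (1 - cmod z) powr (- 2 / real N)" by simp
  qed (use K0 in simp)
qed

text \<open>Top-heaviness of \<open>u\<close> is inherited by \<open>v\<close> and then iterated
  through the dyadic children. Both \<tau>-weights qualify, since the A_p condition is symmetric
  under duality.\<close>

lemma Ap_boxes_strip_decay: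
  assumes Ap: "Ap_boxes u p C v v'" and pq: "p > 1" "q = p / (p - 1)"
    and v: "v \<in> borel_measurable disc_measure" "v' \<in> borel_measurable disc_measure"
    and nn: "\<And>z. v z \<ge> 0" "\<And>z. v' z \<ge> 0"
    and m: "\<And>z. z \<in> unit_disc \<Longrightarrow> u z = v z powr (1/p) * v' z powr (1/q)" and C: "C > 0"
  obtains \<kappa> where "0 \<le> \<kappa>" "\<kappa> < 1" "strip_decay \<kappa> v"
proof -
  obtain c where c: "c > 0" "top_heavy c u" by (rule u_top_heavy)
  have "top_heavy (c powr p / C) v"
    by (rule top_heavy_Ap_boxes[OF Ap pq v nn m C c(2)]) (use c in auto)
  moreover have "disc_mass v (Qbox \<theta> l) < \<infinity>" if "0 < l" "l \<le> 1" for \<theta> l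
    by (rule Ap_boxesE[OF Ap that, of \<theta>]) simp
  ultimately show ?thesis
    using top_heavy_imp_strip_decay[OF v(1)] c(1) C that by (metis divide_pos_pos powr_gt_zero less_irrefl)
qed

section \<open>Trading negative powers of u for the distance to the circle\<close>

lemma u_powr_le:
  assumes z: "z \<in> unit_disc" and e: "e > 0" and b: "1 / u z \<le> K * t powr (- 2 / real N) * Y"
    and "K > 0" "t > 0" "t \<le> 1" "Y > 0" "N > 0" and a: "e / real N + \<eta> \<le> a"
  shows "u z powr (- e / 2) * t powr (- \<eta>) \<le> (K * Y) powr (e / 2) * t powr (- a)"
proof -
  have "u z powr (- e / 2) = (1 / u z) powr (e / 2)"
  proof -
    have "u z powr (- e / 2) = 1 / u z powr (e / 2)"
      unfolding minus_divide_left[symmetric] by (rule powr_minus_divide)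
    also have "\<dots> = (1 / u z) powr (e / 2)"
      using u_nonneg[of z] by (simp add: powr_divide)
    finally show ?thesis .
  qed
  also have "\<dots> \<le> (K * t powr (- 2 / real N) * Y) powr (e / 2)"
    using e b u_nonneg[of z] by (intro powr_mono2) auto
  also have "\<dots> = (K * Y) powr (e / 2) * t powr (- e / real N)"
  proof -
    have "(t powr (- 2 / real N)) powr (e / 2) = t powr (- e / real N)"
      unfolding powr_powr by simp
    then show ?thesis
      using \<open>K > 0\<close> \<open>Y > 0\<close> by (simp add: powr_mult)
  qed
  finally have "u z powr (- e / 2) * t powr (- \<eta>) \<le> (K * Y) powr (e / 2) * t powr (- e / real N) * t powr (- \<eta>)"
    by (rule mult_right_mono) simp
  also have "\<dots> = (K * Y) powr (e / 2) * t powr (- (e / real N + \<eta>))"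
    by (simp add: powr_add[symmetric])
  also have "\<dots> \<le> (K * Y) powr (e / 2) * t powr (- a)"
    using a \<open>t > 0\<close> \<open>t \<le> 1\<close> by (intro mult_left_mono powr_mono') auto
  finally show ?thesis .
qed

text \<open>The exponent \<open>a\<close> is a budget granted by the decay of \<open>v\<close>: the
  part \<open>e / real N\<close> pays for \<open>u powr (- e / 2)\<close> and \<eta> survives. The
  parameter \<open>Y\<close> is \<open>l^2/\<mu>\<close> on small boxes and 1 on boxes of size
  1.\<close>

lemma weighted_box_mass:
  fixes v :: "complex \<Rightarrow> real"
  assumes [measurable]: "v \<in> borel_measurable disc_measure" and nn: "\<And>z. v z \<ge> 0"
    and decay: "strip_decay \<kappa> v"
    and \<kappa>: "\<kappa> \<ge> 0" and a: "a \<ge> 0" "2 powr a * \<kappa> < 1" and e: "e > 0" "N > 0" "e / real N + \<eta> \<le> a"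
    and l: "0 < l" "l \<le> 1" and K: "K > 0" "Y > 0" "\<And>z. z \<in> Qbox \<theta> l \<Longrightarrow> 1 / u z \<le> K * ((1 - cmod z) / l) powr (- 2 / real N) * Y"
    and V: "disc_mass v (Qbox \<theta> l) = ennreal V" "V \<ge> 0"
  shows "(\<integral>\<^sup>+z\<in>Qbox \<theta> l. ennreal (v z * u z powr (- e / 2) * ((1 - cmod z) / l) powr (- \<eta>)) \<partial>disc_measure)
     \<le> ennreal ((K * Y) powr (e / 2) * (2 powr a / (1 - 2 powr a * \<kappa>)) * V)"
proof -
  have "(\<integral>\<^sup>+z\<in>Qbox \<theta> l. ennreal (v z * u z powr (- e / 2) * ((1 - cmod z) / l) powr (- \<eta>)) \<partial>disc_measure)
    \<le> (\<integral>\<^sup>+z. ennreal ((K * Y) powr (e / 2)) * (ennreal (v z * ((1 - cmod z) / l) powr (- a)) * indicator (Qbox \<theta> l) z) \<partial>disc_measure)"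
  proof (rule nn_integral_mono)
    fix z
    show "ennreal (v z * u z powr (- e / 2) * ((1 - cmod z) / l) powr (- \<eta>)) * indicator (Qbox \<theta> l) z \<le>
      ennreal ((K * Y) powr (e / 2)) * (ennreal (v z * ((1 - cmod z) / l) powr (- a)) * indicator (Qbox \<theta> l) z)"
    proof (cases "z \<in> Qbox \<theta> l")
      case True
      then have zD: "z \<in> unit_disc" and t: "(1 - cmod z) / l > 0" "(1 - cmod z) / l \<le> 1"
        using Qbox_subset_disc l(1) by (auto simp: Qbox_iff)
      have "u z powr (- e / 2) * ((1 - cmod z) / l) powr (- \<eta>) \<le> (K * Y) powr (e / 2) * ((1 - cmod z) / l) powr (- a)"
        by (rule u_powr_le[OF zD e(1) K(3)[OF True] K(1) t K(2) e(2,3)])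
      then have "v z * (u z powr (- e / 2) * ((1 - cmod z) / l) powr (- \<eta>)) \<le> v z * ((K * Y) powr (e / 2) * ((1 - cmod z) / l) powr (- a))"
        by (rule mult_left_mono[OF _ nn])
      then have "v z * u z powr (- e / 2) * ((1 - cmod z) / l) powr (- \<eta>) \<le> (K * Y) powr (e / 2) * (v z * ((1 - cmod z) / l) powr (- a))"
        by (simp only: mult_ac)
      then have "ennreal (v z * u z powr (- e / 2) * ((1 - cmod z) / l) powr (- \<eta>)) \<le> ennreal ((K * Y) powr (e / 2)) * ennreal (v z * ((1 - cmod z) / l) powr (- a))"
        unfolding ennreal_mult'[OF powr_ge_zero, symmetric] by (rule ennreal_leI)
      then show ?thesis using True by (simp only: indicator_simps mult_1_right)
    qed (simp add: indicator_def)
  qed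
  also have "\<dots> = ennreal ((K * Y) powr (e / 2)) * (\<integral>\<^sup>+z\<in>Qbox \<theta> l. ennreal (v z * ((1 - cmod z) / l) powr (- a)) \<partial>disc_measure)"
    by (rule nn_integral_cmult) measurable
  also have "\<dots> \<le> ennreal ((K * Y) powr (e / 2)) * (ennreal (2 powr a / (1 - 2 powr a * \<kappa>)) * ennreal V)"
    unfolding V(1)[symmetric]
    by (intro mult_left_mono strip_decay_imp_weighted_mass decay[unfolded strip_decay_def, rule_format]) (use nn \<kappa> l a in auto)
  also have "\<dots> = ennreal ((K * Y) powr (e / 2) * (2 powr a / (1 - 2 powr a * \<kappa>)) * V)"
    using V(2) a by (simp only: ennreal_mult'[OF powr_ge_zero, symmetric] ennreal_mult''[symmetric] mult.assoc)
  finally show ?thesis .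
qed

lemma weighted_disc_mass:
  fixes v :: "complex \<Rightarrow> real"
  assumes [measurable]: "v \<in> borel_measurable disc_measure" and nn: "\<And>z. v z \<ge> 0"
    and decay: "strip_decay \<kappa> v"
    and \<kappa>: "\<kappa> \<ge> 0" and a: "a \<ge> 0" "2 powr a * \<kappa> < 1" and e: "e > 0" "N > 0" "e / real N + \<eta> \<le> a"
    and K: "K > 0" "\<And>z. z \<in> unit_disc \<Longrightarrow> 1 / u z \<le> K * (1 - cmod z) powr (- 2 / real N)"
    and V: "\<And>\<theta>. disc_mass v (Qbox \<theta> 1) < \<infinity>"
  shows "(\<integral>\<^sup>+z. ennreal (v z * u z powr (- e / 2) * (1 - cmod z) powr (- \<eta>)) \<partial>disc_measure) < \<infinity>"
proof -
  let ?g = "\<lambda>z. v z * u z powr (- e / 2) * (1 - cmod z) powr (- \<eta>)"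
  have "(\<integral>\<^sup>+z\<in>Qbox \<theta> 1. ennreal (?g z) \<partial>disc_measure) < \<infinity>" for \<theta>
  proof -
    define V0 where "V0 = enn2real (disc_mass v (Qbox \<theta> 1))"
    have V0: "disc_mass v (Qbox \<theta> 1) = ennreal V0" "V0 \<ge> 0"
      using V[of \<theta>] by (auto simp: V0_def)
    have K1: "1 / u z \<le> K * ((1 - cmod z) / 1) powr (- 2 / real N) * 1" if "z \<in> Qbox \<theta> 1" for z
    proof -
      have "z \<in> unit_disc" using that Qbox_subset_disc by blast
      from K(2)[OF this] show ?thesis by simp
    qed
    from weighted_box_mass[OF assms(1) nn decay \<kappa> a e zero_less_one order_refl K(1) zero_less_one K1 V0]
    have "(\<integral>\<^sup>+z\<in>Qbox \<theta> 1. ennreal (?g z) \<partial>disc_measure) \<le> ennreal ((K * 1) powr (e / 2) * (2 powr a / (1 - 2 powr a * \<kappa>)) * V0)"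
      by simp
    then show ?thesis
      using le_less_trans[OF _ ennreal_less_top] by simp
  qed
  then show ?thesis by (rule nn_integral_disc_finite[rotated]) measurable
qed

text \<open>Without the factors involving \<eta> the box condition would be the Bekolle condition
  for \<omega>. It results from rewriting \<omega> and its dual as \<open>v\<close> and
  \<open>v'\<close> times negative powers of \<open>u\<close> and applying the weighted mass bound
  to each. The two integrals over the whole disc cover the scales above 1/2.\<close>

lemma improved_Bekolle:
  fixes \<tau> :: "complex \<Rightarrow> real"
  assumes p: "p > 1" and \<tau>m[measurable]: "\<tau> \<in> borel_measurable disc_measure" and \<tau>: "\<And>z. \<tau> z > 0" and C0: "C0 > 0"
    and box: "Ap_boxes u p C0 (\<lambda>z. u z * \<tau> z) (\<lambda>z. u z * \<tau> z powr (- 1 / (p - 1)))"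
  obtains \<eta> C A where "\<eta> > 0" "C > 0" "A \<ge> 0"
    "\<And>\<theta> l. 0 < l \<Longrightarrow> l \<le> 1/2 \<Longrightarrow> \<exists>a b. 0 \<le> a \<and> 0 \<le> b \<and>
       (\<integral>\<^sup>+z\<in>Qbox \<theta> l. ennreal ((\<tau> z * u z powr (1 - p/2)) powr (- 1 / (p - 1)) * ((1 - cmod z) / l) powr (- \<eta>)) \<partial>disc_measure) \<le> ennreal a \<and>
       (\<integral>\<^sup>+z\<in>Qbox \<theta> l. ennreal (\<tau> z * u z powr (1 - p/2) * ((1 - cmod z) / l) powr (- \<eta>)) \<partial>disc_measure) \<le> ennreal b \<and>
       b * a powr (p - 1) \<le> C * (l\<^sup>2) powr p"
    "(\<integral>\<^sup>+z. ennreal ((\<tau> z * u z powr (1 - p/2)) powr (- 1 / (p - 1)) * (1 - cmod z) powr (- \<eta>)) \<partial>disc_measure) \<le> ennreal A"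
    "(\<integral>\<^sup>+z. ennreal (\<tau> z * u z powr (1 - p/2) * (1 - cmod z) powr (- \<eta>)) \<partial>disc_measure) \<le> ennreal A"
proof -
  define q where "q = p / (p - 1)"
  have q: "q > 1" "p = q / (q - 1)" "q - 1 = 1 / (p - 1)" using p by (auto simp: q_def field_simps)
  have pq0: "p > 0" "q > 0" using p q(1) by auto
  define v where "v z = u z * \<tau> z" for z
  define v' where "v' z = u z * \<tau> z powr (- 1 / (p - 1))" for z
  have vm[measurable]: "v \<in> borel_measurable disc_measure" "v' \<in> borel_measurable disc_measure"
    unfolding v_def v'_def by measurable
  have vnn: "v z \<ge> 0" "v' z \<ge> 0" for z
    using u_nonneg[of z] \<tau>[of z] by (auto simp: v_def v'_def)
  have e1: "- 1 / (p - 1) * (1 / q) = - 1 / p" and pq: "1/p + 1/q = 1"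
    using p by (auto simp: q_def field_simps)
  have m: "u z = v z powr (1/p) * v' z powr (1/q)" if "z \<in> unit_disc" for z
  proof -
    have "v z powr (1/p) * v' z powr (1/q) = (u z powr (1/p) * u z powr (1/q)) * (\<tau> z powr (1/p) * \<tau> z powr (- 1 / (p - 1) * (1 / q)))"
      using u_pos[OF that] \<tau>[of z] unfolding v_def v'_def by (simp add: powr_mult powr_powr)
    also have "\<dots> = u z"
      unfolding e1 powr_add[symmetric] pq using u_pos[OF that] \<tau>[of z] by simp
    finally show ?thesis by simp
  qed
  have box1: "Ap_boxes u p C0 v v'"
    using box unfolding v_def[abs_def] v'_def[abs_def] .
  \<comment> \<open>Duality: raising the A_p inequality to the power \<open>q - 1\<close>
    interchanges the roles of \<open>v\<close> and \<open>v'\<close>, because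
    \<open>(p - 1) * (q - 1) = 1\<close>.\<close>
  have box2: "Ap_boxes u q (C0 powr (q - 1)) v' v"
    unfolding Ap_boxes_def
  proof (intro allI impI)
    fix \<theta> l assume l: "0 < l" "l \<le> (1::real)"
    obtain V V' \<mu> where b: "V > 0" "V' > 0" "\<mu> > 0"
      "disc_mass v (Qbox \<theta> l) = ennreal V" "disc_mass v' (Qbox \<theta> l) = ennreal V'"
      "disc_mass u (Qbox \<theta> l) = ennreal \<mu>" "V * V' powr (p - 1) \<le> C0 * \<mu> powr p"
      by (rule Ap_boxesE[OF box1 l])
    have "(V * V' powr (p - 1)) powr (q - 1) \<le> (C0 * \<mu> powr p) powr (q - 1)"
      using b(1,7) q(1) by (intro powr_mono2) auto
    moreover have "(p - 1) * (q - 1) = 1" "p * (q - 1) = q"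
      using p by (auto simp: q_def field_simps)
    ultimately have "V powr (q - 1) * V' \<le> C0 powr (q - 1) * \<mu> powr q"
      using b(1-3) C0 by (simp add: powr_mult powr_powr)
    then have "V' * V powr (q - 1) \<le> C0 powr (q - 1) * \<mu> powr q"
      by (simp only: mult.commute)
    then show "\<exists>V V' \<mu>. V > 0 \<and> V' > 0 \<and> \<mu> > 0 \<and>
      disc_mass v' (Qbox \<theta> l) = ennreal V \<and> disc_mass v (Qbox \<theta> l) = ennreal V' \<and>
      disc_mass u (Qbox \<theta> l) = ennreal \<mu> \<and> V * V' powr (q - 1) \<le> C0 powr (q - 1) * \<mu> powr q"
      using b(1-6) by blast
  qed
  obtain \<kappa>1 where \<kappa>1: "0 \<le> \<kappa>1" "\<kappa>1 < 1" "strip_decay \<kappa>1 v"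
    by (rule Ap_boxes_strip_decay[OF box1 p q_def vm vnn m C0]) blast+
  have m': "u z = v' z powr (1/q) * v z powr (1/p)" if "z \<in> unit_disc" for z
    using m[OF that] by (simp only: mult.commute)
  have C0': "C0 powr (q - 1) > 0" using C0 by simp
  obtain \<kappa>2 where \<kappa>2: "0 \<le> \<kappa>2" "\<kappa>2 < 1" "strip_decay \<kappa>2 v'"
    by (rule Ap_boxes_strip_decay[OF box2 q(1,2) vm(2,1) vnn(2,1) m' C0']) blast+
  define \<kappa> where "\<kappa> = max \<kappa>1 \<kappa>2"
  have \<kappa>: "0 \<le> \<kappa>" "\<kappa> < 1" using \<kappa>1 \<kappa>2 by (auto simp: \<kappa>_def)
  have dec1: "strip_decay \<kappa> v" and dec2: "strip_decay \<kappa> v'"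
    using \<kappa>1 \<kappa>2 by (auto intro: strip_decay_mono simp: \<kappa>_def)
  \<comment> \<open>Chosen so that \<open>2 powr a * \<kappa>\<close> equals
    \<open>2 * \<kappa> / (1 + \<kappa>)\<close>, which is below 1 exactly because \<kappa>
    is.\<close>
  define a where "a = log 2 (2 / (1 + \<kappa>))"
  have a2: "2 powr a = 2 / (1 + \<kappa>)" using \<kappa> by (simp add: a_def)
  have a: "a > 0" "2 powr a * \<kappa> < 1" using \<kappa> by (auto simp: a_def a2)
  define S where "S = 2 powr a / (1 - 2 powr a * \<kappa>)"
  have S: "S > 0" using a by (simp add: S_def)
  \<comment> \<open>With this \<open>N\<close> both \<open>p / real N\<close> and
    \<open>q / real N\<close> are at most \<open>a/2\<close>: half of the gain pays for the negative
    powers of \<open>u\<close>, and the other half is left as \<eta>.\<close>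
  obtain N :: nat where N0: "2 * max p q / a < real N" using reals_Archimedean2 by blast
  have "2 * max p q / a > 0" using p a by simp
  then have N: "N > 0" using N0 by (cases N) auto
  have "2 * max p q < a * real N" using N0 a by (simp add: field_simps)
  then have "p / real N + a/2 \<le> a" "q / real N + a/2 \<le> a"
    using N by (auto simp: field_simps)
  note eN = this
  obtain K where K: "K > 0" "\<And>\<theta> l z \<mu>. 0 < l \<Longrightarrow> l \<le> 1/2 \<Longrightarrow> z \<in> Qbox \<theta> l \<Longrightarrow> disc_mass u (Qbox \<theta> l) = ennreal \<mu> \<Longrightarrow> \<mu> > 0 \<Longrightarrow>
       1 / u z \<le> K * ((1 - cmod z) / l) powr (- 2 / real N) * (l\<^sup>2 / \<mu>)"
    by (rule inverse_u_le_box[OF N]) blast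
  obtain K' where K': "K' > 0" "\<And>z. z \<in> unit_disc \<Longrightarrow> 1 / u z \<le> K' * (1 - cmod z) powr (- 2 / real N)"
    by (rule inverse_u_le_disc[OF N]) blast
  have w1: "\<tau> z * u z powr (1 - p/2) = v z * u z powr (- p / 2)" if "z \<in> unit_disc" for z
  proof -
    have "u z powr (1 - p/2) = u z powr 1 * u z powr (- p / 2)"
      unfolding powr_add[symmetric] by simp
    then show ?thesis
      using u_pos[OF that] by (simp add: v_def)
  qed
  have e2: "(1 - p/2) * (- 1 / (p - 1)) = 1 + - q / 2"
    using p by (simp add: q_def field_simps)
  have w2: "(\<tau> z * u z powr (1 - p/2)) powr (- 1 / (p - 1)) = v' z * u z powr (- q / 2)" if "z \<in> unit_disc" for z
  proof -
    have "(\<tau> z * u z powr (1 - p/2)) powr (- 1 / (p - 1)) = \<tau> z powr (- 1 / (p - 1)) * u z powr ((1 - p/2) * (- 1 / (p - 1)))"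
      using \<tau>[of z] by (subst powr_mult) (auto simp only: powr_powr)
    also have "\<dots> = \<tau> z powr (- 1 / (p - 1)) * (u z powr 1 * u z powr (- q / 2))"
      unfolding e2 powr_add ..
    finally show ?thesis
      using u_pos[OF that] by (simp add: v'_def)
  qed
  let ?A1 = "\<integral>\<^sup>+z. ennreal (v' z * u z powr (- q / 2) * (1 - cmod z) powr (- (a/2))) \<partial>disc_measure"
  let ?A2 = "\<integral>\<^sup>+z. ennreal (v z * u z powr (- p / 2) * (1 - cmod z) powr (- (a/2))) \<partial>disc_measure"
  have Vfin: "disc_mass v (Qbox \<theta> 1) < \<infinity>" "disc_mass v' (Qbox \<theta> 1) < \<infinity>" for \<theta>
    by (rule Ap_boxesE[OF box1 zero_less_one order_refl, of \<theta>], simp)+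
  have fin1: "?A1 < \<infinity>"
    by (rule weighted_disc_mass[OF vm(2) vnn(2) dec2 \<kappa>(1) less_imp_le[OF a(1)] a(2) pq0(2) N eN(2) K' Vfin(2)])
  have fin2: "?A2 < \<infinity>"
    by (rule weighted_disc_mass[OF vm(1) vnn(1) dec1 \<kappa>(1) less_imp_le[OF a(1)] a(2) pq0(1) N eN(1) K' Vfin(1)])
  define A where "A = max (enn2real ?A1) (enn2real ?A2)"
  have A0: "A \<ge> 0" by (simp add: A_def le_max_iff_disj)
  have "X \<le> ennreal A" if "X < \<infinity>" "enn2real X \<le> A" for X
    using that ennreal_leI[OF that(2)] by simp
  then have AA: "?A1 \<le> ennreal A" "?A2 \<le> ennreal A"
    using fin1 fin2 by (simp_all add: A_def)
  show ?thesis
  proof (rule that[of "a/2" "K powr p * S powr p * C0" A])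
    show "a / 2 > 0" "K powr p * S powr p * C0 > 0" "A \<ge> 0" using a(1) K(1) S C0 A0 by auto
    have "(\<integral>\<^sup>+z. ennreal ((\<tau> z * u z powr (1 - p/2)) powr (- 1 / (p - 1)) * (1 - cmod z) powr (- (a/2))) \<partial>disc_measure) = ?A1"
      by (rule nn_integral_cong) (simp only: space_restrict_space w2 Int_iff space_completion space_lborel UNIV_I)
    then show "(\<integral>\<^sup>+z. ennreal ((\<tau> z * u z powr (1 - p/2)) powr (- 1 / (p - 1)) * (1 - cmod z) powr (- (a/2))) \<partial>disc_measure) \<le> ennreal A"
      using AA by simp
    have "(\<integral>\<^sup>+z. ennreal (\<tau> z * u z powr (1 - p/2) * (1 - cmod z) powr (- (a/2))) \<partial>disc_measure) = ?A2"
      by (rule nn_integral_cong) (simp only: space_restrict_space w1 Int_iff space_completion space_lborel UNIV_I)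
    then show "(\<integral>\<^sup>+z. ennreal (\<tau> z * u z powr (1 - p/2) * (1 - cmod z) powr (- (a/2))) \<partial>disc_measure) \<le> ennreal A"
      using AA by simp
    fix \<theta> l :: real assume l: "0 < l" "l \<le> 1/2"
    then have l1: "l \<le> 1" by simp
    obtain V V' \<mu> where b: "V > 0" "V' > 0" "\<mu> > 0"
      "disc_mass v (Qbox \<theta> l) = ennreal V"
      "disc_mass v' (Qbox \<theta> l) = ennreal V'"
      "disc_mass u (Qbox \<theta> l) = ennreal \<mu>" "V * V' powr (p - 1) \<le> C0 * \<mu> powr p"
      by (rule Ap_boxesE[OF box1 l(1) l1])
    have Y: "l\<^sup>2 / \<mu> > 0" using l b by simp
    define x where "x = K * (l\<^sup>2 / \<mu>)"
    have x: "x > 0" unfolding x_def using K(1) Y by (rule mult_pos_pos)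
    note Kb = K(2)[OF l _ b(6,3)]
    have B1: "(\<integral>\<^sup>+z\<in>Qbox \<theta> l. ennreal (v z * u z powr (- p / 2) * ((1 - cmod z) / l) powr (- (a/2))) \<partial>disc_measure)
        \<le> ennreal (x powr (p / 2) * S * V)"
      unfolding x_def S_def
      by (rule weighted_box_mass[OF vm(1) vnn(1) dec1 \<kappa>(1) less_imp_le[OF a(1)] a(2) pq0(1) N eN(1) l(1) l1 K(1) Y Kb b(4) less_imp_le[OF b(1)]])
    have B2: "(\<integral>\<^sup>+z\<in>Qbox \<theta> l. ennreal (v' z * u z powr (- q / 2) * ((1 - cmod z) / l) powr (- (a/2))) \<partial>disc_measure)
        \<le> ennreal (x powr (q / 2) * S * V')"
      unfolding x_def S_def
      by (rule weighted_box_mass[OF vm(2) vnn(2) dec2 \<kappa>(1) less_imp_le[OF a(1)] a(2) pq0(2) N eN(2) l(1) l1 K(1) Y Kb b(5) less_imp_le[OF b(2)]])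
    have "(\<integral>\<^sup>+z\<in>Qbox \<theta> l. ennreal ((\<tau> z * u z powr (1 - p/2)) powr (- 1 / (p - 1)) * ((1 - cmod z) / l) powr (- (a/2))) \<partial>disc_measure)
       = (\<integral>\<^sup>+z\<in>Qbox \<theta> l. ennreal (v' z * u z powr (- q / 2) * ((1 - cmod z) / l) powr (- (a/2))) \<partial>disc_measure)"
      by (rule nn_integral_cong) (simp only: space_restrict_space w2 Int_iff space_completion space_lborel UNIV_I)
    moreover have "(\<integral>\<^sup>+z\<in>Qbox \<theta> l. ennreal (\<tau> z * u z powr (1 - p/2) * ((1 - cmod z) / l) powr (- (a/2))) \<partial>disc_measure)
       = (\<integral>\<^sup>+z\<in>Qbox \<theta> l. ennreal (v z * u z powr (- p / 2) * ((1 - cmod z) / l) powr (- (a/2))) \<partial>disc_measure)"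
      by (rule nn_integral_cong) (simp only: space_restrict_space w1 Int_iff space_completion space_lborel UNIV_I)
    moreover have "x powr (p / 2) * S * V * (x powr (q / 2) * S * V') powr (p - 1) \<le> K powr p * S powr p * C0 * (l\<^sup>2) powr p"
    proof -
      \<comment> \<open>The identity that makes \<open>x\<close> appear to the power
        \<open>p\<close>, so that the \<open>\<mu> powr p\<close> in its denominator cancels the one
        from the A_p inequality.\<close>
      have e3: "p / 2 + q / 2 * (p - 1) = p" using p by (simp add: q_def field_simps)
      have Sp: "S * S powr (p - 1) = S powr p" using S by (simp add: powr_diff)
      have "x powr (p / 2) * S * V * (x powr (q / 2) * S * V') powr (p - 1)
         = (x powr (p/2) * x powr (q / 2 * (p - 1))) * (S * S powr (p - 1)) * (V * V' powr (p - 1))"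
        using x S b(1,2) by (simp add: powr_mult powr_powr)
      also have "\<dots> = x powr p * S powr p * (V * V' powr (p - 1))"
        unfolding powr_add[symmetric] e3 Sp ..
      also have "\<dots> \<le> x powr p * S powr p * (C0 * \<mu> powr p)"
        using b(7) by (intro mult_left_mono) auto
      also have "\<dots> = K powr p * S powr p * C0 * (l\<^sup>2) powr p"
        using K(1) b(3) l(1) by (simp add: x_def powr_mult powr_divide)
      finally show ?thesis .
    qed
    ultimately show "\<exists>a' b. 0 \<le> a' \<and> 0 \<le> b \<and>
       (\<integral>\<^sup>+z\<in>Qbox \<theta> l. ennreal ((\<tau> z * u z powr (1 - p/2)) powr (- 1 / (p - 1)) * ((1 - cmod z) / l) powr (- (a/2))) \<partial>disc_measure) \<le> ennreal a' \<and>
       (\<integral>\<^sup>+z\<in>Qbox \<theta> l. ennreal (\<tau> z * u z powr (1 - p/2) * ((1 - cmod z) / l) powr (- (a/2))) \<partial>disc_measure) \<le> ennreal b \<and>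
       b * a' powr (p - 1) \<le> K powr p * S powr p * C0 * (l\<^sup>2) powr p"
      using B1 B2 S b(1,2) by (intro exI[of _ "x powr (q / 2) * S * V'"] exI[of _ "x powr (p / 2) * S * V"]) auto
  qed
qed

lemma nn_integral_image_box:
  assumes g[measurable]: "g \<in> borel_measurable (lebesgue_on (\<psi> ` unit_disc))" and Q: "Q \<in> sets lebesgue" "Q \<subseteq> unit_disc"
  shows "(\<integral>\<^sup>+w. g w \<partial>lebesgue_on (\<psi> ` Q)) = (\<integral>\<^sup>+z\<in>Q. ennreal (u z) * g (\<psi> z) \<partial>disc_measure)"
proof -
  have V: "open (\<psi> ` unit_disc)" using hol inj open_mapping_thm3 by blast
  have S: "\<psi> ` Q \<in> sets lebesgue" "\<psi> ` Q \<subseteq> \<psi> ` unit_disc"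
    using emeasure_conformal_image(1)[OF Q open_ball hol inj_on_subset[OF inj Q(2)]] Q by auto
  then have [measurable]: "\<psi> ` Q \<in> sets (lebesgue_on (\<psi> ` unit_disc))"
    using V by (simp add: sets_restrict_space_iff)
  have "(\<integral>\<^sup>+w. g w \<partial>lebesgue_on (\<psi> ` Q)) = (\<integral>\<^sup>+w. g w * indicator (\<psi> ` Q) w \<partial>lebesgue_on (\<psi> ` unit_disc))"
    using V by (intro nn_integral_lebesgue_on_subset S) auto
  also have "\<dots> = (\<integral>\<^sup>+z. ennreal (u z) * (g (\<psi> z) * indicator (\<psi> ` Q) (\<psi> z)) \<partial>disc_measure)"
    unfolding u_def by (rule nn_integral_conformal[OF open_ball hol inj]) measurable
  also have "\<dots> = (\<integral>\<^sup>+z\<in>Q. ennreal (u z) * g (\<psi> z) \<partial>disc_measure)"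
  proof (rule nn_integral_cong)
    fix z assume "z \<in> space disc_measure"
    then have "z \<in> unit_disc" by (simp add: space_restrict_space)
    then have "\<psi> z \<in> \<psi> ` Q \<longleftrightarrow> z \<in> Q" by (rule inj_on_image_mem_iff[OF inj _ Q(2)])
    then show "ennreal (u z) * (g (\<psi> z) * indicator (\<psi> ` Q) (\<psi> z)) = ennreal (u z) * g (\<psi> z) * indicator Q z"
      by (simp add: indicator_def)
  qed
  finally show ?thesis .
qed

text \<open>The Schur test is run on the sublevel sets \<open>E k\<close> of |1 - cnj z * w|, on
  which the kernel is replaced by \<open>4 ^ k\<close>. For fine scales a box around
  \<open>w\<close> contains all points within two steps of \<open>w\<close>; the remaining scales
  use the bounds on the whole disc.\<close>

lemma Bekolle_disc_bound:
  fixes \<tau> :: "complex \<Rightarrow> real"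
  assumes p: "p > 1" and \<tau>m[measurable]: "\<tau> \<in> borel_measurable disc_measure" and \<tau>: "\<And>z. \<tau> z > 0" and C0: "C0 > 0"
    and box: "Ap_boxes u p C0 (\<lambda>z. u z * \<tau> z) (\<lambda>z. u z * \<tau> z powr (- 1 / (p - 1)))"
  obtains C where "\<And>F G. F \<in> borel_measurable disc_measure \<Longrightarrow> (\<And>z. F z \<ge> 0) \<Longrightarrow> (\<And>z. G z \<ge> 0) \<Longrightarrow>
    (\<And>z. z \<in> unit_disc \<Longrightarrow> ennreal (G z) \<le> (\<integral>\<^sup>+w. ennreal (F w / (cmod (1 - cnj z * w))\<^sup>2) \<partial>disc_measure)) \<Longrightarrow>
    (\<integral>\<^sup>+z. ennreal (G z powr p * (\<tau> z * u z powr (1 - p/2))) \<partial>disc_measure)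
      \<le> ennreal C * (\<integral>\<^sup>+z. ennreal (F z powr p * (\<tau> z * u z powr (1 - p/2))) \<partial>disc_measure)"
proof -
  define \<omega>0 where "\<omega>0 z = \<tau> z * u z powr (1 - p/2)" for z
  obtain \<eta> C A where \<eta>: "\<eta> > 0" and C: "C > 0" and A: "A \<ge> 0"
    and near: "\<And>\<theta> l. 0 < l \<Longrightarrow> l \<le> 1/2 \<Longrightarrow> \<exists>a b. 0 \<le> a \<and> 0 \<le> b \<and>
       (\<integral>\<^sup>+z\<in>Qbox \<theta> l. ennreal (\<omega>0 z powr (- 1 / (p - 1)) * ((1 - cmod z) / l) powr (- \<eta>)) \<partial>disc_measure) \<le> ennreal a \<and>
       (\<integral>\<^sup>+z\<in>Qbox \<theta> l. ennreal (\<omega>0 z * ((1 - cmod z) / l) powr (- \<eta>)) \<partial>disc_measure) \<le> ennreal b \<and>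
       b * a powr (p - 1) \<le> C * (l\<^sup>2) powr p"
    and far: "(\<integral>\<^sup>+z. ennreal (\<omega>0 z powr (- 1 / (p - 1)) * (1 - cmod z) powr (- \<eta>)) \<partial>disc_measure) \<le> ennreal A"
      "(\<integral>\<^sup>+z. ennreal (\<omega>0 z * (1 - cmod z) powr (- \<eta>)) \<partial>disc_measure) \<le> ennreal A"
    unfolding \<omega>0_def by (rule improved_Bekolle[OF p \<tau>m \<tau> C0 box]) blast+
  \<comment> \<open>The value 1 outside the disc makes the weight positive everywhere, as the Schur
    test demands; \<open>d\<close> is extended for the same reason.\<close>
  define \<omega> where "\<omega> z = (if z \<in> unit_disc then \<omega>0 z else 1)" for z
  \<comment> \<open>The half compensates the threshold \<open>2 / 2 ^ k\<close> in
    \<open>E k\<close>, which starts at 2 because |1 - cnj z * w| can be that large.\<close>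
  define d where "d z = (if z \<in> unit_disc then (1 - cmod z) / 2 else 1)" for z :: complex
  define E where "E k = {zw \<in> space (disc_measure \<Otimes>\<^sub>M disc_measure). cmod (1 - cnj (fst zw) * snd zw) \<le> 2 / 2 ^ k}" for k :: nat
  have Eiff: "(z, w) \<in> E k \<longleftrightarrow> cmod z < 1 \<and> cmod w < 1 \<and> cmod (1 - cnj z * w) \<le> 2 / 2 ^ k" for z w k
    by (auto simp: E_def space_pair_measure space_restrict_space)
  have idm[measurable]: "(\<lambda>x. x) \<in> disc_measure \<rightarrow>\<^sub>M borel"
    by (simp add: measurable_restrict_space1 measurable_completion)
  have [measurable]: "cnj \<in> borel_measurable borel"
    by (intro borel_measurable_continuous_onI continuous_intros)
  have Em: "E k \<in> sets (disc_measure \<Otimes>\<^sub>M disc_measure)" for k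
    unfolding E_def by measurable
  have \<omega>0m[measurable]: "\<omega>0 \<in> borel_measurable disc_measure"
    unfolding \<omega>0_def by measurable
  have \<omega>m: "\<omega> \<in> borel_measurable disc_measure"
    using \<omega>0m by (rule measurable_cong[THEN iffD1, rotated]) (auto simp: \<omega>_def space_restrict_space)
  have "(\<lambda>z. (1 - cmod z) / 2) \<in> borel_measurable disc_measure" by measurable
  then have dm: "d \<in> borel_measurable disc_measure"
    by (rule measurable_cong[THEN iffD1, rotated]) (auto simp: d_def space_restrict_space)
  have sym: "(w, z) \<in> E k" if "(z, w) \<in> E k" for k z w
  proof -
    have "cmod (1 - cnj w * z) = cmod (cnj (1 - cnj w * z))" by (simp only: complex_mod_cnj)
    also have "cnj (1 - cnj w * z) = 1 - cnj z * w" by (simp add: mult.commute)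
    finally show ?thesis using that by (simp add: Eiff)
  qed
  have small: "2 ^ k * d z \<le> 1" if "(z, w) \<in> E k" for k z w
  proof -
    have z: "cmod z < 1" "cmod w < 1" "cmod (1 - cnj z * w) \<le> 2 / 2 ^ k" using that by (auto simp: Eiff)
    then have "1 - cmod z \<le> 2 / 2 ^ k" using one_minus_norm_le(1)[OF z(1,2)] by linarith
    then show ?thesis using z(1) by (simp add: d_def field_simps)
  qed
  have \<omega>pos: "\<omega> z > 0" for z
    using u_pos[of z] \<tau>[of z] by (auto simp: \<omega>_def \<omega>0_def)
  have \<omega>0pos: "\<omega> z = \<omega>0 z \<and> 0 \<le> \<omega>0 z" if "z \<in> unit_disc" for z
    using that \<omega>pos[of z] by (auto simp: \<omega>_def)
  have dpos: "d z > 0" for z by (auto simp: d_def)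
  define B where "B = 2 powr \<eta> * A"
  have B: "B \<ge> 0" using A by (simp add: B_def)
  \<comment> \<open>The first term serves the fine scales and the second the coarse ones; adding 1
    gives room in both estimates.\<close>
  define CC where "CC = C * 1024 powr p + 1024 powr p * B * B powr (p - 1) + 1"
  have CC: "CC > 0" using C B by (auto simp: CC_def intro!: add_nonneg_pos)
  have cond: "\<exists>a b. 0 \<le> a \<and> 0 \<le> b \<and>
      (\<forall>z. (w, z) \<in> E k \<longrightarrow>
        (\<integral>\<^sup>+x. ennreal (\<omega> x powr (- 1 / (p - 1)) * (2 ^ k * d x) powr (- \<eta>)) * indicator (E k) (z, x) \<partial>disc_measure) \<le> ennreal a) \<and>
      (\<integral>\<^sup>+z. ennreal (\<omega> z * (2 ^ k * d z) powr (- \<eta>)) * indicator (E k) (w, z) \<partial>disc_measure) \<le> ennreal b \<and>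
      (4 ^ k) powr p * b * a powr (p - 1) \<le> CC" if w: "w \<in> space disc_measure" for k w
  proof (cases "k \<ge> 6")
    case True
    \<comment> \<open>A step in \<open>E k\<close> has length at most \<open>l/16\<close>, so two
      steps stay within the \<open>l/8\<close> allowed by \<open>near_in_Qbox\<close>. The
      requirement \<open>l \<le> 1/2\<close> means \<open>2 ^ k \<ge> 64\<close>, hence the split at
      6.\<close>
    define l :: real where "l = 32 / 2 ^ k"
    have "(2::real) ^ 6 \<le> 2 ^ k" using True by (intro power_increasing) auto
    then have l: "0 < l" "l \<le> 1/2" by (auto simp: l_def field_simps)
    have l16: "2 / 2 ^ k = l / 16" by (simp add: l_def)
    obtain a b where ab: "0 \<le> a" "0 \<le> b"
      "(\<integral>\<^sup>+z\<in>Qbox (Arg w) l. ennreal (\<omega>0 z powr (- 1 / (p - 1)) * ((1 - cmod z) / l) powr (- \<eta>)) \<partial>disc_measure) \<le> ennreal a"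
      "(\<integral>\<^sup>+z\<in>Qbox (Arg w) l. ennreal (\<omega>0 z * ((1 - cmod z) / l) powr (- \<eta>)) \<partial>disc_measure) \<le> ennreal b"
      "b * a powr (p - 1) \<le> C * (l\<^sup>2) powr p"
      using near[OF l, of "Arg w"] by blast
    have t: "(2 ^ k * d x) powr (- \<eta>) \<le> ((1 - cmod x) / l) powr (- \<eta>)" if "cmod x < 1" for x
    proof -
      have "(1 - cmod x) / l \<le> 2 ^ k * d x"
        using that by (simp add: d_def l_def field_simps)
      then show ?thesis
        using that l \<eta> by (intro powr_mono2') auto
    qed
    \<comment> \<open>Two steps are needed since the dual integral is taken around a neighbour
      \<open>z\<close> of \<open>w\<close>, while both integrals must be over the same box to be
      multiplied.\<close>
    have in2: "x \<in> Qbox (Arg w) l" if "(w, z) \<in> E k" "(z, x) \<in> E k" for x z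
    proof -
      have 1: "cmod w < 1" "cmod z < 1" "cmod (1 - cnj w * z) \<le> l / 16"
        and 2: "cmod x < 1" "cmod (1 - cnj z * x) \<le> l / 16"
        using that by (auto simp: Eiff l16)
      have "cmod (x - w) \<le> cmod (z - x) + cmod (w - z)"
        using norm_triangle_ineq[of "z - x" "w - z"] by (simp add: norm_minus_commute)
      then show ?thesis
        using 1 2 one_minus_norm_le[OF 1(1,2)] one_minus_norm_le[OF 1(2) 2(1)] l
        by (intro near_in_Qbox) linarith+
    qed
    have in1: "x \<in> Qbox (Arg w) l" if "(w, x) \<in> E k" for x
    proof -
      have 1: "cmod w < 1" "cmod x < 1" "cmod (1 - cnj w * x) \<le> l / 16"
        using that by (auto simp: Eiff l16)
      have "cmod (x - w) = cmod (w - x)" by (rule norm_minus_commute)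
      then show ?thesis
        using 1 one_minus_norm_le[OF 1(1,2)] l
        by (intro near_in_Qbox) linarith+
    qed
    have gen: "(\<integral>\<^sup>+x. ennreal (f x * (2 ^ k * d x) powr (- \<eta>)) * indicator (E k) (z, x) \<partial>disc_measure)
        \<le> (\<integral>\<^sup>+x\<in>Qbox (Arg w) l. ennreal (f0 x * ((1 - cmod x) / l) powr (- \<eta>)) \<partial>disc_measure)"
      if f: "\<And>x. x \<in> unit_disc \<Longrightarrow> f x = f0 x \<and> f0 x \<ge> 0" and E: "\<And>x. (z, x) \<in> E k \<Longrightarrow> x \<in> Qbox (Arg w) l" for f f0 z
    proof (rule nn_integral_mono)
      fix x
      show "ennreal (f x * (2 ^ k * d x) powr (- \<eta>)) * indicator (E k) (z, x)
        \<le> ennreal (f0 x * ((1 - cmod x) / l) powr (- \<eta>)) * indicator (Qbox (Arg w) l) x"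
      proof (cases "(z, x) \<in> E k")
        case True
        then have x: "cmod x < 1" "x \<in> Qbox (Arg w) l" using E by (auto simp: Eiff)
        then have "f x * (2 ^ k * d x) powr (- \<eta>) \<le> f0 x * ((1 - cmod x) / l) powr (- \<eta>)"
          using f[of x] t[OF x(1)] by (simp add: mult_left_mono)
        then show ?thesis
          using x True by (simp add: ennreal_leI)
      qed simp
    qed
    have a1: "(\<integral>\<^sup>+x. ennreal (\<omega> x powr (- 1 / (p - 1)) * (2 ^ k * d x) powr (- \<eta>)) * indicator (E k) (z, x) \<partial>disc_measure) \<le> ennreal a"
      if "(w, z) \<in> E k" for z
      by (rule order_trans[OF gen ab(3)]) (use in2[OF that] in \<open>auto simp: \<omega>_def\<close>)
    have b1: "(\<integral>\<^sup>+x. ennreal (\<omega> x * (2 ^ k * d x) powr (- \<eta>)) * indicator (E k) (w, x) \<partial>disc_measure) \<le> ennreal b"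
      by (rule order_trans[OF gen ab(4)]) (use in1 \<omega>0pos in auto)
    have "(4 ^ k) powr p * b * a powr (p - 1) = (4 ^ k) powr p * (b * a powr (p - 1))" by simp
    also have "\<dots> \<le> (4 ^ k) powr p * (C * (l\<^sup>2) powr p)"
      by (intro mult_left_mono ab(5)) auto
    also have "\<dots> = C * (4 ^ k * l\<^sup>2) powr p"
      by (simp add: powr_mult)
    \<comment> \<open>1024 is the square of 32: the kernel size compensates the area of the box at
      every scale.\<close>
    also have "4 ^ k * l\<^sup>2 = 1024"
    proof -
      have "(4::real) ^ k = (2 ^ k)\<^sup>2"
        by (metis mult.commute num_double numeral_times_numeral power2_eq_square power_mult_distrib)
      then show ?thesis by (simp add: l_def power_divide)
    qed
    also have "C * 1024 powr p \<le> CC" using B by (simp add: CC_def)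
    finally show ?thesis using ab(1,2) a1 b1 by blast
  next
    case False
    \<comment> \<open>At coarse scales the factor \<open>2 ^ k\<close> is simply dropped; the
      halving in \<open>d\<close> accounts for \<open>2 powr \<eta>\<close>.\<close>
    have t: "(2 ^ k * d x) powr (- \<eta>) \<le> 2 powr \<eta> * (1 - cmod x) powr (- \<eta>)" if "cmod x < 1" for x
    proof -
      have "1 * ((1 - cmod x) / 2) \<le> 2 ^ k * ((1 - cmod x) / 2)"
        using that by (intro mult_right_mono) auto
      then have "(1 - cmod x) / 2 \<le> 2 ^ k * d x"
        using that by (simp only: d_def mem_ball_0 if_True mult_1)
      then have "(2 ^ k * d x) powr (- \<eta>) \<le> ((1 - cmod x) / 2) powr (- \<eta>)"
        using that \<eta> by (intro powr_mono2') auto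
      also have "\<dots> = 2 powr \<eta> * (1 - cmod x) powr (- \<eta>)"
        using that by (simp add: powr_divide powr_minus field_simps)
      finally show ?thesis .
    qed
    have gen: "(\<integral>\<^sup>+x. ennreal (f x * (2 ^ k * d x) powr (- \<eta>)) * indicator (E k) (z, x) \<partial>disc_measure) \<le> ennreal B"
      if f: "\<And>x. x \<in> unit_disc \<Longrightarrow> f x = f0 x \<and> f0 x \<ge> 0" "f0 \<in> borel_measurable disc_measure"
        "(\<integral>\<^sup>+x. ennreal (f0 x * (1 - cmod x) powr (- \<eta>)) \<partial>disc_measure) \<le> ennreal A" for f f0 z
    proof -
      note [measurable] = f(2)
      have "(\<integral>\<^sup>+x. ennreal (f x * (2 ^ k * d x) powr (- \<eta>)) * indicator (E k) (z, x) \<partial>disc_measure)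
        \<le> (\<integral>\<^sup>+x. ennreal (2 powr \<eta>) * ennreal (f0 x * (1 - cmod x) powr (- \<eta>)) \<partial>disc_measure)"
      proof (rule nn_integral_mono)
        fix x assume "x \<in> space disc_measure"
        then have x: "x \<in> unit_disc" "cmod x < 1" by (auto simp: space_restrict_space)
        have "f0 x * (2 ^ k * d x) powr (- \<eta>) \<le> f0 x * (2 powr \<eta> * (1 - cmod x) powr (- \<eta>))"
          using f(1)[OF x(1)] by (intro mult_left_mono t x(2)) auto
        also have "\<dots> = 2 powr \<eta> * (f0 x * (1 - cmod x) powr (- \<eta>))" by simp
        finally have "ennreal (f0 x * (2 ^ k * d x) powr (- \<eta>)) \<le> ennreal (2 powr \<eta>) * ennreal (f0 x * (1 - cmod x) powr (- \<eta>))"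
          unfolding ennreal_mult'[OF powr_ge_zero, symmetric] by (rule ennreal_leI)
        then show "ennreal (f x * (2 ^ k * d x) powr (- \<eta>)) * indicator (E k) (z, x) \<le> ennreal (2 powr \<eta>) * ennreal (f0 x * (1 - cmod x) powr (- \<eta>))"
          using f(1)[OF x(1)] by (cases "(z, x) \<in> E k") auto
      qed
      also have "\<dots> = ennreal (2 powr \<eta>) * (\<integral>\<^sup>+x. ennreal (f0 x * (1 - cmod x) powr (- \<eta>)) \<partial>disc_measure)"
        by (rule nn_integral_cmult) measurable
      also have "\<dots> \<le> ennreal (2 powr \<eta>) * ennreal A"
        by (intro mult_left_mono f) auto
      also have "\<dots> = ennreal B"
        unfolding B_def by (rule ennreal_mult'[symmetric]) simp
      finally show ?thesis .
    qed
    have a1: "(\<integral>\<^sup>+x. ennreal (\<omega> x powr (- 1 / (p - 1)) * (2 ^ k * d x) powr (- \<eta>)) * indicator (E k) (z, x) \<partial>disc_measure) \<le> ennreal B" for z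
    proof (rule gen[OF _ _ far(1)])
      show "\<omega> x powr (- 1 / (p - 1)) = \<omega>0 x powr (- 1 / (p - 1)) \<and> 0 \<le> \<omega>0 x powr (- 1 / (p - 1))" if "x \<in> unit_disc" for x
        using that by (simp add: \<omega>_def)
      show "(\<lambda>x. \<omega>0 x powr (- 1 / (p - 1))) \<in> borel_measurable disc_measure" by measurable
    qed
    have b1: "(\<integral>\<^sup>+x. ennreal (\<omega> x * (2 ^ k * d x) powr (- \<eta>)) * indicator (E k) (w, x) \<partial>disc_measure) \<le> ennreal B"
      by (rule gen[OF \<omega>0pos \<omega>0m far(2)])
    have "(4::real) ^ k \<le> 4 ^ 5" using False by (intro power_increasing) auto
    then have "(4 ^ k) powr p \<le> (1024::real) powr p" using p by (intro powr_mono2) auto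
    then have "(4 ^ k) powr p * B * B powr (p - 1) \<le> 1024 powr p * B * B powr (p - 1)"
      using B by (intro mult_right_mono) auto
    also have "\<dots> \<le> CC" using C by (simp add: CC_def)
    finally show ?thesis using B a1 b1 by blast
  qed
  define KK where "KK = (1 / (1 - 2 powr (- \<eta> / (p - 1)))) powr (p - 1) * CC * (1 / (1 - 2 powr (- \<eta> * (p - 1))))"
  have fin: "sigma_finite_measure disc_measure"
    using finite_measure_lebesgue_on[OF lmeasurable_ball] unfolding finite_measure_def by blast
  show ?thesis
  proof (rule that[of KK])
    fix F G :: "complex \<Rightarrow> real"
    assume F[measurable]: "F \<in> borel_measurable disc_measure" and F0: "\<And>z. F z \<ge> 0" and G0: "\<And>z. G z \<ge> 0"
      and FG: "\<And>z. z \<in> unit_disc \<Longrightarrow> ennreal (G z) \<le> (\<integral>\<^sup>+w. ennreal (F w / (cmod (1 - cnj z * w))\<^sup>2) \<partial>disc_measure)"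
    have GE: "ennreal (G z) \<le> (\<Sum>k. ennreal (4 ^ k) * (\<integral>\<^sup>+w. ennreal (F w) * indicator (E k) (z, w) \<partial>disc_measure))"
      if z': "z \<in> space disc_measure" for z
    proof -
      have z: "z \<in> unit_disc" "cmod z < 1" using z' by (auto simp: space_restrict_space)
      note [measurable] = Em
      have "ennreal (G z) \<le> (\<integral>\<^sup>+w. ennreal (F w / (cmod (1 - cnj z * w))\<^sup>2) \<partial>disc_measure)"
        by (rule FG[OF z(1)])
      also have "\<dots> \<le> (\<integral>\<^sup>+w. (\<Sum>k. ennreal (4 ^ k) * (ennreal (F w) * indicator (E k) (z, w))) \<partial>disc_measure)"
      proof (rule nn_integral_mono)
        fix w assume "w \<in> space disc_measure"
        then have w: "cmod w < 1" by (simp add: space_restrict_space)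
        let ?r = "cmod (1 - cnj z * w)"
        have "?r > 0" using one_minus_norm_le(1)[OF z(2) w] z(2) by linarith
        moreover have "?r \<le> 2"
        proof -
          have "cmod (cnj z * w) \<le> 1" using z(2) w by (simp add: norm_mult mult_le_one)
          then show ?thesis using norm_triangle_ineq4[of 1 "cnj z * w"] by simp
        qed
        ultimately obtain k :: nat where k: "?r \<le> 2 / 2 ^ k" "1 / ?r\<^sup>2 \<le> 4 ^ k"
          by (rule dyadic_kernel_bound)
        have "F w / ?r\<^sup>2 \<le> 4 ^ k * F w"
          using mult_right_mono[OF k(2) F0[of w]] by simp
        then have "ennreal (F w / ?r\<^sup>2) \<le> ennreal (4 ^ k * F w)"
          by (rule ennreal_leI)
        also have "\<dots> = ennreal (4 ^ k) * (ennreal (F w) * indicator (E k) (z, w))"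
          using k(1) z w F0[of w] by (simp add: Eiff ennreal_mult)
        also have "\<dots> \<le> (\<Sum>k. ennreal (4 ^ k) * (ennreal (F w) * indicator (E k) (z, w)))"
          using sum_le_suminf[of "\<lambda>k. ennreal (4 ^ k) * (ennreal (F w) * indicator (E k) (z, w))" "{k}"] by simp
        finally show "ennreal (F w / ?r\<^sup>2) \<le> (\<Sum>k. ennreal (4 ^ k) * (ennreal (F w) * indicator (E k) (z, w)))" .
      qed
      also have "\<dots> = (\<Sum>k. \<integral>\<^sup>+w. ennreal (4 ^ k) * (ennreal (F w) * indicator (E k) (z, w)) \<partial>disc_measure)"
        using z' by (intro nn_integral_suminf) measurable
      also have "\<dots> = (\<Sum>k. ennreal (4 ^ k) * (\<integral>\<^sup>+w. ennreal (F w) * indicator (E k) (z, w) \<partial>disc_measure))"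
        using z' by (intro suminf_cong nn_integral_cmult) measurable
      finally show ?thesis .
    qed
    have "(\<integral>\<^sup>+z. ennreal (G z powr p * \<omega> z) \<partial>disc_measure) \<le> ennreal KK * (\<integral>\<^sup>+z. ennreal (F z powr p * \<omega> z) \<partial>disc_measure)"
      unfolding KK_def
      by (rule dyadic_schur_bound[OF fin p \<eta> CC Em dm \<omega>m F sym small dpos \<omega>pos F0 G0 cond GE])
    moreover have "(\<integral>\<^sup>+z. ennreal (H z powr p * \<omega> z) \<partial>disc_measure) = (\<integral>\<^sup>+z. ennreal (H z powr p * (\<tau> z * u z powr (1 - p/2))) \<partial>disc_measure)" for H
      by (rule nn_integral_cong) (simp add: \<omega>_def \<omega>0_def space_restrict_space)
    ultimately show "(\<integral>\<^sup>+z. ennreal (G z powr p * (\<tau> z * u z powr (1 - p/2))) \<partial>disc_measure)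
      \<le> ennreal KK * (\<integral>\<^sup>+z. ennreal (F z powr p * (\<tau> z * u z powr (1 - p/2))) \<partial>disc_measure)"
      by simp
  qed
qed

text \<open>The change of variables turns the hypothesis on \<sigma> into an A_p condition relative
  to \<open>u dA\<close>, and both weighted norms into norms of f(\<psi>) \<psi>' and g(\<psi>)
  \<psi>' with weight \<omega>, between which the pointwise kernel bound holds.\<close>

lemma bergman_bounded_of_Bp_dom:
  assumes p: "p > 1" and \<Omega>: "\<psi> ` unit_disc = \<Omega>" and B: "Bp_dom \<psi> \<Omega> p \<sigma>"
  shows "bergman_bounded \<Omega> p \<sigma>"
proof -
  have V: "open \<Omega>" using hol inj open_mapping_thm3 \<Omega> by blast
  then have \<Omega>s: "\<Omega> \<in> sets lebesgue" by auto
  have \<sigma>m[measurable]: "\<sigma> \<in> borel_measurable (lebesgue_on \<Omega>)" and \<sigma>pos: "AE z in lebesgue. z \<in> \<Omega> \<longrightarrow> \<sigma> z > 0"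
    using B by (auto simp: Bp_dom_def weight_on_def)
  obtain C1 where C1: "\<And>\<theta> l. 0 < l \<Longrightarrow> l \<le> 1 \<Longrightarrow>
      avg 1 (\<lambda>_. 1) (\<psi> ` Qbox \<theta> l) \<sigma> * avg (1 / (p - 1)) (\<lambda>_. 1) (\<psi> ` Qbox \<theta> l) (\<lambda>z. 1 / \<sigma> z) \<le> ennreal C1"
    using B unfolding Bp_dom_def by blast
  \<comment> \<open>A weight is positive only almost everywhere; changing it on a null set gives a
    \<tau> that is positive at every point without affecting any integral.\<close>
  define \<sigma>' where "\<sigma>' z = (if \<sigma> z > 0 then \<sigma> z else 1)" for z
  have \<sigma>'m[measurable]: "\<sigma>' \<in> borel_measurable (lebesgue_on \<Omega>)"
    unfolding \<sigma>'_def by measurable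
  have \<sigma>'pos: "\<sigma>' z > 0" for z by (simp add: \<sigma>'_def)
  have AES: "AE z in lebesgue_on S. \<sigma> z > 0" "AE z in lebesgue_on S. \<sigma> z = \<sigma>' z" if "S \<in> sets lebesgue" "S \<subseteq> \<Omega>" for S
  proof -
    show "AE z in lebesgue_on S. \<sigma> z > 0"
      using \<sigma>pos that by (subst AE_restrict_space_iff) (auto elim!: eventually_mono)
    then show "AE z in lebesgue_on S. \<sigma> z = \<sigma>' z"
      by eventually_elim (simp add: \<sigma>'_def)
  qed
  note \<psi>m[measurable] = measurable_conformal[OF open_ball hol inj, unfolded \<Omega>]
  define \<tau> where "\<tau> z = (if z \<in> unit_disc then \<sigma>' (\<psi> z) else 1)" for z
  have "(\<lambda>z. \<sigma>' (\<psi> z)) \<in> borel_measurable disc_measure" by measurable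
  then have \<tau>m: "\<tau> \<in> borel_measurable disc_measure"
    by (rule measurable_cong[THEN iffD1, rotated]) (auto simp: \<tau>_def space_restrict_space)
  have \<tau>pos: "\<tau> z > 0" for z by (simp add: \<tau>_def \<sigma>'pos)
  have box: "Ap_boxes u p (max C1 1) (\<lambda>z. u z * \<tau> z) (\<lambda>z. u z * \<tau> z powr (- 1 / (p - 1)))"
    unfolding Ap_boxes_def
  proof (intro allI impI)
    fix \<theta> l assume l: "0 < l" "l \<le> (1::real)"
    let ?Q = "Qbox \<theta> l" and ?S = "\<psi> ` Qbox \<theta> l"
    have Q: "?Q \<in> sets lebesgue" "?Q \<subseteq> unit_disc" "unit_disc \<in> sets lebesgue" using Qbox_subset_disc by auto
    have S: "?S \<in> sets lebesgue" "emeasure lebesgue ?S = (\<integral>\<^sup>+z\<in>?Q. ennreal (u z) \<partial>lebesgue)"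
      using emeasure_conformal_image[OF Q(1,2) open_ball hol inj_on_subset[OF inj Q(2)]] by (auto simp: u_def)
    have S\<Omega>: "?S \<subseteq> \<Omega>" using Q(2) \<Omega> by blast
    \<comment> \<open>The B_2 condition is used only for its by-product that the u-mass of the box,
      which is the area of its image, is finite and positive.\<close>
    obtain C where "Ap_boxes (\<lambda>_. 1) 2 C u (\<lambda>z. u z powr (- 1 / (2 - 1)))"
      by (rule u_box[of 2]) auto
    then obtain \<mu> where \<mu>: "disc_mass u ?Q = ennreal \<mu>" "\<mu> > 0"
      using Ap_boxesE[OF _ l] by metis
    have "emeasure lebesgue ?S = ennreal \<mu>"
      unfolding S(2) \<mu>(1)[symmetric] nn_integral_lebesgue_on_subset[OF Q, symmetric]
      using Q by (simp add: nn_integral_restrict_space)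
    moreover have "\<sigma> \<in> borel_measurable (lebesgue_on ?S)"
      using \<sigma>m S\<Omega> by (meson measurable_restrict_mono)
    ultimately obtain V V' where VV: "(\<integral>\<^sup>+z. ennreal (\<sigma> z) \<partial>lebesgue_on ?S) = ennreal V" "V > 0"
      "(\<integral>\<^sup>+z. ennreal (\<sigma> z powr (- 1 / (p - 1))) \<partial>lebesgue_on ?S) = ennreal V'" "V' > 0"
      "V * V' powr (p - 1) \<le> C1 * \<mu> powr p"
      using Bp_average_bound[OF S(1) _ \<mu>(2) p _ AES(1)[OF S(1) S\<Omega>] C1[OF l, of \<theta>]] by blast
    have tr: "(\<integral>\<^sup>+w. ennreal (h (\<sigma> w)) \<partial>lebesgue_on ?S) = (\<integral>\<^sup>+z\<in>?Q. ennreal (u z * h (\<tau> z)) \<partial>disc_measure)"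
      if h[measurable]: "h \<in> borel_measurable borel" for h :: "real \<Rightarrow> real"
    proof -
      have "(\<integral>\<^sup>+w. ennreal (h (\<sigma> w)) \<partial>lebesgue_on ?S) = (\<integral>\<^sup>+w. ennreal (h (\<sigma>' w)) \<partial>lebesgue_on ?S)"
        using AES(2)[OF S(1) S\<Omega>] by (intro nn_integral_cong_AE) (auto elim!: eventually_mono)
      also have "\<dots> = (\<integral>\<^sup>+z\<in>?Q. ennreal (u z) * ennreal (h (\<sigma>' (\<psi> z))) \<partial>disc_measure)"
        by (rule nn_integral_image_box[OF _ Q(1,2), unfolded \<Omega>]) measurable
      also have "\<dots> = (\<integral>\<^sup>+z\<in>?Q. ennreal (u z * h (\<tau> z)) \<partial>disc_measure)"
        by (rule nn_integral_cong) (auto simp: \<tau>_def space_restrict_space ennreal_mult'[OF u_nonneg])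
      finally show ?thesis .
    qed
    have "C1 * \<mu> powr p \<le> max C1 1 * \<mu> powr p" by (intro mult_right_mono) auto
    then have "V * V' powr (p - 1) \<le> max C1 1 * \<mu> powr p" using VV(5) by linarith
    moreover have "(\<integral>\<^sup>+z\<in>?Q. ennreal (u z * \<tau> z) \<partial>disc_measure) = ennreal V"
      using tr[of "\<lambda>x. x"] VV(1) by simp
    moreover have "(\<integral>\<^sup>+z\<in>?Q. ennreal (u z * \<tau> z powr (- 1 / (p - 1))) \<partial>disc_measure) = ennreal V'"
      using tr[of "\<lambda>x. x powr (- 1 / (p - 1))"] VV(3) by simp
    ultimately show "\<exists>V V' \<mu>. V > 0 \<and> V' > 0 \<and> \<mu> > 0 \<and>
      (\<integral>\<^sup>+z\<in>?Q. ennreal (u z * \<tau> z) \<partial>disc_measure) = ennreal V \<and>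
      (\<integral>\<^sup>+z\<in>?Q. ennreal (u z * \<tau> z powr (- 1 / (p - 1))) \<partial>disc_measure) = ennreal V' \<and>
      disc_mass u ?Q = ennreal \<mu> \<and> V * V' powr (p - 1) \<le> max C1 1 * \<mu> powr p"
      using VV(2,4) \<mu> by blast
  qed
  have C0: "max C1 1 > 0" by simp
  obtain C where C: "\<And>F G. F \<in> borel_measurable disc_measure \<Longrightarrow> (\<And>z. F z \<ge> 0) \<Longrightarrow> (\<And>z. G z \<ge> 0) \<Longrightarrow>
    (\<And>z. z \<in> unit_disc \<Longrightarrow> ennreal (G z) \<le> (\<integral>\<^sup>+w. ennreal (F w / (cmod (1 - cnj z * w))\<^sup>2) \<partial>disc_measure)) \<Longrightarrow>
    (\<integral>\<^sup>+z. ennreal (G z powr p * (\<tau> z * u z powr (1 - p/2))) \<partial>disc_measure)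
      \<le> ennreal C * (\<integral>\<^sup>+z. ennreal (F z powr p * (\<tau> z * u z powr (1 - p/2))) \<partial>disc_measure)"
    by (rule Bekolle_disc_bound[OF p \<tau>m \<tau>pos C0 box]) blast+
  \<comment> \<open>Of the factor \<open>u\<close> from the Jacobian, \<open>u powr (p/2)\<close> is
    moved into the p-th power as |\<psi>'|, which leaves \<open>u powr (1 - p/2)\<close> in the
    weight.\<close>
  have conv: "(\<integral>\<^sup>+z\<in>\<Omega>. ennreal (cmod (h z) powr p * \<sigma> z) \<partial>dA) = ennreal (1/pi) *
      (\<integral>\<^sup>+z. ennreal ((cmod (h (\<psi> z)) * cmod (deriv \<psi> z)) powr p * (\<tau> z * u z powr (1 - p/2))) \<partial>disc_measure)"
    if h[measurable]: "h \<in> borel_measurable (lebesgue_on \<Omega>)" for h :: "complex \<Rightarrow> complex"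
  proof -
    have "(\<integral>\<^sup>+z\<in>\<Omega>. ennreal (cmod (h z) powr p * \<sigma> z) \<partial>dA) = ennreal (1/pi) * (\<integral>\<^sup>+z. ennreal (cmod (h z) powr p * \<sigma> z) \<partial>lebesgue_on \<Omega>)"
      by (rule nn_integral_dA[OF \<Omega>s]) measurable
    also have "(\<integral>\<^sup>+z. ennreal (cmod (h z) powr p * \<sigma> z) \<partial>lebesgue_on \<Omega>) = (\<integral>\<^sup>+z. ennreal (cmod (h z) powr p * \<sigma>' z) \<partial>lebesgue_on \<Omega>)"
      using AES(2)[OF \<Omega>s order_refl] by (intro nn_integral_cong_AE) (auto elim!: eventually_mono)
    also have "\<dots> = (\<integral>\<^sup>+z. ennreal (u z) * ennreal (cmod (h (\<psi> z)) powr p * \<sigma>' (\<psi> z)) \<partial>disc_measure)"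
      using nn_integral_conformal[OF open_ball hol inj, of "\<lambda>z. ennreal (cmod (h z) powr p * \<sigma>' z)"] unfolding \<Omega> u_def by simp
    also have "\<dots> = (\<integral>\<^sup>+z. ennreal ((cmod (h (\<psi> z)) * cmod (deriv \<psi> z)) powr p * (\<tau> z * u z powr (1 - p/2))) \<partial>disc_measure)"
    proof (rule nn_integral_cong)
      fix z assume "z \<in> space disc_measure"
      then have z: "z \<in> unit_disc" by (simp add: space_restrict_space)
      have d: "cmod (deriv \<psi> z) > 0" using deriv_nz[OF z] by simp
      have "u z = cmod (deriv \<psi> z) powr 2" using d by (simp add: u_def powr_numeral)
      then have "u z powr (p/2) = cmod (deriv \<psi> z) powr (2 * (p/2))" by (simp only: powr_powr)
      then have "u z powr (p/2) = cmod (deriv \<psi> z) powr p" by simp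
      then have "cmod (deriv \<psi> z) powr p * u z powr (1 - p/2) = u z powr (p/2 + (1 - p/2))"
        by (simp only: powr_add)
      also have "\<dots> = u z" using u_pos[OF z] by simp
      finally have e: "cmod (deriv \<psi> z) powr p * u z powr (1 - p/2) = u z" .
      have "(cmod (h (\<psi> z)) * cmod (deriv \<psi> z)) powr p * (\<tau> z * u z powr (1 - p/2))
          = (cmod (deriv \<psi> z) powr p * u z powr (1 - p/2)) * (cmod (h (\<psi> z)) powr p * \<sigma>' (\<psi> z))"
        using z by (simp add: powr_mult \<tau>_def)
      then show "ennreal (u z) * ennreal (cmod (h (\<psi> z)) powr p * \<sigma>' (\<psi> z)) =
          ennreal ((cmod (h (\<psi> z)) * cmod (deriv \<psi> z)) powr p * (\<tau> z * u z powr (1 - p/2)))"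
        unfolding e by (simp only: ennreal_mult'[OF u_nonneg])
    qed
    finally show ?thesis .
  qed
  show ?thesis
    unfolding bergman_bounded_def
  proof (intro exI[of _ C] allI impI)
    fix f g assume fg: "L2_on \<Omega> f \<and> Lp_on \<Omega> p \<sigma> f \<and> is_bergman_proj \<Omega> f g"
    have fm[measurable]: "f \<in> borel_measurable (lebesgue_on \<Omega>)" and gm[measurable]: "g \<in> borel_measurable (lebesgue_on \<Omega>)"
      using fg by (auto simp: is_bergman_proj_def L2_on_def borel_measurable_dA)
    define F where "F z = cmod (f (\<psi> z)) * cmod (deriv \<psi> z)" for z
    define G where "G z = cmod (g (\<psi> z)) * cmod (deriv \<psi> z)" for z
    have Fm: "F \<in> borel_measurable disc_measure" unfolding F_def by measurable
    have FG: "ennreal (G z) \<le> (\<integral>\<^sup>+w. ennreal (F w / (cmod (1 - cnj z * w))\<^sup>2) \<partial>disc_measure)" if z: "z \<in> unit_disc" for z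
    proof -
      have "ennreal (G z) \<le> ennreal (1/pi) * (\<integral>\<^sup>+w. ennreal (F w / (cmod (1 - cnj z * w))\<^sup>2) \<partial>disc_measure)"
        unfolding F_def G_def using Bergman_projection_pointwise[OF hol inj \<Omega>, of f g z] fg z by simp
      also have "\<dots> \<le> 1 * (\<integral>\<^sup>+w. ennreal (F w / (cmod (1 - cnj z * w))\<^sup>2) \<partial>disc_measure)"
        using pi_gt3 by (intro mult_right_mono) (auto simp: ennreal_le_1)
      finally show ?thesis by simp
    qed
    have "(\<integral>\<^sup>+z. ennreal (G z powr p * (\<tau> z * u z powr (1 - p/2))) \<partial>disc_measure)
      \<le> ennreal C * (\<integral>\<^sup>+z. ennreal (F z powr p * (\<tau> z * u z powr (1 - p/2))) \<partial>disc_measure)"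
      by (rule C[OF Fm _ _ FG]) (auto simp: F_def G_def)
    from mult_left_mono[OF this, of "ennreal (1/pi)"]
    show "(\<integral>\<^sup>+z\<in>\<Omega>. ennreal (cmod (g z) powr p * \<sigma> z) \<partial>dA) \<le> ennreal C * (\<integral>\<^sup>+z\<in>\<Omega>. ennreal (cmod (f z) powr p * \<sigma> z) \<partial>dA)"
      unfolding conv[OF fm] conv[OF gm] F_def G_def by (simp add: mult.left_commute)
  qed
qed

end

theorem theorem1p2:
  fixes \<Omega> :: "complex set" and \<psi> :: "complex \<Rightarrow> complex"
  assumes "open \<Omega>" and "connected \<Omega>" and "bounded \<Omega>" and "simply_connected \<Omega>"
    and "\<psi> holomorphic_on unit_disc" and "inj_on \<psi> unit_disc" and "\<psi> ` unit_disc = \<Omega>"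
    and "\<forall>q>1. Bp_disc q (\<lambda>z. (cmod (deriv \<psi> z))\<^sup>2)"
  shows "\<forall>p \<sigma>. 1 < p \<and> Bp_dom \<psi> \<Omega> p \<sigma> \<longrightarrow> bergman_bounded \<Omega> p \<sigma>"
proof (intro allI impI)
  fix p \<sigma> assume "1 < p \<and> Bp_dom \<psi> \<Omega> p \<sigma>"
  moreover have "conformal_Bekolle \<psi>"
    by (rule conformal_Bekolle.intro) (use assms in auto)
  ultimately show "bergman_bounded \<Omega> p \<sigma>"
    using conformal_Bekolle.bergman_bounded_of_Bp_dom assms(7) by blast
qed

end
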